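(* Let $p$ be a prime, let a compactum $Y$ be $p$-resolvable by an $n$-dimensional compactum and let $\dim Y\geq n+2$. Then the Čech cohomology group $H^2(Y;\mathbb{Z})$ contains a subgroup $H$ isomorphic to $\mathbb{Z}_{p^\infty}$ such that, moreover, for every closed $A\subset Y$ with $\dim A\geq n+2$, the image of $H$ in $H^2(A;\mathbb{Z})$ under the homomorphism induced by the inclusion $A\hookrightarrow Y$ is non-trivial.
   Context: A compactum is a compact metric space. $A_p$ denotes the (topological) group of $p$-adic integers, and $\mathbb{Z}_{p^\infty}=\varinjlim \mathbb{Z}/p^k\mathbb{Z}$ is the Prüfer $p$-group. $\dim$ is covering dimension (the value $\infty$ is allowed for $\dim Y$ and $\dim A$). A compactum $Y$ is $p$-resolvable by a compactum $X$ if there is a continuous free action of $A_p$ on $X$ such that $Y=X/A_p$ (up to homeomorphism). *)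

theory Defs
  imports
    "HOL-Analysis.Analysis"
    "HOL-Computational_Algebra.Primes"
    "HOL-Algebra.Group_Action"
    "HOL-Algebra.Product_Groups"
begin

section \<open>Compacta and covering dimension\<close>

definition compactum :: "'a topology \<Rightarrow> bool" where
  "compactum X \<longleftrightarrow> compact_space X \<and> metrizable_space X"

definition open_cover :: "'a topology \<Rightarrow> 'a set set \<Rightarrow> bool" where
  "open_cover X \<U> \<longleftrightarrow> (\<forall>U\<in>\<U>. openin X U) \<and> \<Union>\<U> = topspace X"

definition refines :: "'a set set \<Rightarrow> 'a set set \<Rightarrow> bool" where
  "refines \<V> \<U> \<longleftrightarrow> (\<forall>V\<in>\<V>. \<exists>U\<in>\<U>. V \<subseteq> U)"

definition covering_dim_le :: "'a topology \<Rightarrow> int \<Rightarrow> bool" where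
  "covering_dim_le X n \<longleftrightarrow>
     (\<forall>\<U>. finite \<U> \<and> open_cover X \<U> \<longrightarrow>
       (\<exists>\<V>. finite \<V> \<and> open_cover X \<V> \<and> refines \<V> \<U> \<and>
         (\<forall>x\<in>topspace X. int (card {V\<in>\<V>. x \<in> V}) \<le> n + 1)))"

text \<open>The empty space has dimension \<open>-1\<close>; the infimum of the empty set is \<open>\<infinity>\<close>.\<close>

definition covering_dim :: "'a topology \<Rightarrow> ereal" where
  "covering_dim X = (INF n\<in>{n. n \<ge> -1 \<and> covering_dim_le X n}. ereal (real_of_int n))"


section \<open>Direct limits of groups\<close>

text \<open>
  \<open>h i k\<close> is the transition homomorphism \<open>G i \<rightarrow> G k\<close> for \<open>leq i k\<close>. The definitions make sense
  for a directed system over a nonempty index set; the unions in \<open>mult\<close> and \<open>one\<close> then range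
  over copies of a single class.
\<close>

definition direct_limit_rel ::
  "'i set \<Rightarrow> ('i \<Rightarrow> 'i \<Rightarrow> bool) \<Rightarrow> ('i \<Rightarrow> 'g monoid) \<Rightarrow> ('i \<Rightarrow> 'i \<Rightarrow> 'g \<Rightarrow> 'g)
    \<Rightarrow> (('i \<times> 'g) \<times> ('i \<times> 'g)) set" where
  "direct_limit_rel I leq G h =
     {((i, x), (j, y)). i \<in> I \<and> j \<in> I \<and> x \<in> carrier (G i) \<and> y \<in> carrier (G j) \<and>
        (\<exists>k\<in>I. leq i k \<and> leq j k \<and> h i k x = h j k y)}"

definition direct_limit ::
  "'i set \<Rightarrow> ('i \<Rightarrow> 'i \<Rightarrow> bool) \<Rightarrow> ('i \<Rightarrow> 'g monoid) \<Rightarrow> ('i \<Rightarrow> 'i \<Rightarrow> 'g \<Rightarrow> 'g)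
    \<Rightarrow> ('i \<times> 'g) set monoid" where
  "direct_limit I leq G h =
     \<lparr>carrier = (SIGMA i:I. carrier (G i)) // direct_limit_rel I leq G h,
      monoid.mult = (\<lambda>a b. \<Union>(i, x)\<in>a. \<Union>(j, y)\<in>b. \<Union>k\<in>{k\<in>I. leq i k \<and> leq j k}.
         direct_limit_rel I leq G h `` {(k, h i k x \<otimes>\<^bsub>G k\<^esub> h j k y)}),
      one = (\<Union>i\<in>I. direct_limit_rel I leq G h `` {(i, \<one>\<^bsub>G i\<^esub>)})\<rparr>"


section \<open>The Pruefer group\<close>

text \<open>The transition map \<open>\<int>/p\<^sup>j \<rightarrow> \<int>/p\<^sup>k\<close> is multiplication by \<open>p\<^sup>k\<^sup>-\<^sup>j\<close>.\<close>

definition prufer_group :: "nat \<Rightarrow> (nat \<times> int) set monoid" where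
  "prufer_group p = direct_limit UNIV (\<le>) (\<lambda>k. integer_mod_group (p ^ k))
     (\<lambda>j k x. (int p ^ (k - j) * x) mod int p ^ k)"


section \<open>The topological group of \<open>p\<close>-adic integers and \<open>p\<close>-resolvability\<close>

text \<open>\<open>A\<^sub>p\<close> is the inverse limit of the groups \<open>\<int>/p\<^sup>k\<close>, as a subgroup and subspace of their product.\<close>

definition padic_carrier :: "nat \<Rightarrow> (nat \<Rightarrow> int) set" where
  "padic_carrier p =
     {x \<in> carrier (product_group UNIV (\<lambda>k. integer_mod_group (p ^ k))).
        \<forall>k. x (Suc k) mod int p ^ k = x k}"

definition padic_group :: "nat \<Rightarrow> (nat \<Rightarrow> int) monoid" where
  "padic_group p = (product_group UNIV (\<lambda>k. integer_mod_group (p ^ k))) \<lparr>carrier := padic_carrier p\<rparr>"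

definition padic_topology :: "nat \<Rightarrow> (nat \<Rightarrow> int) topology" where
  "padic_topology p = subtopology
     (product_topology (\<lambda>k. discrete_topology (carrier (integer_mod_group (p ^ k)))) UNIV)
     (padic_carrier p)"

definition continuous_action ::
  "('g, 'm) monoid_scheme \<Rightarrow> 'g topology \<Rightarrow> 'a topology \<Rightarrow> ('g \<Rightarrow> 'a \<Rightarrow> 'a) \<Rightarrow> bool" where
  "continuous_action G T X \<phi> \<longleftrightarrow>
     group_action G (topspace X) \<phi> \<and>
     continuous_map (prod_topology T X) X (\<lambda>(g, x). \<phi> g x)"

definition free_action :: "('g, 'm) monoid_scheme \<Rightarrow> 'a set \<Rightarrow> ('g \<Rightarrow> 'a \<Rightarrow> 'a) \<Rightarrow> bool" where
  "free_action G E \<phi> \<longleftrightarrow> (\<forall>x\<in>E. stabilizer G \<phi> x = {\<one>\<^bsub>G\<^esub>})"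

definition orbit_space ::
  "('g, 'm) monoid_scheme \<Rightarrow> 'a topology \<Rightarrow> ('g \<Rightarrow> 'a \<Rightarrow> 'a) \<Rightarrow> 'a set topology" where
  "orbit_space G X \<phi> = topology (\<lambda>\<O>. \<O> \<subseteq> orbits G (topspace X) \<phi> \<and>
     openin X {x \<in> topspace X. orbit G \<phi> x \<in> \<O>})"

lemma openin_orbit_space:
  "openin (orbit_space G X \<phi>) \<O> \<longleftrightarrow>
     \<O> \<subseteq> orbits G (topspace X) \<phi> \<and> openin X {x \<in> topspace X. orbit G \<phi> x \<in> \<O>}"
proof -
  have "istopology (\<lambda>\<O>. \<O> \<subseteq> orbits G (topspace X) \<phi> \<and>
     openin X {x \<in> topspace X. orbit G \<phi> x \<in> \<O>})"
    unfolding istopology_def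
  proof (intro conjI allI impI)
    fix S T
    assume S: "S \<subseteq> orbits G (topspace X) \<phi> \<and> openin X {x \<in> topspace X. orbit G \<phi> x \<in> S}"
      and T: "T \<subseteq> orbits G (topspace X) \<phi> \<and> openin X {x \<in> topspace X. orbit G \<phi> x \<in> T}"
    show "S \<inter> T \<subseteq> orbits G (topspace X) \<phi>" using S by blast
    have "{x \<in> topspace X. orbit G \<phi> x \<in> S \<inter> T} =
        {x \<in> topspace X. orbit G \<phi> x \<in> S} \<inter> {x \<in> topspace X. orbit G \<phi> x \<in> T}" by blast
    then show "openin X {x \<in> topspace X. orbit G \<phi> x \<in> S \<inter> T}"
      using S T by (metis (no_types, lifting) openin_Int)
  next
    fix \<K>
    assume K: "\<forall>K\<in>\<K>. K \<subseteq> orbits G (topspace X) \<phi> \<and>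
        openin X {x \<in> topspace X. orbit G \<phi> x \<in> K}"
    show "\<Union>\<K> \<subseteq> orbits G (topspace X) \<phi>" using K by blast
    have "{x \<in> topspace X. orbit G \<phi> x \<in> \<Union>\<K>} =
        (\<Union>K\<in>\<K>. {x \<in> topspace X. orbit G \<phi> x \<in> K})" by blast
    then show "openin X {x \<in> topspace X. orbit G \<phi> x \<in> \<Union>\<K>}" using K by auto
  qed
  then show ?thesis by (simp add: orbit_space_def)
qed

definition p_resolvable_by :: "nat \<Rightarrow> 'b topology \<Rightarrow> 'a topology \<Rightarrow> bool" where
  "p_resolvable_by p Y X \<longleftrightarrow>
     (\<exists>\<phi>. continuous_action (padic_group p) (padic_topology p) X \<phi> \<and>
          free_action (padic_group p) (topspace X) \<phi> \<and>
          Y homeomorphic_space orbit_space (padic_group p) X \<phi>)"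


section \<open>Cech cohomology with integer coefficients\<close>

text \<open>
  The complex of a cover \<open>\<U>\<close> is the complex of all (ordered, possibly degenerate) integral
  cochains of its nerve: an ordered \<open>q\<close>-simplex is a list of \<open>q + 1\<close> members of \<open>\<U>\<close>, repetitions
  allowed, with nonempty intersection.
\<close>

definition nerve_simplices :: "nat \<Rightarrow> 'a set set \<Rightarrow> 'a set list set" where
  "nerve_simplices q \<U> = {s. length s = Suc q \<and> set s \<subseteq> \<U> \<and> \<Inter>(set s) \<noteq> {}}"

definition nerve_cochains :: "nat \<Rightarrow> 'a set set \<Rightarrow> ('a set list \<Rightarrow> int) monoid" where
  "nerve_cochains q \<U> = product_group (nerve_simplices q \<U>) (\<lambda>_. integer_group)"

definition nerve_coboundary ::
  "nat \<Rightarrow> 'a set set \<Rightarrow> ('a set list \<Rightarrow> int) \<Rightarrow> ('a set list \<Rightarrow> int)" where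
  "nerve_coboundary q \<U> f =
     (\<lambda>s\<in>nerve_simplices (Suc q) \<U>. \<Sum>i\<le>Suc q. (-1) ^ i * f (take i s @ drop (Suc i) s))"

definition nerve_cocycles :: "nat \<Rightarrow> 'a set set \<Rightarrow> ('a set list \<Rightarrow> int) set" where
  "nerve_cocycles q \<U> = kernel (nerve_cochains q \<U>) (nerve_cochains (Suc q) \<U>) (nerve_coboundary q \<U>)"

definition nerve_coboundaries :: "nat \<Rightarrow> 'a set set \<Rightarrow> ('a set list \<Rightarrow> int) set" where
  "nerve_coboundaries q \<U> = (case q of
       0 \<Rightarrow> {\<one>\<^bsub>nerve_cochains 0 \<U>\<^esub>}
     | Suc r \<Rightarrow> nerve_coboundary r \<U> ` carrier (nerve_cochains r \<U>))"

definition nerve_cohomology :: "nat \<Rightarrow> 'a set set \<Rightarrow> ('a set list \<Rightarrow> int) set monoid" where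
  "nerve_cohomology q \<U> =
     (nerve_cochains q \<U>) \<lparr>carrier := nerve_cocycles q \<U>\<rparr> Mod nerve_coboundaries q \<U>"

text \<open>
  For \<open>f : X \<rightarrow> Y\<close>, a cover \<open>\<V>\<close> of \<open>X\<close> and a cover \<open>\<U>\<close> of \<open>Y\<close>, a projection is a map
  \<open>r : \<V> \<rightarrow> \<U>\<close> with \<open>f(V) \<subseteq> r(V)\<close>; it is a simplicial map of nerves. Any two projections are
  contiguous and hence agree on cohomology, so the union below is over copies of a single coset.
\<close>

definition projections :: "('a \<Rightarrow> 'b) \<Rightarrow> 'a set set \<Rightarrow> 'b set set \<Rightarrow> ('a set \<Rightarrow> 'b set) set" where
  "projections f \<V> \<U> = {r \<in> \<V> \<rightarrow> \<U>. \<forall>V\<in>\<V>. f ` V \<subseteq> r V}"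

definition nerve_cohomology_map ::
  "nat \<Rightarrow> ('a \<Rightarrow> 'b) \<Rightarrow> 'a set set \<Rightarrow> 'b set set
    \<Rightarrow> ('b set list \<Rightarrow> int) set \<Rightarrow> ('a set list \<Rightarrow> int) set" where
  "nerve_cohomology_map q f \<V> \<U> c =
     (\<Union>r\<in>projections f \<V> \<U>. \<Union>z\<in>c.
        nerve_coboundaries q \<V> #>\<^bsub>nerve_cochains q \<V>\<^esub> (\<lambda>s\<in>nerve_simplices q \<V>. z (map r s)))"

definition cech_cohomology ::
  "nat \<Rightarrow> 'a topology \<Rightarrow> ('a set set \<times> ('a set list \<Rightarrow> int) set) set monoid" where
  "cech_cohomology q X = direct_limit {\<U>. open_cover X \<U>} (\<lambda>\<U> \<V>. refines \<V> \<U>)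
     (nerve_cohomology q) (\<lambda>\<U> \<V>. nerve_cohomology_map q id \<V> \<U>)"

definition cech_class ::
  "nat \<Rightarrow> 'a topology \<Rightarrow> 'a set set \<Rightarrow> ('a set list \<Rightarrow> int) set
    \<Rightarrow> ('a set set \<times> ('a set list \<Rightarrow> int) set) set" where
  "cech_class q X \<U> c = direct_limit_rel {\<U>. open_cover X \<U>} (\<lambda>\<U> \<V>. refines \<V> \<U>)
     (nerve_cohomology q) (\<lambda>\<U> \<V>. nerve_cohomology_map q id \<V> \<U>) `` {(\<U>, c)}"

definition pullback_cover :: "'a topology \<Rightarrow> ('a \<Rightarrow> 'b) \<Rightarrow> 'b set set \<Rightarrow> 'a set set" where
  "pullback_cover X f \<U> = (\<lambda>U. {x \<in> topspace X. f x \<in> U}) ` \<U>"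

text \<open>
  The homomorphism \<open>H\<^sup>q(Y;\<int>) \<rightarrow> H\<^sup>q(X;\<int>)\<close> induced by a continuous map \<open>f : X \<rightarrow> Y\<close>; again the
  union is over copies of a single class.
\<close>

definition cech_map ::
  "nat \<Rightarrow> 'a topology \<Rightarrow> ('a \<Rightarrow> 'b)
    \<Rightarrow> ('b set set \<times> ('b set list \<Rightarrow> int) set) set
    \<Rightarrow> ('a set set \<times> ('a set list \<Rightarrow> int) set) set" where
  "cech_map q X f a = (\<Union>(\<U>, c)\<in>a.
     cech_class q X (pullback_cover X f \<U>)
       (nerve_cohomology_map q f (pullback_cover X f \<U>) \<U> c))"

end

theory Submission
  imports Defs "HOL-Algebra.Multiplicative_Group"
begin

text \<open>
  The group \<open>A\<^sub>p\<close> acts freely on \<open>X\<close> with quotient \<open>Y\<close>, so \<open>Y\<close> is the base of the principal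
  \<open>\<int>/p\<^sup>k\<close>-bundles \<open>X/p\<^sup>kA\<^sub>p \<rightarrow> Y\<close>. Their classes in \<open>H\<^sup>1(Y; \<int>/p\<^sup>k)\<close> are compatible under reduction, and
  hence their Bockstein images \<open>b\<^sub>k \<in> H\<^sup>2(Y; \<int>)\<close> satisfy \<open>p b\<^sub>k\<^sub>+\<^sub>1 = b\<^sub>k\<close> and \<open>b\<^sub>0 = 0\<close>
  (\<open>bockstein_class_step\<close>, \<open>bockstein_class_0\<close>). Such a tower is a homomorphism from the Pruefer group.
  Every proper quotient of the Pruefer group is isomorphic to it, so the subgroup \<open>H\<close> generated by the
  \<open>b\<^sub>k\<close> is a copy of it or trivial (\<open>prufer_subgroup_of_tower\<close>). Everything therefore follows from one
  claim, applied to \<open>A = Y\<close> and to the given \<open>A\<close>: if all \<open>b\<^sub>k\<close> vanish on a closed set \<open>A\<close>, then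
  \<open>dim A \<le> n + 1\<close>.

  If \<open>b\<^sub>k\<close> vanishes on \<open>A\<close>, the class of the bundle over \<open>A\<close> lifts to an integral class, that is, to a
  map from \<open>A\<close> to the circle, and the bundle is the pullback of the \<open>p\<^sup>k\<close>-fold covering of the circle.
  In other words, the preimage \<open>X\<^sub>A\<close> of \<open>A\<close> carries an angle on which \<open>A\<^sub>p\<close> acts by rotations through
  \<open>\<int>/p\<^sup>k\<close> (\<open>trivial_bockstein_angle\<close>). The space that controls the dimension is the mapping torus of a
  topological generator of \<open>A\<^sub>p\<close> acting on \<open>X\<^sub>A\<close>: it is locally the product of \<open>X\<^sub>A\<close> and an arc, so its
  dimension is at most \<open>n + 1\<close>, and a fine cover of it comes from a circle bundle over \<open>A\<close> at some
  finite stage \<open>k\<close>, of which the angle is a section. Pulling the cover back along this section bounds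
  \<open>dim A\<close>. The lemma \<open>quotient_covering_dim_le\<close> writes down the resulting cover of \<open>A\<close> directly.

  The Cech classes are made from concrete cochains. Small open sets \<open>N \<subseteq> X\<close> give the charts \<open>\<pi>(N)\<close>: by
  compactness and freeness the translation between two small sets is a single residue modulo \<open>p\<^sup>k\<close>
  (\<open>good_radius_exists\<close>), and these residues are the transitions of the bundle.
\<close>

section \<open>Direct limits of abelian groups\<close>

locale directed_system =
  fixes I :: "'i set" and leq :: "'i \<Rightarrow> 'i \<Rightarrow> bool"
    and G :: "'i \<Rightarrow> 'g monoid" and h :: "'i \<Rightarrow> 'i \<Rightarrow> 'g \<Rightarrow> 'g"
  assumes nonempty: "I \<noteq> {}"
    and refl: "i \<in> I \<Longrightarrow> leq i i"
    and trans: "\<lbrakk>i \<in> I; j \<in> I; k \<in> I; leq i j; leq j k\<rbrakk> \<Longrightarrow> leq i k"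
    and directed: "\<lbrakk>i \<in> I; j \<in> I\<rbrakk> \<Longrightarrow> \<exists>k\<in>I. leq i k \<and> leq j k"
    and comm_groups: "i \<in> I \<Longrightarrow> comm_group (G i)"
    and transition_hom: "\<lbrakk>i \<in> I; j \<in> I; leq i j\<rbrakk> \<Longrightarrow> h i j \<in> hom (G i) (G j)"
    and transition_id: "\<lbrakk>i \<in> I; x \<in> carrier (G i)\<rbrakk> \<Longrightarrow> h i i x = x"
    and transition_comp: "\<lbrakk>i \<in> I; j \<in> I; k \<in> I; leq i j; leq j k; x \<in> carrier (G i)\<rbrakk>
                            \<Longrightarrow> h j k (h i j x) = h i k x"
begin

abbreviation "R \<equiv> direct_limit_rel I leq G h"
abbreviation "L \<equiv> direct_limit I leq G h"

definition cl :: "'i \<Rightarrow> 'g \<Rightarrow> ('i \<times> 'g) set" where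
  "cl i x = R `` {(i, x)}"

lemma transition_closed:
  "\<lbrakk>i \<in> I; j \<in> I; leq i j; x \<in> carrier (G i)\<rbrakk> \<Longrightarrow> h i j x \<in> carrier (G j)"
  using transition_hom by (auto simp: hom_def)

lemma transition_mult:
  "\<lbrakk>i \<in> I; j \<in> I; leq i j; x \<in> carrier (G i); y \<in> carrier (G i)\<rbrakk>
    \<Longrightarrow> h i j (x \<otimes>\<^bsub>G i\<^esub> y) = h i j x \<otimes>\<^bsub>G j\<^esub> h i j y"
  using transition_hom by (auto simp: hom_def)

lemma groups: "i \<in> I \<Longrightarrow> group (G i)"
  using comm_groups comm_group.axioms(2) by blast

lemma transition_one:
  assumes "i \<in> I" "j \<in> I" "leq i j"
  shows "h i j \<one>\<^bsub>G i\<^esub> = \<one>\<^bsub>G j\<^esub>"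
  using hom_one[OF transition_hom[OF assms] groups groups] assms by blast

lemma in_R_iff:
  "((i, x), (j, y)) \<in> R \<longleftrightarrow> i \<in> I \<and> j \<in> I \<and> x \<in> carrier (G i) \<and> y \<in> carrier (G j) \<and>
     (\<exists>k\<in>I. leq i k \<and> leq j k \<and> h i k x = h j k y)"
  by (simp add: direct_limit_rel_def)

lemma equiv_R: "equiv (SIGMA i:I. carrier (G i)) R"
proof (rule equivI)
  show "R \<subseteq> (SIGMA i:I. carrier (G i)) \<times> (SIGMA i:I. carrier (G i))"
    by (auto simp: direct_limit_rel_def)
  show "refl_on (SIGMA i:I. carrier (G i)) R"
    using refl by (fastforce simp: refl_on_def in_R_iff)
  show "sym R"
    by (force simp: sym_def direct_limit_rel_def)
  show "Relation.trans R"
  proof (rule transI)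
    fix u v w assume "(u, v) \<in> R" "(v, w) \<in> R"
    moreover obtain i x j y k z where uvw: "u = (i, x)" "v = (j, y)" "w = (k, z)"
      by (metis surj_pair)
    ultimately obtain a b where
        I: "i \<in> I" "j \<in> I" "k \<in> I" "a \<in> I" "b \<in> I"
      and c: "x \<in> carrier (G i)" "y \<in> carrier (G j)" "z \<in> carrier (G k)"
      and a: "leq i a" "leq j a" "h i a x = h j a y"
      and b: "leq j b" "leq k b" "h j b y = h k b z"
      by (auto simp: in_R_iff)
    obtain m where m: "m \<in> I" "leq a m" "leq b m"
      using directed I by blast
    have "h i m x = h a m (h i a x)" using transition_comp I m a c by metis
    also have "\<dots> = h j m y" using transition_comp I m a c by metis
    also have "\<dots> = h b m (h j b y)" using transition_comp I m b c by metis
    also have "\<dots> = h k m z" using transition_comp I m b c by metis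
    finally show "(u, w) \<in> R"
      using I c m a b trans unfolding uvw in_R_iff by blast
  qed
qed

lemma cl_eq_iff:
  assumes "i \<in> I" "j \<in> I" "x \<in> carrier (G i)" "y \<in> carrier (G j)"
  shows "cl i x = cl j y \<longleftrightarrow> (\<exists>k\<in>I. leq i k \<and> leq j k \<and> h i k x = h j k y)"
  unfolding cl_def using equiv_R assms
  by (subst eq_equiv_class_iff) (auto simp: in_R_iff)

lemma carrier_limit: "carrier L = {cl i x |i x. i \<in> I \<and> x \<in> carrier (G i)}"
  by (auto simp: direct_limit_def quotient_def cl_def)

lemma cl_closed [intro]: "\<lbrakk>i \<in> I; x \<in> carrier (G i)\<rbrakk> \<Longrightarrow> cl i x \<in> carrier L"
  by (auto simp: carrier_limit)

lemma cl_transition: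
  assumes "i \<in> I" "j \<in> I" "leq i j" "x \<in> carrier (G i)"
  shows "cl j (h i j x) = cl i x"
  using assms refl transition_closed transition_id
  by (subst cl_eq_iff) (auto intro!: bexI[of _ j])

lemma in_cl_iff:
  "(j, y) \<in> cl i x \<longleftrightarrow> i \<in> I \<and> j \<in> I \<and> x \<in> carrier (G i) \<and> y \<in> carrier (G j) \<and> cl j y = cl i x"
  unfolding cl_def using equiv_class_eq_iff[OF equiv_R, of "(j, y)" "(i, x)"] symD[of R] equiv_R
  by (auto simp: equiv_def)

lemma mult_cl:
  assumes "i \<in> I" "j \<in> I" "k \<in> I" "leq i k" "leq j k" "x \<in> carrier (G i)" "y \<in> carrier (G j)"
  shows "cl i x \<otimes>\<^bsub>L\<^esub> cl j y = cl k (h i k x \<otimes>\<^bsub>G k\<^esub> h j k y)"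
proof -
  interpret K: comm_group "G k" using assms comm_groups by blast
  have key: "cl l (h i' l x' \<otimes>\<^bsub>G l\<^esub> h j' l y') = cl k (h i k x \<otimes>\<^bsub>G k\<^esub> h j k y)"
    if u: "(i', x') \<in> cl i x" and v: "(j', y') \<in> cl j y"
      and l: "l \<in> I" "leq i' l" "leq j' l" for i' x' j' y' l
  proof -
    have I': "i' \<in> I" "j' \<in> I" "x' \<in> carrier (G i')" "y' \<in> carrier (G j')"
      and e: "cl i' x' = cl i x" "cl j' y' = cl j y"
      using u v by (auto simp: in_cl_iff)
    have "cl l (h i' l x') = cl k (h i k x)" "cl l (h j' l y') = cl k (h j k y)"
      using e cl_transition[OF I'(1) l(1) l(2) I'(3)] cl_transition[OF I'(2) l(1) l(3) I'(4)]
        cl_transition[OF assms(1,3,4,6)] cl_transition[OF assms(2,3,5,7)] by simp_all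
    moreover have c1: "h i' l x' \<in> carrier (G l)" "h j' l y' \<in> carrier (G l)"
      "h i k x \<in> carrier (G k)" "h j k y \<in> carrier (G k)"
      using transition_closed[OF I'(1) l(1) l(2) I'(3)] transition_closed[OF I'(2) l(1) l(3) I'(4)]
        transition_closed[OF assms(1,3,4,6)] transition_closed[OF assms(2,3,5,7)] by simp_all
    ultimately obtain a b where a: "a \<in> I" "leq l a" "leq k a" "h l a (h i' l x') = h k a (h i k x)"
      and b: "b \<in> I" "leq l b" "leq k b" "h l b (h j' l y') = h k b (h j k y)"
      using cl_eq_iff[OF l(1) assms(3)] by meson
    obtain m where m: "m \<in> I" "leq a m" "leq b m" using directed a b by blast
    have lm: "leq l m" "leq k m" using trans m a l assms by blast+
    have e1: "h l m (h i' l x') = h k m (h i k x)"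
      using transition_comp[OF _ _ m(1) _ m(2)] a c1 l assms by metis
    have e2: "h l m (h j' l y') = h k m (h j k y)"
      using transition_comp[OF _ _ m(1) _ m(3)] b c1 l assms by metis
    have gl: "group (G l)" using groups l by blast
    have "h l m (h i' l x' \<otimes>\<^bsub>G l\<^esub> h j' l y') = h k m (h i k x \<otimes>\<^bsub>G k\<^esub> h j k y)"
      using transition_mult l m lm c1 assms e1 e2 by simp
    then show ?thesis
      using c1 l m lm assms gl by (subst cl_eq_iff) (auto simp: group.is_monoid monoid.m_closed)
  qed
  have mem: "(i, x) \<in> cl i x" "(j, y) \<in> cl j y"
    using assms by (simp_all add: in_cl_iff)
  have eq: "cl i x \<otimes>\<^bsub>L\<^esub> cl j y =
      (\<Union>(i', x')\<in>cl i x. \<Union>(j', y')\<in>cl j y. \<Union>l\<in>{l \<in> I. leq i' l \<and> leq j' l}.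
         cl l (h i' l x' \<otimes>\<^bsub>G l\<^esub> h j' l y'))"
    by (simp add: direct_limit_def cl_def)
  show ?thesis
  proof
    show "cl i x \<otimes>\<^bsub>L\<^esub> cl j y \<subseteq> cl k (h i k x \<otimes>\<^bsub>G k\<^esub> h j k y)"
      unfolding eq by (intro UN_least, clarify, drule (4) key) blast
    show "cl k (h i k x \<otimes>\<^bsub>G k\<^esub> h j k y) \<subseteq> cl i x \<otimes>\<^bsub>L\<^esub> cl j y"
      unfolding eq using mem assms(3-5) by blast
  qed
qed

lemma mult_cl_same:
  assumes "i \<in> I" "x \<in> carrier (G i)" "y \<in> carrier (G i)"
  shows "cl i x \<otimes>\<^bsub>L\<^esub> cl i y = cl i (x \<otimes>\<^bsub>G i\<^esub> y)"
  using mult_cl[OF assms(1,1,1) refl[OF assms(1)] refl[OF assms(1)] assms(2,3)]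
  by (simp only: transition_id[OF assms(1)] assms)

lemma one_limit:
  assumes "i \<in> I"
  shows "\<one>\<^bsub>L\<^esub> = cl i \<one>\<^bsub>G i\<^esub>"
proof -
  have eq: "cl j \<one>\<^bsub>G j\<^esub> = cl i \<one>\<^bsub>G i\<^esub>" if jI: "j \<in> I" for j
  proof -
    obtain k where k: "k \<in> I" "leq j k" "leq i k" using directed[OF jI assms] by blast
    have "cl j \<one>\<^bsub>G j\<^esub> = cl k \<one>\<^bsub>G k\<^esub>"
      using cl_transition[OF jI k(1,2)] transition_one[OF jI k(1,2)]
        monoid.one_closed[OF group.is_monoid[OF groups[OF jI]]] by metis
    also have "\<dots> = cl i \<one>\<^bsub>G i\<^esub>"
      using cl_transition[OF assms k(1,3)] transition_one[OF assms k(1,3)]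
        monoid.one_closed[OF group.is_monoid[OF groups[OF assms]]] by metis
    finally show ?thesis .
  qed
  have "\<one>\<^bsub>L\<^esub> = (\<Union>j\<in>I. cl j \<one>\<^bsub>G j\<^esub>)"
    by (simp add: direct_limit_def cl_def)
  also have "\<dots> = (\<Union>j\<in>I. cl i \<one>\<^bsub>G i\<^esub>)" using eq by (intro SUP_cong HOL.refl)
  finally show ?thesis using assms by auto
qed

text \<open>By directedness the group laws of the limit can be checked at one stage.\<close>

lemma common_stage2:
  assumes "a \<in> carrier L" "b \<in> carrier L"
  obtains i x y where "i \<in> I" "x \<in> carrier (G i)" "y \<in> carrier (G i)" "a = cl i x" "b = cl i y"
proof -
  obtain i x j y where *: "i \<in> I" "j \<in> I" "x \<in> carrier (G i)" "y \<in> carrier (G j)" "a = cl i x" "b = cl j y"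
    using assms by (auto simp: carrier_limit)
  obtain k where k: "k \<in> I" "leq i k" "leq j k" using directed * by blast
  show thesis
    using that[of k "h i k x" "h j k y"] * k cl_transition transition_closed by simp
qed

lemma comm_group_limit: "comm_group L"
proof (rule comm_groupI)
  obtain i0 where i0: "i0 \<in> I" using nonempty by blast
  have one: "monoid.one (G i) \<in> carrier (G i)" if "i \<in> I" for i
    using groups that by (simp add: group.is_monoid monoid.one_closed)
  show "\<one>\<^bsub>L\<^esub> \<in> carrier L" using one_limit[OF i0] one[OF i0] i0 by (simp add: cl_closed)
  fix a b assume ab: "a \<in> carrier L" "b \<in> carrier L"
  obtain i x y where i: "i \<in> I" "x \<in> carrier (G i)" "y \<in> carrier (G i)" "a = cl i x" "b = cl i y"
    using common_stage2[OF ab] by blast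
  interpret A: comm_group "G i" using comm_groups i by blast
  show "a \<otimes>\<^bsub>L\<^esub> b \<in> carrier L" "a \<otimes>\<^bsub>L\<^esub> b = b \<otimes>\<^bsub>L\<^esub> a" "\<one>\<^bsub>L\<^esub> \<otimes>\<^bsub>L\<^esub> a = a"
    using i by (simp_all add: mult_cl_same one_limit[of i] cl_closed A.m_comm)
  show "\<exists>y\<in>carrier L. y \<otimes>\<^bsub>L\<^esub> a = \<one>\<^bsub>L\<^esub>"
    using i by (intro bexI[of _ "cl i (inv\<^bsub>G i\<^esub> x)"]) (simp_all add: mult_cl_same one_limit[of i] cl_closed)
  fix c assume "c \<in> carrier L"
  then obtain j z where j: "j \<in> I" "z \<in> carrier (G j)" "c = cl j z"
    by (auto simp: carrier_limit)
  obtain k where k: "k \<in> I" "leq i k" "leq j k" using directed i j by blast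
  interpret B: comm_group "G k" using comm_groups k by blast
  have e: "a = cl k (h i k x)" "b = cl k (h i k y)" "c = cl k (h j k z)"
    using i j k by (simp_all add: cl_transition)
  have "h i k x \<in> carrier (G k)" "h i k y \<in> carrier (G k)" "h j k z \<in> carrier (G k)"
    using i j k by (simp_all add: transition_closed)
  then show "a \<otimes>\<^bsub>L\<^esub> b \<otimes>\<^bsub>L\<^esub> c = a \<otimes>\<^bsub>L\<^esub> (b \<otimes>\<^bsub>L\<^esub> c)"
    unfolding e by (simp only: mult_cl_same[OF k(1)] B.m_closed B.m_assoc)
qed

lemma cl_hom: "i \<in> I \<Longrightarrow> cl i \<in> hom (G i) L"
  by (rule homI) (simp_all add: cl_closed mult_cl_same)

text \<open>Any two elements of the limit have representatives at a common stage, so the homomorphism law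
  and injectivity are both inherited from the legs of the cone. This is how the Pruefer group is
  embedded into cohomology below.\<close>

lemma cone_factors:
  assumes K: "group K" and f: "\<And>i. i \<in> I \<Longrightarrow> f i \<in> hom (G i) K"
    and compat: "\<And>i j x. \<lbrakk>i \<in> I; j \<in> I; leq i j; x \<in> carrier (G i)\<rbrakk> \<Longrightarrow> f j (h i j x) = f i x"
  obtains F where "F \<in> hom L K" "\<And>i x. \<lbrakk>i \<in> I; x \<in> carrier (G i)\<rbrakk> \<Longrightarrow> F (cl i x) = f i x"
    "(\<And>i. i \<in> I \<Longrightarrow> inj_on (f i) (carrier (G i))) \<Longrightarrow> inj_on F (carrier L)"
proof -
  define F where "F a = (case SOME u. u \<in> a of (i, x) \<Rightarrow> f i x)" for a
  have F: "F (cl i x) = f i x" if i: "i \<in> I" "x \<in> carrier (G i)" for i x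
  proof -
    have "(i, x) \<in> cl i x" using i by (simp add: in_cl_iff)
    then have S: "(SOME u. u \<in> cl i x) \<in> cl i x" by (rule someI)
    obtain j y where jy: "(SOME u. u \<in> cl i x) = (j, y)" by (metis surj_pair)
    then have j: "j \<in> I" "y \<in> carrier (G j)" "cl j y = cl i x"
      using S by (auto simp: in_cl_iff)
    then obtain k where "k \<in> I" "leq j k" "leq i k" "h j k y = h i k x"
      using i cl_eq_iff[of j i y x] by blast
    then have "f j y = f i x" using compat i j by metis
    then show ?thesis by (simp add: F_def jy)
  qed
  have 1: "F \<in> hom L K"
  proof (rule homI)
    show "F a \<in> carrier K" if aL: "a \<in> carrier L" for a
    proof -
      obtain i x where "i \<in> I" "x \<in> carrier (G i)" "a = cl i x"
        using aL unfolding carrier_limit by blast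
      then show ?thesis using f[of i] by (auto simp: F hom_def)
    qed
    show  "F (a \<otimes>\<^bsub>L\<^esub> b) = F a \<otimes>\<^bsub>K\<^esub> F b" if ab: "a \<in> carrier L" "b \<in> carrier L" for a b
    proof -
      obtain i x y where i: "i \<in> I" "x \<in> carrier (G i)" "y \<in> carrier (G i)" "a = cl i x" "b = cl i y"
        using common_stage2[OF ab] by blast
      then show ?thesis using f[OF i(1)] groups[OF i(1)]
        by (simp add: mult_cl_same F hom_def group.is_monoid monoid.m_closed)
    qed
  qed
  have 2: "inj_on F (carrier L)" if inj: "\<And>i. i \<in> I \<Longrightarrow> inj_on (f i) (carrier (G i))"
  proof (rule inj_onI)
    fix a b assume ab: "a \<in> carrier L" "b \<in> carrier L" and e: "F a = F b"
    obtain i x y where i: "i \<in> I" "x \<in> carrier (G i)" "y \<in> carrier (G i)" "a = cl i x" "b = cl i y"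
      using common_stage2[OF ab] by blast
    then show "a = b" using e inj[OF i(1)] by (simp add: F inj_on_eq_iff)
  qed
  show thesis by (rule that[OF 1 F 2])
qed

end

section \<open>Second cohomology of a nerve\<close>

abbreviation cocycle_group :: "'a set set \<Rightarrow> ('a set list \<Rightarrow> int) monoid" where
  "cocycle_group \<U> \<equiv> (nerve_cochains 2 \<U>) \<lparr>carrier := nerve_cocycles 2 \<U>\<rparr>"

text \<open>Cochains are curried here and constrained only on
  the nerve, so that the extensionality of the carriers does not have to be carried along.\<close>

definition cobounds :: "'a set set \<Rightarrow> ('a set \<Rightarrow> 'a set \<Rightarrow> int) \<Rightarrow> ('a set \<Rightarrow> 'a set \<Rightarrow> 'a set \<Rightarrow> int) \<Rightarrow> bool" where
  "cobounds \<U> m f \<longleftrightarrow>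
     (\<forall>a b c. [a, b, c] \<in> nerve_simplices 2 \<U> \<longrightarrow> f a b c = m b c - m a c + m a b)"

lemma simplex2_iff:
  "[a, b, c] \<in> nerve_simplices 2 \<U> \<longleftrightarrow> a \<in> \<U> \<and> b \<in> \<U> \<and> c \<in> \<U> \<and> a \<inter> b \<inter> c \<noteq> {}"
  by (auto simp: nerve_simplices_def Int_assoc)

lemma simplex2_cases:
  assumes "s \<in> nerve_simplices 2 \<U>"
  obtains a b c where "s = [a, b, c]"
proof -
  from assms have "length s = Suc (Suc (Suc 0))" by (simp add: nerve_simplices_def)
  then show thesis using that by (auto simp: length_Suc_conv)
qed

lemma simplex3_iff:
  "[a, b, c, d] \<in> nerve_simplices 3 \<U> \<longleftrightarrow>
     a \<in> \<U> \<and> b \<in> \<U> \<and> c \<in> \<U> \<and> d \<in> \<U> \<and> a \<inter> b \<inter> c \<inter> d \<noteq> {}"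
  by (auto simp: nerve_simplices_def Int_assoc numeral_eq_Suc)

lemma simplex3_cases:
  assumes "s \<in> nerve_simplices 3 \<U>"
  obtains a b c d where "s = [a, b, c, d]"
proof -
  from assms have "length s = Suc (Suc (Suc (Suc 0)))" by (simp add: nerve_simplices_def numeral_eq_Suc)
  then show thesis using that by (auto simp: length_Suc_conv)
qed

lemma simplex1_iff:
  "[a, b] \<in> nerve_simplices (Suc 0) \<U> \<longleftrightarrow> a \<in> \<U> \<and> b \<in> \<U> \<and> a \<inter> b \<noteq> {}"
  by (auto simp: nerve_simplices_def)

lemma carrier_nerve_cochains: "carrier (nerve_cochains q \<U>) = extensional (nerve_simplices q \<U>)"
  by (auto simp: nerve_cochains_def PiE_def)

lemma mult_nerve_cochains:
  "z \<otimes>\<^bsub>nerve_cochains q \<U>\<^esub> w = (\<lambda>s\<in>nerve_simplices q \<U>. z s + w s)"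
  by (simp add: nerve_cochains_def)

lemma one_nerve_cochains: "\<one>\<^bsub>nerve_cochains q \<U>\<^esub> = (\<lambda>s\<in>nerve_simplices q \<U>. 0)"
  by (simp add: nerve_cochains_def)

lemma nerve_coboundary_3:
  assumes "[a, b, c, d] \<in> nerve_simplices 3 \<U>"
  shows "nerve_coboundary 2 \<U> z [a, b, c, d] = z [b, c, d] - z [a, c, d] + z [a, b, d] - z [a, b, c]"
  using assms by (simp add: nerve_coboundary_def numeral_eq_Suc atMost_Suc)

lemma nerve_coboundary_2:
  assumes "[a, b, c] \<in> nerve_simplices 2 \<U>"
  shows "nerve_coboundary (Suc 0) \<U> m [a, b, c] = m [b, c] - m [a, c] + m [a, b]"
  using assms by (simp add: nerve_coboundary_def numeral_eq_Suc atMost_Suc)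

lemma nerve_cocycle_iff:
  "z \<in> nerve_cocycles 2 \<U> \<longleftrightarrow> z \<in> extensional (nerve_simplices 2 \<U>) \<and>
     (\<forall>a\<in>\<U>. \<forall>b\<in>\<U>. \<forall>c\<in>\<U>. \<forall>d\<in>\<U>. a \<inter> b \<inter> c \<inter> d \<noteq> {} \<longrightarrow>
        z [b, c, d] - z [a, c, d] + z [a, b, d] - z [a, b, c] = 0)"
proof -
  have "nerve_coboundary 2 \<U> z = \<one>\<^bsub>nerve_cochains 3 \<U>\<^esub> \<longleftrightarrow>
      (\<forall>s\<in>nerve_simplices 3 \<U>. nerve_coboundary 2 \<U> z s = 0)"
    by (auto simp: one_nerve_cochains nerve_coboundary_def fun_eq_iff restrict_def numeral_eq_Suc)
  also have "\<dots> \<longleftrightarrow> (\<forall>a b c d. [a, b, c, d] \<in> nerve_simplices 3 \<U> \<longrightarrow>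
      nerve_coboundary 2 \<U> z [a, b, c, d] = 0)"
    using simplex3_cases by metis
  also have "\<dots> \<longleftrightarrow> (\<forall>a b c d. [a, b, c, d] \<in> nerve_simplices 3 \<U> \<longrightarrow>
      z [b, c, d] - z [a, c, d] + z [a, b, d] - z [a, b, c] = 0)"
    using nerve_coboundary_3 by (metis (no_types, lifting))
  finally have eq: "nerve_coboundary 2 \<U> z = \<one>\<^bsub>nerve_cochains 3 \<U>\<^esub> \<longleftrightarrow>
      (\<forall>a b c d. [a, b, c, d] \<in> nerve_simplices 3 \<U> \<longrightarrow>
         z [b, c, d] - z [a, c, d] + z [a, b, d] - z [a, b, c] = 0)" .
  have "Suc 2 = (3::nat)" by simp
  then have "z \<in> nerve_cocycles 2 \<U> \<longleftrightarrow> z \<in> extensional (nerve_simplices 2 \<U>) \<and>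
      nerve_coboundary 2 \<U> z = \<one>\<^bsub>nerve_cochains 3 \<U>\<^esub>"
    by (simp only: nerve_cocycles_def kernel_def carrier_nerve_cochains mem_Collect_eq)
  then show ?thesis
    unfolding eq simplex3_iff by blast
qed

lemma nerve_cocycleD:
  assumes "z \<in> nerve_cocycles 2 \<U>" "a \<in> \<U>" "b \<in> \<U>" "c \<in> \<U>" "d \<in> \<U>" "a \<inter> b \<inter> c \<inter> d \<noteq> {}"
  shows "z [b, c, d] - z [a, c, d] + z [a, b, d] - z [a, b, c] = 0"
  using assms unfolding nerve_cocycle_iff by blast

lemma nerve_coboundary_iff:
  "z \<in> nerve_coboundaries 2 \<U> \<longleftrightarrow> z \<in> extensional (nerve_simplices 2 \<U>) \<and>
     (\<exists>m. cobounds \<U> m (\<lambda>a b c. z [a, b, c]))"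
proof -
  have 2: "nerve_coboundaries 2 \<U> = nerve_coboundary (Suc 0) \<U> ` extensional (nerve_simplices (Suc 0) \<U>)"
    by (simp add: nerve_coboundaries_def numeral_2_eq_2 carrier_nerve_cochains)
  show ?thesis
  proof (intro iffI conjI; (elim conjE exE)?)
    assume "z \<in> nerve_coboundaries 2 \<U>"
    then obtain m where m: "z = nerve_coboundary (Suc 0) \<U> m"
      by (auto simp: 2)
    show "z \<in> extensional (nerve_simplices 2 \<U>)"
      unfolding m by (simp add: nerve_coboundary_def numeral_2_eq_2)
    have "cobounds \<U> (\<lambda>a b. m [a, b]) (\<lambda>a b c. z [a, b, c])"
      by (simp add: cobounds_def m nerve_coboundary_2)
    then show "\<exists>m. cobounds \<U> m (\<lambda>a b c. z [a, b, c])" by blast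
  next
    fix m assume z: "z \<in> extensional (nerve_simplices 2 \<U>)" and m: "cobounds \<U> m (\<lambda>a b c. z [a, b, c])"
    define m' where "m' = (\<lambda>s\<in>nerve_simplices (Suc 0) \<U>. m (s ! 0) (s ! 1))"
    have "z s = nerve_coboundary (Suc 0) \<U> m' s" for s
    proof (cases "s \<in> nerve_simplices 2 \<U>")
      case True
      then obtain a b c where s: "s = [a, b, c]" using simplex2_cases by blast
      have "[b, c] \<in> nerve_simplices (Suc 0) \<U>" "[a, c] \<in> nerve_simplices (Suc 0) \<U>"
        "[a, b] \<in> nerve_simplices (Suc 0) \<U>"
        using True unfolding s simplex2_iff simplex1_iff by auto
      then show ?thesis using True m unfolding s
        by (simp add: nerve_coboundary_2 m'_def cobounds_def)
    next
      case False
      then show ?thesis using z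
        by (simp add: nerve_coboundary_def numeral_2_eq_2 extensional_def)
    qed
    then show "z \<in> nerve_coboundaries 2 \<U>"
      unfolding 2 by (intro image_eqI[of _ _ m'] ext) (auto simp: m'_def)
  qed
qed

lemma coboundary_imp_cocycle: "nerve_coboundaries 2 \<U> \<subseteq> nerve_cocycles 2 \<U>"
proof
  fix z assume "z \<in> nerve_coboundaries 2 \<U>"
  then obtain m where z: "z \<in> extensional (nerve_simplices 2 \<U>)" and m: "cobounds \<U> m (\<lambda>a b c. z [a, b, c])"
    by (auto simp: nerve_coboundary_iff)
  have *: "z [a, b, c] = m b c - m a c + m a b" if "a \<in> \<U>" "b \<in> \<U>" "c \<in> \<U>" "a \<inter> b \<inter> c \<noteq> {}" for a b c
    using m that by (simp add: cobounds_def simplex2_iff)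
  show "z \<in> nerve_cocycles 2 \<U>"
    unfolding nerve_cocycle_iff
  proof (intro conjI z ballI impI)
    fix a b c d assume U: "a \<in> \<U>" "b \<in> \<U>" "c \<in> \<U>" "d \<in> \<U>" and "a \<inter> b \<inter> c \<inter> d \<noteq> {}"
    then have "b \<inter> c \<inter> d \<noteq> {}" "a \<inter> c \<inter> d \<noteq> {}" "a \<inter> b \<inter> d \<noteq> {}" "a \<inter> b \<inter> c \<noteq> {}" by auto
    with U show "z [b, c, d] - z [a, c, d] + z [a, b, d] - z [a, b, c] = 0"
      by (simp add: *)
  qed
qed

lemma comm_group_cocycles: "comm_group (cocycle_group \<U>)"
proof (rule comm_groupI; simp)
  fix x assume x: "x \<in> nerve_cocycles 2 \<U>"
  have x_ext: "x \<in> extensional (nerve_simplices 2 \<U>)"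
    using x by (simp add: nerve_cocycle_iff)
  have face: "[a, b, c] \<in> nerve_simplices 2 \<U>"
    if "a \<in> \<U>" "b \<in> \<U>" "c \<in> \<U>" "v \<in> a" "v \<in> b" "v \<in> c" for a b c v
    using that by (auto simp: simplex2_iff)
  show "x \<otimes>\<^bsub>nerve_cochains 2 \<U>\<^esub> y \<in> nerve_cocycles 2 \<U>" if y: "y \<in> nerve_cocycles 2 \<U>" for y
    unfolding nerve_cocycle_iff mult_nerve_cochains
  proof (intro conjI ballI impI)
    fix a b c d assume U: "a \<in> \<U>" "b \<in> \<U>" "c \<in> \<U>" "d \<in> \<U>" and ne: "a \<inter> b \<inter> c \<inter> d \<noteq> {}"
    from ne obtain v where "v \<in> a" "v \<in> b" "v \<in> c" "v \<in> d" by blast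
    note face[OF U(2,3,4) this(2,3,4)] face[OF U(1,3,4) this(1,3,4)]
      face[OF U(1,2,4) this(1,2,4)] face[OF U(1,2,3) this(1,2,3)]
    moreover have "x [b, c, d] - x [a, c, d] + x [a, b, d] - x [a, b, c] = 0"
      "y [b, c, d] - y [a, c, d] + y [a, b, d] - y [a, b, c] = 0"
      using nerve_cocycleD[OF x U ne] nerve_cocycleD[OF y U ne] by simp_all
    ultimately show "(\<lambda>s\<in>nerve_simplices 2 \<U>. x s + y s) [b, c, d] - (\<lambda>s\<in>nerve_simplices 2 \<U>. x s + y s) [a, c, d] +
       (\<lambda>s\<in>nerve_simplices 2 \<U>. x s + y s) [a, b, d] - (\<lambda>s\<in>nerve_simplices 2 \<U>. x s + y s) [a, b, c] = 0"
      by simp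
  qed simp
  show "x \<otimes>\<^bsub>nerve_cochains 2 \<U>\<^esub> y = y \<otimes>\<^bsub>nerve_cochains 2 \<U>\<^esub> x" for y
    by (auto simp: mult_nerve_cochains)
  show "x \<otimes>\<^bsub>nerve_cochains 2 \<U>\<^esub> y \<otimes>\<^bsub>nerve_cochains 2 \<U>\<^esub> z =
      x \<otimes>\<^bsub>nerve_cochains 2 \<U>\<^esub> (y \<otimes>\<^bsub>nerve_cochains 2 \<U>\<^esub> z)" for y z
    by (auto simp: mult_nerve_cochains restrict_def)
  show "\<one>\<^bsub>nerve_cochains 2 \<U>\<^esub> \<otimes>\<^bsub>nerve_cochains 2 \<U>\<^esub> x = x"
    unfolding mult_nerve_cochains one_nerve_cochains
    by (rule extensionalityI[of _ "nerve_simplices 2 \<U>"]) (simp_all add: x_ext)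
  show "\<exists>y\<in>nerve_cocycles 2 \<U>. y \<otimes>\<^bsub>nerve_cochains 2 \<U>\<^esub> x = \<one>\<^bsub>nerve_cochains 2 \<U>\<^esub>"
  proof (intro bexI)
    show "(\<lambda>s\<in>nerve_simplices 2 \<U>. - x s) \<otimes>\<^bsub>nerve_cochains 2 \<U>\<^esub> x = \<one>\<^bsub>nerve_cochains 2 \<U>\<^esub>"
      by (auto simp: mult_nerve_cochains one_nerve_cochains restrict_def)
    show "(\<lambda>s\<in>nerve_simplices 2 \<U>. - x s) \<in> nerve_cocycles 2 \<U>"
      unfolding nerve_cocycle_iff
    proof (intro conjI ballI impI)
      fix a b c d assume U: "a \<in> \<U>" "b \<in> \<U>" "c \<in> \<U>" "d \<in> \<U>" and ne: "a \<inter> b \<inter> c \<inter> d \<noteq> {}"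
      from ne obtain v where "v \<in> a" "v \<in> b" "v \<in> c" "v \<in> d" by blast
      note face[OF U(2,3,4) this(2,3,4)] face[OF U(1,3,4) this(1,3,4)]
        face[OF U(1,2,4) this(1,2,4)] face[OF U(1,2,3) this(1,2,3)]
      moreover have "x [b, c, d] - x [a, c, d] + x [a, b, d] - x [a, b, c] = 0"
        by (rule nerve_cocycleD[OF x U ne])
      ultimately show "(\<lambda>s\<in>nerve_simplices 2 \<U>. - x s) [b, c, d] - (\<lambda>s\<in>nerve_simplices 2 \<U>. - x s) [a, c, d] +
         (\<lambda>s\<in>nerve_simplices 2 \<U>. - x s) [a, b, d] - (\<lambda>s\<in>nerve_simplices 2 \<U>. - x s) [a, b, c] = 0"
        by simp
    qed simp
  qed
next
  show "\<one>\<^bsub>nerve_cochains 2 \<U>\<^esub> \<in> nerve_cocycles 2 \<U>"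
    by (auto simp: nerve_cocycle_iff one_nerve_cochains simplex2_iff)
qed

lemma subgroup_coboundaries: "subgroup (nerve_coboundaries 2 \<U>) (cocycle_group \<U>)"
proof -
  interpret Z: comm_group "cocycle_group \<U>" by (rule comm_group_cocycles)
  have sub: "nerve_coboundaries 2 \<U> \<subseteq> carrier (cocycle_group \<U>)"
    using coboundary_imp_cocycle by simp
  have one: "\<one>\<^bsub>cocycle_group \<U>\<^esub> \<in> nerve_coboundaries 2 \<U>"
    unfolding nerve_coboundary_iff
    by (auto simp: one_nerve_cochains cobounds_def intro!: exI[of _ "\<lambda>_ _. 0"])
  show ?thesis
  proof (rule Z.subgroupI[OF sub])
    show "nerve_coboundaries 2 \<U> \<noteq> {}" using one by blast
  next
    fix x assume x: "x \<in> nerve_coboundaries 2 \<U>"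
    then obtain m where x_ext: "x \<in> extensional (nerve_simplices 2 \<U>)"
      and m: "cobounds \<U> m (\<lambda>a b c. x [a, b, c])" by (auto simp: nerve_coboundary_iff)
    define y where "y = (\<lambda>s\<in>nerve_simplices 2 \<U>. - x s)"
    have y: "y \<in> nerve_coboundaries 2 \<U>"
      unfolding nerve_coboundary_iff
    proof (intro conjI exI)
      show "cobounds \<U> (\<lambda>a b. - m a b) (\<lambda>a b c. y [a, b, c])"
        using m by (auto simp: cobounds_def y_def)
    qed (simp add: y_def)
    have "y \<otimes>\<^bsub>cocycle_group \<U>\<^esub> x = \<one>\<^bsub>cocycle_group \<U>\<^esub>"
      by (auto simp: y_def mult_nerve_cochains one_nerve_cochains)
    then show "inv\<^bsub>cocycle_group \<U>\<^esub> x \<in> nerve_coboundaries 2 \<U>"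
      using Z.inv_equality[of y x] y x sub by auto
  next
    fix x y assume "x \<in> nerve_coboundaries 2 \<U>" "y \<in> nerve_coboundaries 2 \<U>"
    then obtain m m' where m: "cobounds \<U> m (\<lambda>a b c. x [a, b, c])"
        "cobounds \<U> m' (\<lambda>a b c. y [a, b, c])" by (auto simp: nerve_coboundary_iff)
    show "x \<otimes>\<^bsub>cocycle_group \<U>\<^esub> y \<in> nerve_coboundaries 2 \<U>"
      unfolding nerve_coboundary_iff
    proof (intro conjI exI)
      show "cobounds \<U> (\<lambda>a b. m a b + m' a b) (\<lambda>a b c. (x \<otimes>\<^bsub>cocycle_group \<U>\<^esub> y) [a, b, c])"
        using m by (auto simp: cobounds_def mult_nerve_cochains)
    qed (simp add: mult_nerve_cochains)
  qed
qed

definition nerve_class :: "'a set set \<Rightarrow> ('a set list \<Rightarrow> int) \<Rightarrow> ('a set list \<Rightarrow> int) set" where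
  "nerve_class \<U> z = nerve_coboundaries 2 \<U> #>\<^bsub>nerve_cochains 2 \<U>\<^esub> z"

lemma nerve_class_alt: "nerve_class \<U> z = nerve_coboundaries 2 \<U> #>\<^bsub>cocycle_group \<U>\<^esub> z"
  by (simp add: nerve_class_def r_coset_def)

lemma nerve_cohomology_alt: "nerve_cohomology 2 \<U> = cocycle_group \<U> Mod nerve_coboundaries 2 \<U>"
  by (simp add: nerve_cohomology_def)

lemma comm_group_nerve_cohomology: "comm_group (nerve_cohomology 2 \<U>)"
  unfolding nerve_cohomology_alt
  by (rule comm_group.abelian_FactGroup[OF comm_group_cocycles subgroup_coboundaries])

lemma nerve_class_hom: "nerve_class \<U> \<in> hom (cocycle_group \<U>) (nerve_cohomology 2 \<U>)"
proof -
  interpret Z: comm_group "cocycle_group \<U>" by (rule comm_group_cocycles)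
  interpret N: normal "nerve_coboundaries 2 \<U>" "cocycle_group \<U>"
    using Z.subgroup_imp_normal subgroup_coboundaries by blast
  have "nerve_class \<U> = (\<lambda>z. nerve_coboundaries 2 \<U> #>\<^bsub>cocycle_group \<U>\<^esub> z)"
    by (auto simp: nerve_class_alt)
  then show ?thesis using N.r_coset_hom_Mod by (simp add: nerve_cohomology_alt)
qed

lemma carrier_nerve_cohomology: "carrier (nerve_cohomology 2 \<U>) = nerve_class \<U> ` nerve_cocycles 2 \<U>"
  unfolding nerve_cohomology_alt FactGroup_def RCOSETS_def by (auto simp: nerve_class_alt)

text \<open>All later comparisons of classes go through this form, in which the coboundary witness is
  explicit.\<close>

lemma nerve_class_eq_iff:
  assumes "z \<in> nerve_cocycles 2 \<U>" "w \<in> nerve_cocycles 2 \<U>"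
  shows "nerve_class \<U> z = nerve_class \<U> w \<longleftrightarrow> (\<exists>m. cobounds \<U> m (\<lambda>a b c. z [a, b, c] - w [a, b, c]))"
proof -
  interpret Z: comm_group "cocycle_group \<U>" by (rule comm_group_cocycles)
  have ext: "z \<in> extensional (nerve_simplices 2 \<U>)" "w \<in> extensional (nerve_simplices 2 \<U>)"
    using assms by (simp_all add: nerve_cocycle_iff)
  have "nerve_class \<U> z = nerve_class \<U> w \<longleftrightarrow> z \<in> nerve_class \<U> w"
    using Z.rcos_self[OF _ subgroup_coboundaries, of z] Z.repr_independence[OF _ _ subgroup_coboundaries, of z w] assms
    by (auto simp: nerve_class_alt)
  also have "\<dots> \<longleftrightarrow> (\<exists>b\<in>nerve_coboundaries 2 \<U>. z = (\<lambda>s\<in>nerve_simplices 2 \<U>. b s + w s))"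
    by (auto simp: nerve_class_def r_coset_def mult_nerve_cochains)
  also have "\<dots> \<longleftrightarrow> (\<exists>m. cobounds \<U> m (\<lambda>a b c. z [a, b, c] - w [a, b, c]))"
  proof
    assume "\<exists>b\<in>nerve_coboundaries 2 \<U>. z = (\<lambda>s\<in>nerve_simplices 2 \<U>. b s + w s)"
    then obtain b m where z: "z = (\<lambda>s\<in>nerve_simplices 2 \<U>. b s + w s)" and "cobounds \<U> m (\<lambda>a b' c. b [a, b', c])"
      by (auto simp: nerve_coboundary_iff)
    then show "\<exists>m. cobounds \<U> m (\<lambda>a b c. z [a, b, c] - w [a, b, c])"
      unfolding z by (intro exI[of _ m]) (simp add: cobounds_def)
  next
    assume "\<exists>m. cobounds \<U> m (\<lambda>a b c. z [a, b, c] - w [a, b, c])"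
    then obtain m where m: "cobounds \<U> m (\<lambda>a b c. z [a, b, c] - w [a, b, c])" by blast
    show "\<exists>b\<in>nerve_coboundaries 2 \<U>. z = (\<lambda>s\<in>nerve_simplices 2 \<U>. b s + w s)"
    proof
      show "z = (\<lambda>s\<in>nerve_simplices 2 \<U>. (\<lambda>s\<in>nerve_simplices 2 \<U>. z s - w s) s + w s)"
        by (rule extensionalityI[OF ext(1)]) simp_all
      show "(\<lambda>s\<in>nerve_simplices 2 \<U>. z s - w s) \<in> nerve_coboundaries 2 \<U>"
        using m by (auto simp: nerve_coboundary_iff cobounds_def intro!: exI[of _ m])
    qed
  qed
  finally show ?thesis .
qed

section \<open>Functoriality under refinement\<close>

definition pull :: "'a set set \<Rightarrow> ('a set \<Rightarrow> 'b set) \<Rightarrow> ('b set list \<Rightarrow> int) \<Rightarrow> 'a set list \<Rightarrow> int" where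
  "pull \<V> r z = (\<lambda>s\<in>nerve_simplices 2 \<V>. z (map r s))"

lemma projections_id: "r \<in> projections id \<V> \<U> \<longleftrightarrow> (\<forall>V\<in>\<V>. r V \<in> \<U> \<and> V \<subseteq> r V)"
  by (auto simp: projections_def)

lemma projection_exists: "refines \<V> \<U> \<Longrightarrow> \<exists>r. r \<in> projections id \<V> \<U>"
  unfolding refines_def projections_id by metis

lemma map_simplex:
  assumes r: "r \<in> projections id \<V> \<U>" and s: "s \<in> nerve_simplices 2 \<V>"
  shows "map r s \<in> nerve_simplices 2 \<U>"
proof -
  obtain a b c where e: "s = [a, b, c]" using simplex2_cases[OF s] by blast
  show ?thesis using r s unfolding e list.map simplex2_iff projections_id by blast
qed

lemma pull_cocycle:
  assumes "r \<in> projections id \<V> \<U>" "z \<in> nerve_cocycles 2 \<U>"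
  shows "pull \<V> r z \<in> nerve_cocycles 2 \<V>"
  unfolding nerve_cocycle_iff
proof (intro conjI ballI impI)
  show "pull \<V> r z \<in> extensional (nerve_simplices 2 \<V>)" by (simp add: pull_def)
  fix a b c d assume V: "a \<in> \<V>" "b \<in> \<V>" "c \<in> \<V>" "d \<in> \<V>" and ne: "a \<inter> b \<inter> c \<inter> d \<noteq> {}"
  have s: "[b, c, d] \<in> nerve_simplices 2 \<V>" "[a, c, d] \<in> nerve_simplices 2 \<V>"
    "[a, b, d] \<in> nerve_simplices 2 \<V>" "[a, b, c] \<in> nerve_simplices 2 \<V>"
    using V ne unfolding simplex2_iff by blast+
  have "r a \<in> \<U>" "r b \<in> \<U>" "r c \<in> \<U>" "r d \<in> \<U>" "r a \<inter> r b \<inter> r c \<inter> r d \<noteq> {}"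
    using assms(1) V ne unfolding projections_id by blast+
  from nerve_cocycleD[OF assms(2) this] s
  show "pull \<V> r z [b, c, d] - pull \<V> r z [a, c, d] + pull \<V> r z [a, b, d] - pull \<V> r z [a, b, c] = 0"
    by (simp add: pull_def)
qed

text \<open>Two projections are contiguous; the cochain below is the value on \<open>z\<close> of the prism
  operator of the resulting homotopy.\<close>

lemma contiguous_cobounds:
  assumes r: "r \<in> projections id \<V> \<U>" and r': "r' \<in> projections id \<V> \<U>" and z: "z \<in> nerve_cocycles 2 \<U>"
  shows "cobounds \<V> (\<lambda>a b. z [r a, r' a, r' b] - z [r a, r b, r' b])
           (\<lambda>a b c. z [r' a, r' b, r' c] - z [r a, r b, r c])"
  unfolding cobounds_def
proof (intro allI impI)
  fix a b c assume "[a, b, c] \<in> nerve_simplices 2 \<V>"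
  then have V: "a \<in> \<V>" "b \<in> \<V>" "c \<in> \<V>" "a \<inter> b \<inter> c \<noteq> {}" unfolding simplex2_iff by auto
  then obtain v where v: "v \<in> a" "v \<in> b" "v \<in> c" by blast
  have m: "r a \<in> \<U>" "r b \<in> \<U>" "r c \<in> \<U>" "r' a \<in> \<U>" "r' b \<in> \<U>" "r' c \<in> \<U>"
    "v \<in> r a" "v \<in> r b" "v \<in> r c" "v \<in> r' a" "v \<in> r' b" "v \<in> r' c"
    using r r' V v unfolding projections_id by blast+
  have "z [r' a, r' b, r' c] - z [r a, r' b, r' c] + z [r a, r' a, r' c] - z [r a, r' a, r' b] = 0"
    using m by (intro nerve_cocycleD[OF z]) auto
  moreover have "z [r b, r' b, r' c] - z [r a, r' b, r' c] + z [r a, r b, r' c] - z [r a, r b, r' b] = 0"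
    using m by (intro nerve_cocycleD[OF z]) auto
  moreover have "z [r b, r c, r' c] - z [r a, r c, r' c] + z [r a, r b, r' c] - z [r a, r b, r c] = 0"
    using m by (intro nerve_cocycleD[OF z]) auto
  ultimately show "z [r' a, r' b, r' c] - z [r a, r b, r c] =
      (z [r b, r' b, r' c] - z [r b, r c, r' c]) - (z [r a, r' a, r' c] - z [r a, r c, r' c]) +
      (z [r a, r' a, r' b] - z [r a, r b, r' b])" by linarith
qed

lemma cobounds_pull:
  assumes "r \<in> projections id \<V> \<U>" "cobounds \<U> m f"
  shows "cobounds \<V> (\<lambda>a b. m (r a) (r b)) (\<lambda>a b c. f (r a) (r b) (r c))"
  unfolding cobounds_def
proof (intro allI impI)
  fix a b c assume "[a, b, c] \<in> nerve_simplices 2 \<V>"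
  then have "[r a, r b, r c] \<in> nerve_simplices 2 \<U>"
    using assms(1) unfolding simplex2_iff projections_id by blast
  then show "f (r a) (r b) (r c) = m (r b) (r c) - m (r a) (r c) + m (r a) (r b)"
    using assms(2) by (simp add: cobounds_def)
qed

lemma cobounds_add:
  assumes "cobounds \<U> m f" "cobounds \<U> m' f'"
  shows "cobounds \<U> (\<lambda>a b. m a b + m' a b) (\<lambda>a b c. f a b c + f' a b c)"
  using assms by (simp add: cobounds_def)

text \<open>The union in \<^term>\<open>nerve_cohomology_map\<close> ranges over all projections and all representatives;
  by contiguity and by functoriality of coboundaries all of them give the same coset.\<close>

lemma nerve_map_class:
  assumes r: "r \<in> projections id \<V> \<U>" and z: "z \<in> nerve_cocycles 2 \<U>"
  shows "nerve_cohomology_map 2 id \<V> \<U> (nerve_class \<U> z) = nerve_class \<V> (pull \<V> r z)"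
proof -
  interpret Z: comm_group "cocycle_group \<U>" by (rule comm_group_cocycles)
  have eq: "nerve_class \<V> (pull \<V> r' w) = nerve_class \<V> (pull \<V> r z)"
    if r': "r' \<in> projections id \<V> \<U>" and w: "w \<in> nerve_class \<U> z" for r' w
  proof -
    have wZ: "w \<in> nerve_cocycles 2 \<U>"
      using Z.r_coset_subset_G[of "nerve_coboundaries 2 \<U>" z] w z coboundary_imp_cocycle[of \<U>]
      unfolding nerve_class_alt by auto
    have "nerve_class \<U> z = nerve_class \<U> w"
      unfolding nerve_class_alt
      by (rule Z.repr_independence[OF w[unfolded nerve_class_alt] _ subgroup_coboundaries])
        (simp add: z)
    from this[symmetric] obtain m where m: "cobounds \<U> m (\<lambda>a b c. w [a, b, c] - z [a, b, c])"
      using nerve_class_eq_iff[OF wZ z] by blast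
    have "cobounds \<V> (\<lambda>a b. w [r a, r' a, r' b] - w [r a, r b, r' b] + m (r a) (r b))
        (\<lambda>a b c. pull \<V> r' w [a, b, c] - pull \<V> r z [a, b, c])"
      using cobounds_add[OF contiguous_cobounds[OF r r' wZ] cobounds_pull[OF r m]]
      by (simp add: cobounds_def pull_def)
    then have "\<exists>m. cobounds \<V> m (\<lambda>a b c. pull \<V> r' w [a, b, c] - pull \<V> r z [a, b, c])"
      by (rule exI[where x = "\<lambda>a b. w [r a, r' a, r' b] - w [r a, r b, r' b] + m (r a) (r b)"])
    then show ?thesis
      by (simp only: nerve_class_eq_iff[OF pull_cocycle[OF r' wZ] pull_cocycle[OF r z]])
  qed
  have self: "z \<in> nerve_class \<U> z"
    using Z.rcos_self[OF _ subgroup_coboundaries] z by (simp add: nerve_class_alt)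
  have ne: "nerve_class \<U> z \<noteq> {}" "projections id \<V> \<U> \<noteq> {}"
    using self r by blast+
  have "nerve_cohomology_map 2 id \<V> \<U> (nerve_class \<U> z) =
      (\<Union>r'\<in>projections id \<V> \<U>. \<Union>w\<in>nerve_class \<U> z. nerve_class \<V> (pull \<V> r' w))"
    by (simp add: nerve_cohomology_map_def nerve_class_def pull_def)
  also have "\<dots> = (\<Union>r'\<in>projections id \<V> \<U>. \<Union>w\<in>nerve_class \<U> z. nerve_class \<V> (pull \<V> r z))"
    by (rule SUP_cong[OF refl], rule SUP_cong[OF refl]) (rule eq)
  also have "\<dots> = nerve_class \<V> (pull \<V> r z)"
    using ne by simp
  finally show ?thesis .
qed

section \<open>The second Cech cohomology group\<close>

lemma pull_hom:
  assumes "r \<in> projections id \<V> \<U>"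
  shows "pull \<V> r \<in> hom (cocycle_group \<U>) (cocycle_group \<V>)"
proof (rule homI)
  show "pull \<V> r z \<in> carrier (cocycle_group \<V>)" if "z \<in> carrier (cocycle_group \<U>)" for z
    using pull_cocycle[OF assms] that by simp
  show "pull \<V> r (z \<otimes>\<^bsub>cocycle_group \<U>\<^esub> w) = pull \<V> r z \<otimes>\<^bsub>cocycle_group \<V>\<^esub> pull \<V> r w" for z w
    using map_simplex[OF assms] by (auto simp: pull_def mult_nerve_cochains)
qed

lemma nerve_map_hom:
  assumes "refines \<V> \<U>"
  shows "nerve_cohomology_map 2 id \<V> \<U> \<in> hom (nerve_cohomology 2 \<U>) (nerve_cohomology 2 \<V>)"
proof -
  obtain r where r: "r \<in> projections id \<V> \<U>" using projection_exists[OF assms] by blast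
  note map = nerve_map_class[OF r]
  have cl: "nerve_class \<U> z \<otimes>\<^bsub>nerve_cohomology 2 \<U>\<^esub> nerve_class \<U> w = nerve_class \<U> (z \<otimes>\<^bsub>cocycle_group \<U>\<^esub> w)"
    if "z \<in> nerve_cocycles 2 \<U>" "w \<in> nerve_cocycles 2 \<U>" for z w and \<U> :: "'a set set"
    using nerve_class_hom[of \<U>] that by (auto simp: hom_def)
  have mc: "z \<otimes>\<^bsub>cocycle_group \<U>\<^esub> w \<in> nerve_cocycles 2 \<U>"
    if "z \<in> nerve_cocycles 2 \<U>" "w \<in> nerve_cocycles 2 \<U>" for z w
    using comm_group_cocycles[of \<U>] that comm_groupE(1) by fastforce
  show ?thesis
  proof (rule homI)
    fix x assume "x \<in> carrier (nerve_cohomology 2 \<U>)"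
    then obtain z where z: "z \<in> nerve_cocycles 2 \<U>" "x = nerve_class \<U> z"
      unfolding carrier_nerve_cohomology by blast
    show "nerve_cohomology_map 2 id \<V> \<U> x \<in> carrier (nerve_cohomology 2 \<V>)"
      unfolding z(2) carrier_nerve_cohomology map[OF z(1)] using pull_cocycle[OF r z(1)] by blast
    fix y assume "y \<in> carrier (nerve_cohomology 2 \<U>)"
    then obtain w where w: "w \<in> nerve_cocycles 2 \<U>" "y = nerve_class \<U> w"
      unfolding carrier_nerve_cohomology by blast
    have "pull \<V> r (z \<otimes>\<^bsub>cocycle_group \<U>\<^esub> w) = pull \<V> r z \<otimes>\<^bsub>cocycle_group \<V>\<^esub> pull \<V> r w"
      using pull_hom[OF r] z(1) w(1) by (simp add: hom_def)
    then show "nerve_cohomology_map 2 id \<V> \<U> (x \<otimes>\<^bsub>nerve_cohomology 2 \<U>\<^esub> y) =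
      nerve_cohomology_map 2 id \<V> \<U> x \<otimes>\<^bsub>nerve_cohomology 2 \<V>\<^esub> nerve_cohomology_map 2 id \<V> \<U> y"
      unfolding z(2) w(2) cl[OF z(1) w(1)] map[OF z(1)] map[OF w(1)] map[OF mc[OF z(1) w(1)]]
        cl[OF pull_cocycle[OF r z(1)] pull_cocycle[OF r w(1)]] by (rule arg_cong)
  qed
qed

abbreviation covers :: "'a topology \<Rightarrow> 'a set set set" where
  "covers X \<equiv> {\<U>. open_cover X \<U>}"

lemma refines_trans: "refines \<W> \<V> \<Longrightarrow> refines \<V> \<U> \<Longrightarrow> refines \<W> \<U>"
  unfolding refines_def by (meson order_trans)

lemma common_refinement:
  assumes "open_cover X \<U>" "open_cover X \<V>"
  shows "\<exists>\<W>. open_cover X \<W> \<and> refines \<W> \<U> \<and> refines \<W> \<V>"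
proof (intro exI conjI)
  let ?W = "{U \<inter> V |U V. U \<in> \<U> \<and> V \<in> \<V>}"
  show "refines ?W \<U>" "refines ?W \<V>" unfolding refines_def by blast+
  have "\<Union>?W = \<Union>\<U> \<inter> \<Union>\<V>" by blast
  then show "open_cover X ?W"
    using assms unfolding open_cover_def by (auto intro!: openin_Int)
qed

lemma cech_directed_system:
  "directed_system (covers X) (\<lambda>\<U> \<V>. refines \<V> \<U>) (nerve_cohomology 2)
     (\<lambda>\<U> \<V>. nerve_cohomology_map 2 id \<V> \<U>)"
proof (rule directed_system.intro)
  have "open_cover X {topspace X}" by (simp add: open_cover_def)
  then show "covers X \<noteq> {}" by blast
  show "refines \<U> \<U>" for \<U> :: "'a set set" by (auto simp: refines_def)
  show "refines \<W> \<U>" if "refines \<V> \<U>" "refines \<W> \<V>" for \<U> \<V> \<W> :: "'a set set"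
    by (rule refines_trans[OF that(2,1)])
  show "\<exists>\<W>\<in>covers X. refines \<W> \<U> \<and> refines \<W> \<V>" if "\<U> \<in> covers X" "\<V> \<in> covers X" for \<U> \<V>
    using common_refinement[of X \<U> \<V>] that by blast
  show "comm_group (nerve_cohomology 2 \<U>)" for \<U> :: "'a set set"
    by (rule comm_group_nerve_cohomology)
  show "nerve_cohomology_map 2 id \<V> \<U> \<in> hom (nerve_cohomology 2 \<U>) (nerve_cohomology 2 \<V>)"
    if "refines \<V> \<U>" for \<U> \<V> :: "'a set set"
    using nerve_map_hom[OF that] .
  show "nerve_cohomology_map 2 id \<U> \<U> x = x" if x: "x \<in> carrier (nerve_cohomology 2 \<U>)" for \<U> :: "'a set set" and x
  proof -
    obtain z where z: "z \<in> nerve_cocycles 2 \<U>" "x = nerve_class \<U> z"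
      using x by (auto simp: carrier_nerve_cohomology)
    have id: "(\<lambda>U. U) \<in> projections id \<U> \<U>" by (simp add: projections_id)
    have "pull \<U> (\<lambda>U. U) z = z"
      using z unfolding pull_def nerve_cocycle_iff
      by (intro extensionalityI[of _ "nerve_simplices 2 \<U>"]) simp_all
    then show ?thesis using nerve_map_class[OF id z(1)] z by simp
  qed
  show "nerve_cohomology_map 2 id \<W> \<V> (nerve_cohomology_map 2 id \<V> \<U> x) = nerve_cohomology_map 2 id \<W> \<U> x"
    if VU: "refines \<V> \<U>" and WV: "refines \<W> \<V>" and x: "x \<in> carrier (nerve_cohomology 2 \<U>)"
    for \<U> \<V> \<W> :: "'a set set" and x
  proof -
    obtain z where z: "z \<in> nerve_cocycles 2 \<U>" "x = nerve_class \<U> z"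
      using x by (auto simp: carrier_nerve_cohomology)
    obtain r s where r: "r \<in> projections id \<V> \<U>" and s: "s \<in> projections id \<W> \<V>"
      using projection_exists[OF VU] projection_exists[OF WV] by blast
    have rs: "r \<circ> s \<in> projections id \<W> \<U>"
      using r s unfolding projections_id comp_def by (meson subset_trans)
    have "pull \<W> s (pull \<V> r z) = pull \<W> (r \<circ> s) z"
      using map_simplex[OF s] by (simp add: pull_def restrict_def fun_eq_iff)
    then show ?thesis
      by (simp add: z nerve_map_class[OF r] nerve_map_class[OF s] nerve_map_class[OF rs] pull_cocycle[OF r])
  qed
qed

definition cech_cocycle_class :: "'a topology \<Rightarrow> 'a set set \<Rightarrow> ('a set list \<Rightarrow> int)
    \<Rightarrow> ('a set set \<times> ('a set list \<Rightarrow> int) set) set" where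
  "cech_cocycle_class X \<U> z = cech_class 2 X \<U> (nerve_class \<U> z)"

context
  fixes X :: "'a topology"
begin

interpretation cech: directed_system "covers X" "\<lambda>\<U> \<V>. refines \<V> \<U>" "nerve_cohomology 2"
    "\<lambda>\<U> \<V>. nerve_cohomology_map 2 id \<V> \<U>"
  by (rule cech_directed_system)

lemma cech_limit: "cech_cohomology 2 X = cech.L"
  by (simp add: cech_cohomology_def)

lemma cech_cocycle_class_cl: "cech_cocycle_class X \<U> z = cech.cl \<U> (nerve_class \<U> z)"
  by (simp add: cech_cocycle_class_def cech_class_def cech.cl_def)

lemma nerve_class_closed: "z \<in> nerve_cocycles 2 \<U> \<Longrightarrow> nerve_class \<U> z \<in> carrier (nerve_cohomology 2 \<U>)"
  by (simp add: carrier_nerve_cohomology)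

lemma comm_group_cech: "comm_group (cech_cohomology 2 X)"
  unfolding cech_limit by (rule cech.comm_group_limit)

lemma cech_cocycle_class_hom:
  assumes "open_cover X \<U>"
  shows "cech_cocycle_class X \<U> \<in> hom (cocycle_group \<U>) (cech_cohomology 2 X)"
proof -
  have "cech_cocycle_class X \<U> = cech.cl \<U> \<circ> nerve_class \<U>"
    by (simp add: cech_cocycle_class_cl comp_def fun_eq_iff)
  moreover have "cech.cl \<U> \<in> hom (nerve_cohomology 2 \<U>) (cech_cohomology 2 X)"
    unfolding cech_limit using assms by (intro cech.cl_hom) simp
  ultimately show ?thesis
    using hom_compose[OF nerve_class_hom] by metis
qed

lemma cech_cocycle_class_eqI:
  assumes U: "open_cover X \<U>" "z \<in> nerve_cocycles 2 \<U>"
    and V: "open_cover X \<V>" "w \<in> nerve_cocycles 2 \<V>"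
    and W: "open_cover X \<W>" and r: "r \<in> projections id \<W> \<U>" and s: "s \<in> projections id \<W> \<V>"
    and m: "cobounds \<W> m (\<lambda>a b c. z [r a, r b, r c] - w [s a, s b, s c])"
  shows "cech_cocycle_class X \<U> z = cech_cocycle_class X \<V> w"
proof -
  have "\<exists>m. cobounds \<W> m (\<lambda>a b c. pull \<W> r z [a, b, c] - pull \<W> s w [a, b, c])"
    using m by (intro exI[of _ m]) (simp add: cobounds_def pull_def)
  then have "nerve_class \<W> (pull \<W> r z) = nerve_class \<W> (pull \<W> s w)"
    by (simp only: nerve_class_eq_iff[OF pull_cocycle[OF r U(2)] pull_cocycle[OF s V(2)]])
  then have e: "nerve_cohomology_map 2 id \<W> \<U> (nerve_class \<U> z) = nerve_cohomology_map 2 id \<W> \<V> (nerve_class \<V> w)"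
    by (simp only: nerve_map_class[OF r U(2)] nerve_map_class[OF s V(2)])
  have ref: "refines \<W> \<U>" "refines \<W> \<V>"
    using r s unfolding refines_def projections_id by blast+
  show ?thesis
    unfolding cech_cocycle_class_cl
    using cech.cl_transition[of \<U> \<W> "nerve_class \<U> z"] cech.cl_transition[of \<V> \<W> "nerve_class \<V> w"]
      nerve_class_closed[OF U(2)] nerve_class_closed[OF V(2)] e ref U(1) V(1) W by simp
qed

text \<open>A direct limit identifies a class with the unit only if some later stage does, and there the
  class is a coboundary. The hypothesis is an inclusion because \<^term>\<open>cech_map\<close> is a union of
  classes: if the union is the unit class, each of its members is contained in that class.\<close>

lemma cech_cocycle_class_trivialD:
  assumes U: "open_cover X \<U>" and z: "z \<in> nerve_cocycles 2 \<U>"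
    and triv: "cech_cocycle_class X \<U> z \<subseteq> \<one>\<^bsub>cech_cohomology 2 X\<^esub>"
  shows "\<exists>\<W> r m. open_cover X \<W> \<and> r \<in> projections id \<W> \<U> \<and> cobounds \<W> m (\<lambda>a b c. z [r a, r b, r c])"
proof -
  interpret N: comm_group "nerve_cohomology 2 \<U>" by (rule comm_group_nerve_cohomology)
  have one: "\<one>\<^bsub>cech_cohomology 2 X\<^esub> = cech.cl \<U> \<one>\<^bsub>nerve_cohomology 2 \<U>\<^esub>"
    unfolding cech_limit using U by (intro cech.one_limit) simp
  have cl: "nerve_class \<U> z \<in> carrier (nerve_cohomology 2 \<U>)" using nerve_class_closed[OF z] .
  have "(\<U>, nerve_class \<U> z) \<in> cech_cocycle_class X \<U> z"
    unfolding cech_cocycle_class_cl cech.in_cl_iff using U cl by simp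
  then have "cech.cl \<U> (nerve_class \<U> z) = cech.cl \<U> \<one>\<^bsub>nerve_cohomology 2 \<U>\<^esub>"
    using triv unfolding one cech.in_cl_iff[symmetric] using cech.in_cl_iff by blast
  then obtain \<W> where W: "open_cover X \<W>" and ref: "refines \<W> \<U>"
    and e: "nerve_cohomology_map 2 id \<W> \<U> (nerve_class \<U> z) = nerve_cohomology_map 2 id \<W> \<U> \<one>\<^bsub>nerve_cohomology 2 \<U>\<^esub>"
    using cech.cl_eq_iff[of \<U> \<U> "nerve_class \<U> z" "\<one>\<^bsub>nerve_cohomology 2 \<U>\<^esub>"] U cl by auto
  obtain r where r: "r \<in> projections id \<W> \<U>" using projection_exists[OF ref] by blast
  have "nerve_cohomology_map 2 id \<W> \<U> \<one>\<^bsub>nerve_cohomology 2 \<U>\<^esub> = \<one>\<^bsub>nerve_cohomology 2 \<W>\<^esub>"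
    using hom_one[OF nerve_map_hom[OF ref]] comm_group_nerve_cohomology comm_group.axioms(2) by blast
  also have "\<dots> = nerve_class \<W> \<one>\<^bsub>cocycle_group \<W>\<^esub>"
    using hom_one[OF nerve_class_hom, of \<W>] comm_group_cocycles comm_group_nerve_cohomology
      comm_group.axioms(2) by metis
  finally have "nerve_class \<W> (pull \<W> r z) = nerve_class \<W> \<one>\<^bsub>cocycle_group \<W>\<^esub>"
    using e by (simp add: nerve_map_class[OF r z])
  moreover have "\<one>\<^bsub>cocycle_group \<W>\<^esub> \<in> nerve_cocycles 2 \<W>"
    using comm_group_cocycles[of \<W>] comm_groupE(2) by fastforce
  ultimately obtain m where m: "cobounds \<W> m (\<lambda>a b c. pull \<W> r z [a, b, c] - \<one>\<^bsub>cocycle_group \<W>\<^esub> [a, b, c])"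
    using nerve_class_eq_iff[OF pull_cocycle[OF r z]] by blast
  then have "cobounds \<W> m (\<lambda>a b c. z [r a, r b, r c])"
    by (simp add: cobounds_def pull_def one_nerve_cochains)
  then show ?thesis using W r by blast
qed

end

text \<open>The representative \<open>(\<U>, z)\<close> contributes its pullback to \<^term>\<open>cech_map\<close>; composing the
  projection of that pullback with the one from the previous lemma gives a single projection
  \<open>\<W> \<rightarrow> \<U>\<close> along which \<open>z\<close> becomes a coboundary.\<close>

lemma cech_restriction_trivialD:
  assumes A: "A \<subseteq> topspace X" and U: "open_cover X \<U>" and z: "z \<in> nerve_cocycles 2 \<U>"
    and triv: "cech_map 2 (subtopology X A) id (cech_cocycle_class X \<U> z) = \<one>\<^bsub>cech_cohomology 2 (subtopology X A)\<^esub>"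
  shows "\<exists>\<W> r m. open_cover (subtopology X A) \<W> \<and> r \<in> projections id \<W> \<U> \<and>
           cobounds \<W> m (\<lambda>a b c. z [r a, r b, r c])"
proof -
  interpret cech: directed_system "covers X" "\<lambda>\<U> \<V>. refines \<V> \<U>" "nerve_cohomology 2"
    "\<lambda>\<U> \<V>. nerve_cohomology_map 2 id \<V> \<U>"
    by (rule cech_directed_system)
  let ?V = "pullback_cover (subtopology X A) id \<U>"
  have V: "?V = (\<lambda>U. A \<inter> U) ` \<U>"
    using A by (auto simp: pullback_cover_def)
  have oV: "open_cover (subtopology X A) ?V"
    using U A unfolding V open_cover_def by (auto simp: openin_subtopology_Int2)
  have "refines ?V \<U>" unfolding V refines_def by blast
  then obtain s where s: "s \<in> projections id ?V \<U>" using projection_exists by blast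
  have mem: "(\<U>, nerve_class \<U> z) \<in> cech_cocycle_class X \<U> z"
    unfolding cech_cocycle_class_cl cech.in_cl_iff using U nerve_class_closed[OF z] by simp
  have "cech_class 2 (subtopology X A) ?V (nerve_cohomology_map 2 id ?V \<U> (nerve_class \<U> z))
     \<subseteq> cech_map 2 (subtopology X A) id (cech_cocycle_class X \<U> z)"
    unfolding cech_map_def using mem by blast
  then have "cech_cocycle_class (subtopology X A) ?V (pull ?V s z) \<subseteq> \<one>\<^bsub>cech_cohomology 2 (subtopology X A)\<^esub>"
    unfolding triv by (simp add: cech_cocycle_class_def nerve_map_class[OF s z])
  from cech_cocycle_class_trivialD[OF oV pull_cocycle[OF s z] this]
  obtain \<W> r m where W: "open_cover (subtopology X A) \<W>" and r: "r \<in> projections id \<W> ?V"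
    and m: "cobounds \<W> m (\<lambda>a b c. pull ?V s z [r a, r b, r c])" by blast
  have "[r a, r b, r c] \<in> nerve_simplices 2 ?V" if "[a, b, c] \<in> nerve_simplices 2 \<W>" for a b c
    using map_simplex[OF r that] by simp
  then have "cobounds \<W> m (\<lambda>a b c. z [(s \<circ> r) a, (s \<circ> r) b, (s \<circ> r) c])"
    using m by (simp add: cobounds_def pull_def)
  moreover have "s \<circ> r \<in> projections id \<W> \<U>"
    using r s unfolding projections_id comp_def by (meson subset_trans)
  ultimately show ?thesis using W by blast
qed

section \<open>The group of p-adic integers\<close>

lemma padic_carrier_iff:
  assumes "p > 0"
  shows "t \<in> padic_carrier p \<longleftrightarrow> (\<forall>k. 0 \<le> t k \<and> t k < int p ^ k \<and> t (Suc k) mod int p ^ k = t k)"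
  using assms by (auto simp: padic_carrier_def carrier_integer_mod_group PiE_iff)

lemma padic_coherent:
  assumes "p > 0" "t \<in> padic_carrier p" "j \<le> k"
  shows "t k mod int p ^ j = t j"
  using assms(3)
proof (induction rule: dec_induct)
  case base
  show ?case using assms by (simp add: padic_carrier_iff)
next
  case (step k)
  have "t (Suc k) mod int p ^ j = (t (Suc k) mod int p ^ k) mod int p ^ j"
    using step.hyps by (simp add: mod_mod_cancel le_imp_power_dvd)
  then show ?case using step assms by (simp add: padic_carrier_iff)
qed

definition padic_of_int :: "nat \<Rightarrow> int \<Rightarrow> nat \<Rightarrow> int" where
  "padic_of_int p m = (\<lambda>k. m mod int p ^ k)"

lemma padic_of_int_closed: "p > 0 \<Longrightarrow> padic_of_int p m \<in> padic_carrier p"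
  by (simp add: padic_carrier_iff padic_of_int_def mod_mod_cancel le_imp_power_dvd)

lemma carrier_padic [simp]: "carrier (padic_group p) = padic_carrier p"
  by (simp add: padic_group_def)

lemma mult_padic: "s \<otimes>\<^bsub>padic_group p\<^esub> t = (\<lambda>k. (s k + t k) mod int p ^ k)"
  by (simp add: padic_group_def restrict_UNIV)

lemma one_padic: "\<one>\<^bsub>padic_group p\<^esub> = (\<lambda>k. 0)"
  by (simp add: padic_group_def restrict_UNIV)

lemma comm_group_padic:
  assumes "p > 0"
  shows "comm_group (padic_group p)"
proof (rule comm_groupI)
  show "\<one>\<^bsub>padic_group p\<^esub> \<in> carrier (padic_group p)"
    using assms by (simp add: padic_carrier_iff one_padic)
next
  fix s t u assume s: "s \<in> carrier (padic_group p)"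
  note * = padic_carrier_iff[OF assms]
  show "\<one>\<^bsub>padic_group p\<^esub> \<otimes>\<^bsub>padic_group p\<^esub> s = s"
    using s by (auto simp: * mult_padic one_padic)
  have cl: "(\<lambda>k. (a * v k + b * w k) mod int p ^ k) \<in> padic_carrier p"
    if vw: "v \<in> padic_carrier p" "w \<in> padic_carrier p" for a b v w
  proof -
    have "((a * v (Suc k) + b * w (Suc k)) mod int p ^ Suc k) mod int p ^ k = (a * v k + b * w k) mod int p ^ k" for k
    proof -
      have "v (Suc k) mod int p ^ k = v k mod int p ^ k" "w (Suc k) mod int p ^ k = w k mod int p ^ k"
        using vw unfolding * by auto
      then have "(a * v (Suc k) + b * w (Suc k)) mod int p ^ k = (a * v k + b * w k) mod int p ^ k"
        by (intro mod_add_cong mod_mult_cong refl)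
      then show ?thesis by (simp add: mod_mod_cancel)
    qed
    then show ?thesis using assms by (simp add: *)
  qed
  show "s \<otimes>\<^bsub>padic_group p\<^esub> t \<in> carrier (padic_group p)" if "t \<in> carrier (padic_group p)"
    using cl[of s t 1 1] s that by (simp add: mult_padic)
  show "s \<otimes>\<^bsub>padic_group p\<^esub> t = t \<otimes>\<^bsub>padic_group p\<^esub> s"
    by (simp add: mult_padic add.commute)
  show "s \<otimes>\<^bsub>padic_group p\<^esub> t \<otimes>\<^bsub>padic_group p\<^esub> u = s \<otimes>\<^bsub>padic_group p\<^esub> (t \<otimes>\<^bsub>padic_group p\<^esub> u)"
    by (simp add: mult_padic mod_add_left_eq mod_add_right_eq add.assoc)
  show "\<exists>y\<in>carrier (padic_group p). y \<otimes>\<^bsub>padic_group p\<^esub> s = \<one>\<^bsub>padic_group p\<^esub>"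
    using cl[of s s "-1" 0] s
    by (intro bexI[of _ "\<lambda>k. (- s k) mod int p ^ k"]) (simp_all add: mult_padic one_padic mod_add_left_eq)
qed

lemma topspace_padic [simp]: "topspace (padic_topology p) = padic_carrier p"
  by (auto simp: padic_topology_def padic_carrier_def)

lemma padic_coordinate_continuous:
  "continuous_map (padic_topology p) (discrete_topology (carrier (integer_mod_group (p ^ k)))) (\<lambda>t. t k)"
  unfolding padic_topology_def
  by (rule continuous_map_from_subtopology)
    (use continuous_map_product_projection[of k UNIV "\<lambda>k. discrete_topology (carrier (integer_mod_group (p ^ k)))"] in simp)

lemma padic_coordinate_open: "openin (padic_topology p) {t \<in> padic_carrier p. t k \<in> S}"
proof -
  have "openin (padic_topology p) {t \<in> topspace (padic_topology p). t k \<in> S \<inter> carrier (integer_mod_group (p ^ k))}"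
    by (rule openin_continuous_map_preimage[OF padic_coordinate_continuous]) simp
  moreover have "t k \<in> carrier (integer_mod_group (p ^ k))" if "t \<in> padic_carrier p" for t
    using that by (auto simp: padic_carrier_def)
  ultimately show ?thesis by (auto elim!: back_subst[of "openin _"])
qed

lemma padic_coordinate_closed: "closedin (padic_topology p) {t \<in> padic_carrier p. t k \<in> S}"
proof -
  have "topspace (padic_topology p) - {t \<in> padic_carrier p. t k \<in> S} = {t \<in> padic_carrier p. t k \<in> - S}" by auto
  then show ?thesis
    unfolding closedin_def using padic_coordinate_open[of p k "-S"] by auto
qed

lemma compact_space_padic:
  assumes "p > 0"
  shows "compact_space (padic_topology p)"
proof -
  let ?D = "\<lambda>k. discrete_topology (carrier (integer_mod_group (p ^ k)))"
  let ?P = "product_topology ?D UNIV"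
  have comp: "compact_space ?P"
    using assms by (auto simp: compact_space_product_topology compact_space_discrete_topology carrier_integer_mod_group)
  have cl: "closedin ?P {t \<in> topspace ?P. t k = c}" for k c
  proof -
    have "closedin ?P {t \<in> topspace ?P. t k \<in> {c} \<inter> carrier (integer_mod_group (p ^ k))}"
      using continuous_map_product_projection[of k UNIV ?D]
      by (intro closedin_continuous_map_preimage[of _ "?D k"]) auto
    moreover have "{t \<in> topspace ?P. t k \<in> {c} \<inter> carrier (integer_mod_group (p ^ k))} = {t \<in> topspace ?P. t k = c}"
      by auto
    ultimately show ?thesis by simp
  qed
  have mem: "t \<in> topspace ?P \<longleftrightarrow> (\<forall>k. 0 \<le> t k \<and> t k < int p ^ k)" for t
    using assms by (simp add: carrier_integer_mod_group PiE_UNIV_domain Pi_iff)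
  define L where "L k = (\<Union>c\<in>{0..<int p ^ Suc k}.
      {t \<in> topspace ?P. t (Suc k) = c} \<inter> {t \<in> topspace ?P. t k = c mod int p ^ k})" for k
  have "padic_carrier p = (\<Inter>k. L k)"
  proof (rule subset_antisym; rule subsetI)
    fix t assume "t \<in> padic_carrier p"
    then have t: "0 \<le> t k" "t k < int p ^ k" "t k = t (Suc k) mod int p ^ k" for k
      by (simp_all add: padic_carrier_iff[OF assms])
    show "t \<in> (\<Inter>k. L k)"
    proof (rule INT_I)
      fix k
      have "t \<in> topspace ?P" unfolding mem using t(1,2) by simp
      moreover have "t (Suc k) \<in> {0..<int p ^ Suc k}" using t(1,2)[of "Suc k"] by simp
      ultimately show "t \<in> L k" unfolding L_def using t(3)[of k] by blast
    qed
  next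
    fix t assume t: "t \<in> (\<Inter>k. L k)"
    then have "t \<in> topspace ?P" unfolding L_def by blast
    moreover have "t (Suc k) mod int p ^ k = t k" for k
      using INT_D[OF t, of k] unfolding L_def by auto
    ultimately show "t \<in> padic_carrier p" using mem[of t] by (simp add: padic_carrier_iff[OF assms])
  qed
  also have "closedin ?P \<dots>"
  proof (rule closedin_Inter)
    fix S assume "S \<in> range L"
    then obtain k where S: "S = L k" by blast
    show "closedin ?P S"
      unfolding S L_def by (intro closedin_Union) (blast intro: closedin_Int cl)+
  qed simp
  finally have "closedin ?P (padic_carrier p)" .
  then show ?thesis
    unfolding padic_topology_def using closedin_compact_space[OF comp] compact_space_subtopology by blast
qed

text \<open>A neighbourhood in the product topology constrains finitely many coordinates, and \<open>t k = 0\<close>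
  makes all coordinates up to \<open>k\<close> vanish. The set \<open>{t. t k = 0}\<close> is the subgroup \<open>p\<^sup>kA\<^sub>p\<close>.\<close>

lemma padic_nhds_one:
  assumes p: "p > 0" and S: "openin (padic_topology p) S" and one: "\<one>\<^bsub>padic_group p\<^esub> \<in> S"
  shows "\<exists>k. \<forall>t\<in>padic_carrier p. t k = 0 \<longrightarrow> t \<in> S"
proof -
  let ?D = "\<lambda>k. discrete_topology (carrier (integer_mod_group (p ^ k)))"
  obtain T where T: "openin (product_topology ?D UNIV) T" "S = T \<inter> padic_carrier p"
    using S unfolding padic_topology_def openin_subtopology by blast
  then have "(\<lambda>k. 0) \<in> T" using one by (simp add: one_padic)
  then obtain B where B: "finite {i \<in> UNIV. B i \<noteq> topspace (?D i)}" "(\<lambda>k. 0) \<in> Pi\<^sub>E UNIV B" "Pi\<^sub>E UNIV B \<subseteq> T"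
    using T(1) unfolding openin_product_topology_alt by blast
  then obtain k where k: "\<And>i. B i \<noteq> topspace (?D i) \<Longrightarrow> i \<le> k"
    using finite_nat_set_iff_bounded_le by auto
  have "t \<in> S" if t: "t \<in> padic_carrier p" "t k = 0" for t
  proof -
    have "t i \<in> B i" for i
    proof (cases "i \<le> k")
      case True
      then have "t i = 0" using padic_coherent[OF p t(1) True] t(2) by simp
      then show ?thesis using B(2) by auto
    next
      case False
      then have "B i = topspace (?D i)" using k by blast
      then show ?thesis using t(1) by (auto simp: padic_carrier_def)
    qed
    then show ?thesis using B(3) t(1) T(2) by auto
  qed
  then show ?thesis by blast
qed

section \<open>Free actions of the p-adic integers\<close>

text \<open>The data of a free action together with its orbit map \<open>\<pi>\<close>, stated elementwise on the space
  rather than as a homomorphism into its bijections: in this form it restricts at once to the preimage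
  of a closed subset of \<open>Y\<close>.\<close>

locale padic_bundle =
  fixes p :: nat and X :: "'a topology" and Y :: "'b topology"
    and \<phi> :: "(nat \<Rightarrow> int) \<Rightarrow> 'a \<Rightarrow> 'a" and \<pi> :: "'a \<Rightarrow> 'b"
  assumes p: "p > 1"
    and compact_X: "compact_space X"
    and act_closed: "\<lbrakk>t \<in> padic_carrier p; x \<in> topspace X\<rbrakk> \<Longrightarrow> \<phi> t x \<in> topspace X"
    and act_one: "x \<in> topspace X \<Longrightarrow> \<phi> \<one>\<^bsub>padic_group p\<^esub> x = x"
    and act_mult: "\<lbrakk>s \<in> padic_carrier p; t \<in> padic_carrier p; x \<in> topspace X\<rbrakk>
                     \<Longrightarrow> \<phi> (s \<otimes>\<^bsub>padic_group p\<^esub> t) x = \<phi> s (\<phi> t x)"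
    and act_free: "\<lbrakk>t \<in> padic_carrier p; x \<in> topspace X; \<phi> t x = x\<rbrakk> \<Longrightarrow> t = \<one>\<^bsub>padic_group p\<^esub>"
    and act_continuous: "continuous_map (prod_topology (padic_topology p) X) X (\<lambda>(t, x). \<phi> t x)"
    and proj_continuous: "continuous_map X Y \<pi>"
    and proj_open: "open_map X Y \<pi>"
    and proj_onto: "\<pi> ` topspace X = topspace Y"
    and proj_eq_iff: "\<lbrakk>x \<in> topspace X; y \<in> topspace X\<rbrakk>
                        \<Longrightarrow> \<pi> x = \<pi> y \<longleftrightarrow> (\<exists>t\<in>padic_carrier p. y = \<phi> t x)"
begin

lemma p_pos: "p > 0" "int p ^ k > 0"
  using p by auto

abbreviation "Ap \<equiv> padic_carrier p"
abbreviation "P \<equiv> padic_group p"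

sublocale P: comm_group P
  by (rule comm_group_padic[OF p_pos(1)])

lemma inv_padic_closed: "t \<in> Ap \<Longrightarrow> inv\<^bsub>P\<^esub> t \<in> Ap"
  using P.inv_closed by simp

lemma act_inv: "\<lbrakk>t \<in> Ap; x \<in> topspace X\<rbrakk> \<Longrightarrow> \<phi> (inv\<^bsub>P\<^esub> t) (\<phi> t x) = x"
  using act_mult[of "inv\<^bsub>P\<^esub> t" t x] inv_padic_closed[of t] act_one[of x] P.l_inv[of t] by simp

lemma act_inv': "\<lbrakk>t \<in> Ap; x \<in> topspace X\<rbrakk> \<Longrightarrow> \<phi> t (\<phi> (inv\<^bsub>P\<^esub> t) x) = x"
  using act_mult[of t "inv\<^bsub>P\<^esub> t" x] inv_padic_closed[of t] act_one[of x] P.r_inv[of t] by simp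

lemma proj_act: "\<lbrakk>t \<in> Ap; x \<in> topspace X\<rbrakk> \<Longrightarrow> \<pi> (\<phi> t x) = \<pi> x"
  using proj_eq_iff[of x "\<phi> t x"] act_closed by auto

lemma act_inj:
  assumes "s \<in> Ap" "t \<in> Ap" "x \<in> topspace X" "\<phi> s x = \<phi> t x"
  shows "s = t"
proof -
  have "\<phi> (inv\<^bsub>P\<^esub> t \<otimes>\<^bsub>P\<^esub> s) x = x"
    using act_mult[of "inv\<^bsub>P\<^esub> t" s x] assms act_inv inv_padic_closed by simp
  then have "inv\<^bsub>P\<^esub> t \<otimes>\<^bsub>P\<^esub> s = \<one>\<^bsub>P\<^esub>"
    using act_free[of "inv\<^bsub>P\<^esub> t \<otimes>\<^bsub>P\<^esub> s" x] assms P.m_closed[of "inv\<^bsub>P\<^esub> t" s] inv_padic_closed by simp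
  then show ?thesis
    using P.inv_solve_left[of "\<one>\<^bsub>P\<^esub>" t s] assms(1,2) P.r_one[of t] P.one_closed by simp
qed

text \<open>By freeness the translation is unique if \<open>x\<close> and \<open>y\<close> lie in one orbit.\<close>

definition trans :: "'a \<Rightarrow> 'a \<Rightarrow> nat \<Rightarrow> int" where
  "trans x y = (THE t. t \<in> Ap \<and> y = \<phi> t x)"

lemma trans_unique: "\<lbrakk>x \<in> topspace X; t \<in> Ap\<rbrakk> \<Longrightarrow> trans x (\<phi> t x) = t"
  unfolding trans_def using act_inj by (intro the_equality) auto

lemma trans:
  assumes "x \<in> topspace X" "y \<in> topspace X" "\<pi> x = \<pi> y"
  shows "trans x y \<in> Ap" "\<phi> (trans x y) x = y"
proof -
  obtain t where "t \<in> Ap" "y = \<phi> t x" using proj_eq_iff assms by blast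
  then show "trans x y \<in> Ap" "\<phi> (trans x y) x = y" using trans_unique assms by auto
qed

lemma trans_comp:
  assumes "x \<in> topspace X" "y \<in> topspace X" "z \<in> topspace X" "\<pi> x = \<pi> y" "\<pi> y = \<pi> z"
  shows "trans x z k = (trans x y k + trans y z k) mod int p ^ k"
proof -
  have "\<phi> (trans y z \<otimes>\<^bsub>P\<^esub> trans x y) x = z"
    using act_mult[of "trans y z" "trans x y" x] trans assms by simp
  then have "trans x z = trans y z \<otimes>\<^bsub>P\<^esub> trans x y"
    using trans_unique[of x "trans y z \<otimes>\<^bsub>P\<^esub> trans x y"] assms trans P.m_closed by simp
  then show ?thesis by (simp add: mult_padic add.commute)
qed

lemma trans_range:
  assumes "x \<in> topspace X" "y \<in> topspace X" "\<pi> x = \<pi> y"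
  shows "0 \<le> trans x y k" "trans x y k < int p ^ k"
  using trans(1)[OF assms] by (auto simp: padic_carrier_iff[OF p_pos(1)])

lemma act_map_continuous: "t \<in> Ap \<Longrightarrow> continuous_map X X (\<phi> t)"
  using continuous_map_compose[OF _ act_continuous, of X "\<lambda>x. (t, x)"]
  by (simp add: continuous_map_pairwise comp_def)

lemma act_image_open:
  assumes t: "t \<in> Ap" and N: "openin X N"
  shows "openin X (\<phi> t ` N)"
proof -
  have "\<phi> t ` N = {x \<in> topspace X. \<phi> (inv\<^bsub>P\<^esub> t) x \<in> N}"
  proof
    show "\<phi> t ` N \<subseteq> {x \<in> topspace X. \<phi> (inv\<^bsub>P\<^esub> t) x \<in> N}"
      using act_inv[OF t] act_closed[OF t] openin_subset[OF N] by auto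
    show "{x \<in> topspace X. \<phi> (inv\<^bsub>P\<^esub> t) x \<in> N} \<subseteq> \<phi> t ` N"
      using act_inv'[OF t] by (auto intro: rev_image_eqI)
  qed
  then show ?thesis
    using openin_continuous_map_preimage[OF act_map_continuous[OF inv_padic_closed[OF t]] N] by simp
qed

end

section \<open>Charts on which translations are constant\<close>

locale metric_padic_bundle = padic_bundle +
  fixes m
  assumes metric: "mtopology_of m = X"
begin

lemma mspace_eq: "mspace m = topspace X"
  using metric topspace_mtopology_of by metis

text \<open>Between two sets of diameter below such a radius the translation is one well-defined residue
  modulo \<open>p\<^sup>k\<close>, which is what makes the transitions of the bundle constant on the sets of a cover.\<close>

definition good_radius :: "nat \<Rightarrow> real \<Rightarrow> bool" where
  "good_radius k r \<longleftrightarrow> 0 < r \<and> (\<forall>a\<in>topspace X. \<forall>b\<in>topspace X. \<forall>a'\<in>topspace X. \<forall>b'\<in>topspace X.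
     \<pi> a = \<pi> a' \<and> \<pi> b = \<pi> b' \<and> mdist m a b < r \<and> mdist m a' b' < r \<longrightarrow> trans a a' k = trans b b' k)"

text \<open>For \<open>a' = s a\<close> and \<open>b' = t b\<close>, the larger of the two distances is a continuous function of
  \<open>(s, t, a, b)\<close>. By freeness it has no zero on the compact set where \<open>s k \<noteq> t k\<close>, so its minimum
  there is a good radius.\<close>

lemma good_radius_exists: "\<exists>r. good_radius k r"
proof -
  let ?T = "padic_topology p"
  let ?Q = "prod_topology (prod_topology ?T ?T) (prod_topology X X)"
  define f where "f w = max (mdist m (fst (snd w)) (snd (snd w)))
     (mdist m (\<phi> (fst (fst w)) (fst (snd w))) (\<phi> (snd (fst w)) (snd (snd w))))"
    for w :: "((nat \<Rightarrow> int) \<times> (nat \<Rightarrow> int)) \<times> ('a \<times> 'a)"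
  have c: "continuous_map ?Q ?T (\<lambda>w. fst (fst w))" "continuous_map ?Q ?T (\<lambda>w. snd (fst w))"
    "continuous_map ?Q X (\<lambda>w. fst (snd w))" "continuous_map ?Q X (\<lambda>w. snd (snd w))"
    by (rule continuous_map_compose[OF continuous_map_fst continuous_map_fst, unfolded comp_def]
        continuous_map_compose[OF continuous_map_fst continuous_map_snd, unfolded comp_def]
        continuous_map_compose[OF continuous_map_snd continuous_map_fst, unfolded comp_def]
        continuous_map_compose[OF continuous_map_snd continuous_map_snd, unfolded comp_def])+
  have pr: "continuous_map ?Q (prod_topology ?T X) (\<lambda>w. (fst (fst w), fst (snd w)))"
    "continuous_map ?Q (prod_topology ?T X) (\<lambda>w. (snd (fst w), snd (snd w)))"
    using c by (simp_all add: continuous_map_pairwise comp_def)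
  have act: "continuous_map ?Q X (\<lambda>w. \<phi> (fst (fst w)) (fst (snd w)))"
    "continuous_map ?Q X (\<lambda>w. \<phi> (snd (fst w)) (snd (snd w)))"
    using continuous_map_compose[OF pr(1) act_continuous] continuous_map_compose[OF pr(2) act_continuous]
    by (simp_all add: comp_def)
  have f: "continuous_map ?Q euclideanreal f"
    unfolding f_def using c act metric by (intro continuous_map_real_max continuous_map_mdist) simp_all
  define K where "K = (\<Union>e\<in>{0..<int p ^ k}. {w \<in> topspace ?Q. fst (fst w) \<in> {t \<in> Ap. t k \<in> {e}}}
                       \<inter> {w \<in> topspace ?Q. snd (fst w) \<in> {t \<in> Ap. t k \<in> - {e}}})"
  have "closedin ?Q ({w \<in> topspace ?Q. fst (fst w) \<in> {t \<in> Ap. t k \<in> {e}}}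
                       \<inter> {w \<in> topspace ?Q. snd (fst w) \<in> {t \<in> Ap. t k \<in> - {e}}})" for e
    by (intro closedin_Int closedin_continuous_map_preimage[OF c(1)] closedin_continuous_map_preimage[OF c(2)]
        padic_coordinate_closed)
  then have "closedin ?Q K"
    unfolding K_def by (intro closedin_Union) auto
  moreover have "compact_space ?Q"
    using compact_X compact_space_padic[OF p_pos(1)] by (simp add: compact_space_prod_topology)
  ultimately have "compactin euclideanreal (f ` K)"
    using closedin_compact_space image_compactin f by blast
  then have comp: "compact (f ` K)" by simp
  have pos: "0 < v" if v: "v \<in> f ` K" for v
  proof -
    obtain s t a b where w: "((s, t), (a, b)) \<in> K" "v = f ((s, t), (a, b))" using v by auto
    then have st: "s \<in> Ap" "t \<in> Ap" "s k \<noteq> t k" and ab: "a \<in> topspace X" "b \<in> topspace X"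
      by (auto simp: K_def)
    have "a \<noteq> b \<or> \<phi> s a \<noteq> \<phi> t b" using act_inj[of s t a] st ab by auto
    then have "0 < mdist m a b \<or> 0 < mdist m (\<phi> s a) (\<phi> t b)"
      using mdist_zero[of a m b] mdist_zero[of "\<phi> s a" m "\<phi> t b"] mdist_nonneg[of m a b]
        mdist_nonneg[of m "\<phi> s a" "\<phi> t b"] act_closed[OF st(1) ab(1)] act_closed[OF st(2) ab(2)] ab
      unfolding mspace_eq by linarith
    then show "0 < v" by (auto simp: w f_def less_max_iff_disj)
  qed
  obtain r where r: "r > 0" "\<And>v. v \<in> f ` K \<Longrightarrow> r \<le> v"
  proof (cases "K = {}")
    case True then show thesis using that[of 1] by simp
  next
    case False
    then obtain v where "v \<in> f ` K" "\<forall>u\<in>f ` K. v \<le> u" using compact_attains_inf[OF comp] by auto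
    then show thesis using that[of v] pos by blast
  qed
  have "good_radius k r"
    unfolding good_radius_def
  proof (intro conjI r(1) ballI impI; elim conjE)
    fix a b a' b' assume X: "a \<in> topspace X" "b \<in> topspace X" "a' \<in> topspace X" "b' \<in> topspace X"
      and e: "\<pi> a = \<pi> a'" "\<pi> b = \<pi> b'" and d: "mdist m a b < r" "mdist m a' b' < r"
    let ?w = "((trans a a', trans b b'), (a, b))"
    have t: "trans a a' \<in> Ap" "trans b b' \<in> Ap" "\<phi> (trans a a') a = a'" "\<phi> (trans b b') b = b'"
      using trans X e by auto
    have "f ?w < r" using t d by (simp add: f_def)
    then have "?w \<notin> K" using r(2)[of "f ?w"] by fastforce
    moreover have "trans a a' k \<in> {0..<int p ^ k}" using trans_range X e by simp
    ultimately show "trans a a' k = trans b b' k" using t X unfolding K_def by auto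
  qed
  then show ?thesis by blast
qed

lemma good_radius_mono: "good_radius k r \<Longrightarrow> 0 < r' \<Longrightarrow> r' \<le> r \<Longrightarrow> good_radius k r'"
  unfolding good_radius_def by force

lemma good_radius_pos: "good_radius k r \<Longrightarrow> 0 < r"
  by (simp add: good_radius_def)

text \<open>The minimum over \<open>j \<le> k\<close> makes the radii decrease, so that the covers by charts become finer.\<close>

definition radius :: "nat \<Rightarrow> real" where
  "radius k = Min ((\<lambda>j. SOME r. good_radius j r) ` {..k})"

lemma good_radius: "good_radius k (radius k)"
proof -
  have some: "good_radius j (SOME r. good_radius j r)" for j
    using good_radius_exists someI_ex by metis
  then have "0 < (SOME r. good_radius j r)" for j
    using good_radius_pos by blast
  then have "0 < radius k"
    unfolding radius_def by (subst Min_gr_iff) auto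
  moreover have "radius k \<le> (SOME r. good_radius k r)"
    unfolding radius_def by (intro Min_le) auto
  ultimately show ?thesis using some good_radius_mono by blast
qed

lemma radius_decreasing: "radius (Suc k) \<le> radius k"
  unfolding radius_def by (intro Min_antimono) auto

definition small :: "nat \<Rightarrow> 'a set \<Rightarrow> bool" where
  "small k N \<longleftrightarrow> openin X N \<and> (\<forall>a\<in>N. \<forall>b\<in>N. mdist m a b < radius k)"

text \<open>The image of a small open set stands for a trivialising neighbourhood in \<open>Y\<close> of the bundle
  \<open>X/p\<^sup>kA\<^sub>p \<rightarrow> Y\<close>, the small set itself being the local section.\<close>

definition chart_cover :: "nat \<Rightarrow> 'b set set" where
  "chart_cover k = (\<lambda>N. \<pi> ` N) ` {N. small k N}"

definition chart :: "nat \<Rightarrow> 'b set \<Rightarrow> 'a set" where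
  "chart k U = (SOME N. small k N \<and> \<pi> ` N = U)"

lemma chart: "U \<in> chart_cover k \<Longrightarrow> small k (chart k U) \<and> \<pi> ` chart k U = U"
  unfolding chart_def chart_cover_def by (rule someI_ex) auto

lemma chart_subset: "U \<in> chart_cover k \<Longrightarrow> chart k U \<subseteq> topspace X"
  using chart openin_subset unfolding small_def by blast

lemma chart_cover_mono: "chart_cover (Suc k) \<subseteq> chart_cover k"
proof -
  have "small k N" if "small (Suc k) N" for N
    using that radius_decreasing[of k] unfolding small_def by (meson order_less_le_trans)
  then show ?thesis unfolding chart_cover_def by blast
qed

lemma open_cover_charts: "open_cover Y (chart_cover k)"
  unfolding open_cover_def
proof (intro conjI ballI equalityI subsetI)
  show "openin Y U" if "U \<in> chart_cover k" for U
    using that proj_open unfolding chart_cover_def small_def open_map_def by auto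
  then show "y \<in> topspace Y" if "y \<in> \<Union> (chart_cover k)" for y
    using that openin_subset by blast
  fix y assume "y \<in> topspace Y"
  then obtain x where x: "x \<in> topspace X" "y = \<pi> x" using proj_onto by blast
  let ?N = "mball_of m x (radius k / 2)"
  have r: "radius k > 0" using good_radius good_radius_pos by blast
  have "mdist m a b < radius k" if "a \<in> ?N" "b \<in> ?N" for a b
    using that mdist_triangle[of a m x b] mdist_commute[of m a x] by simp
  moreover have "openin X ?N"
    using Metric_space.openin_mball[OF Metric_space_mspace_mdist, of m x "radius k / 2"] metric
    by (simp add: mtopology_of_def mball_of_def)
  ultimately have "small k ?N" unfolding small_def by blast
  moreover have "mdist m x x = 0" using x(1) mspace_eq by simp
  then have "mdist m x x < radius k / 2" using r by linarith
  then have "x \<in> ?N" using x(1) mspace_eq by (simp only: in_mball_of simp_thms)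
  ultimately show "y \<in> \<Union> (chart_cover k)" unfolding chart_cover_def using x by blast
qed

lemma small_trans:
  assumes "small k N" "small k N'" "a \<in> N" "b \<in> N" "a' \<in> N'" "b' \<in> N'" "\<pi> a = \<pi> a'" "\<pi> b = \<pi> b'"
  shows "trans a a' k = trans b b' k"
proof -
  have "a \<in> topspace X" "b \<in> topspace X" "a' \<in> topspace X" "b' \<in> topspace X"
    using assms(1-6) openin_subset unfolding small_def by blast+
  then show ?thesis using good_radius[of k] assms unfolding good_radius_def small_def by blast
qed

section \<open>The Bockstein cocycles\<close>

definition cross :: "nat \<Rightarrow> 'a set \<Rightarrow> 'a set \<Rightarrow> int" where
  "cross k N N' = (SOME e. \<exists>a\<in>N. \<exists>a'\<in>N'. \<pi> a = \<pi> a' \<and> e = trans a a' k)"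

lemma cross:
  assumes "small k N" "small k N'" "a \<in> N" "a' \<in> N'" "\<pi> a = \<pi> a'"
  shows "cross k N N' = trans a a' k"
proof -
  have "\<exists>e. \<exists>a\<in>N. \<exists>a'\<in>N'. \<pi> a = \<pi> a' \<and> e = trans a a' k" using assms by blast
  from someI_ex[OF this] obtain b b' where "b \<in> N" "b' \<in> N'" "\<pi> b = \<pi> b'" "cross k N N' = trans b b' k"
    unfolding cross_def by blast
  then show ?thesis using small_trans[of k N N' b a b' a'] assms by simp
qed

text \<open>Translations compose along an orbit, so lifting one point of \<open>Y\<close> to the three sets suffices.\<close>

lemma cross_add:
  assumes "small k N" "small k N'" "small k N''" "y \<in> \<pi> ` N" "y \<in> \<pi> ` N'" "y \<in> \<pi> ` N''"
  shows "cross k N N'' = (cross k N N' + cross k N' N'') mod int p ^ k"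
proof -
  obtain a a' a'' where a: "a \<in> N" "a' \<in> N'" "a'' \<in> N''" "\<pi> a = \<pi> a'" "\<pi> a' = \<pi> a''"
    using assms by auto
  have "a \<in> topspace X" "a' \<in> topspace X" "a'' \<in> topspace X"
    using a assms(1-3) openin_subset unfolding small_def by blast+
  then show ?thesis
    using trans_comp[of a a' a'' k] cross[of k N N' a a'] cross[of k N' N'' a' a''] cross[of k N N'' a a''] a assms
    by simp
qed

definition transition :: "nat \<Rightarrow> 'b set \<Rightarrow> 'b set \<Rightarrow> int" where
  "transition k U V = cross k (chart k U) (chart k V)"

text \<open>The transitions form a cocycle modulo \<open>p\<^sup>k\<close>; the integral coboundary of their lifts to
  \<open>{0..<p\<^sup>k}\<close> is divisible by \<open>p\<^sup>k\<close>, and the quotient represents the Bockstein image of the class of the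
  bundle.\<close>

definition bockstein :: "nat \<Rightarrow> 'b set list \<Rightarrow> int" where
  "bockstein k = (\<lambda>s\<in>nerve_simplices 2 (chart_cover k).
     (transition k (s!1) (s!2) - transition k (s!0) (s!2) + transition k (s!0) (s!1)) div int p ^ k)"

lemma bockstein_eq:
  assumes "[U, V, W] \<in> nerve_simplices 2 (chart_cover k)"
  shows "int p ^ k * bockstein k [U, V, W] = transition k V W - transition k U W + transition k U V"
proof -
  obtain y where y: "y \<in> U" "y \<in> V" "y \<in> W" and U: "U \<in> chart_cover k" "V \<in> chart_cover k" "W \<in> chart_cover k"
    using assms unfolding simplex2_iff by blast
  have "transition k U W = (transition k U V + transition k V W) mod int p ^ k"
    unfolding transition_def using chart[OF U(1)] chart[OF U(2)] chart[OF U(3)] y by (intro cross_add[of _ _ _ _ y]) auto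
  then have "int p ^ k dvd transition k V W - transition k U W + transition k U V"
    using dvd_minus_mod[of "int p ^ k" "transition k U V + transition k V W"]
    by (simp add: algebra_simps)
  then show ?thesis using assms by (simp add: bockstein_def)
qed

lemma bockstein_cocycle: "bockstein k \<in> nerve_cocycles 2 (chart_cover k)"
  unfolding nerve_cocycle_iff
proof (intro conjI ballI impI)
  show "bockstein k \<in> extensional (nerve_simplices 2 (chart_cover k))" by (simp add: bockstein_def)
  fix a b c d assume U: "a \<in> chart_cover k" "b \<in> chart_cover k" "c \<in> chart_cover k" "d \<in> chart_cover k"
    and ne: "a \<inter> b \<inter> c \<inter> d \<noteq> {}"
  have s: "[b, c, d] \<in> nerve_simplices 2 (chart_cover k)" "[a, c, d] \<in> nerve_simplices 2 (chart_cover k)"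
    "[a, b, d] \<in> nerve_simplices 2 (chart_cover k)" "[a, b, c] \<in> nerve_simplices 2 (chart_cover k)"
    using U ne unfolding simplex2_iff by blast+
  have "int p ^ k * (bockstein k [b, c, d] - bockstein k [a, c, d] + bockstein k [a, b, d] - bockstein k [a, b, c]) = 0"
    using s[THEN bockstein_eq] by (simp add: algebra_simps)
  then show "bockstein k [b, c, d] - bockstein k [a, c, d] + bockstein k [a, b, d] - bockstein k [a, b, c] = 0"
    using p_pos(1) p_pos(2)[of k] by simp
qed

text \<open>On the finer cover both systems of charts are available, and they differ by a \<open>0\<close>-cochain
  \<open>shift\<close> modulo \<open>p\<^sup>k\<close>. A change of the transitions by the coboundary of \<open>shift\<close> and by a multiple
  \<open>p\<^sup>k e\<close> changes their coboundary divided by \<open>p\<^sup>k\<close> by the coboundary of \<open>e\<close>; and one divides by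
  \<open>p\<^sup>k\<^sup>+\<^sup>1\<close> for the next class, which explains the factor \<open>p\<close>.\<close>

lemma bockstein_step:
  "\<exists>e. cobounds (chart_cover (Suc k)) e
     (\<lambda>a b c. bockstein k [a, b, c] - int p * bockstein (Suc k) [a, b, c])"
proof -
  define shift where "shift U = cross k (chart k U) (chart (Suc k) U)" for U
  let ?q = "int p ^ k"
  have small_mono: "small k N" if "small (Suc k) N" for N
    using that radius_decreasing[of k] unfolding small_def by (meson order_less_le_trans)
  define e where "e U V = (transition k U V - transition (Suc k) U V - shift U + shift V) div ?q" for U V
  have e: "?q * e U V = transition k U V - transition (Suc k) U V - shift U + shift V"
    if UV: "U \<in> chart_cover (Suc k)" "V \<in> chart_cover (Suc k)" "y \<in> U" "y \<in> V" for U V y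
  proof -
    have UV': "U \<in> chart_cover k" "V \<in> chart_cover k" using UV chart_cover_mono by auto
    note ch = chart[OF UV(1)] chart[OF UV(2)] chart[OF UV'(1)] chart[OF UV'(2)]
    have 1: "cross k (chart k U) (chart (Suc k) V) = (transition k U V + shift V) mod ?q"
      unfolding transition_def shift_def using ch UV(3,4) small_mono by (intro cross_add[of _ _ _ _ y]) auto
    have 2: "cross k (chart k U) (chart (Suc k) V) = (shift U + cross k (chart (Suc k) U) (chart (Suc k) V)) mod ?q"
      unfolding shift_def using ch UV(3,4) small_mono by (intro cross_add[of _ _ _ _ y]) auto
    have "y \<in> \<pi> ` chart (Suc k) U" "y \<in> \<pi> ` chart (Suc k) V"
      using ch(1,2) UV(3,4) by simp_all
    then obtain a b where ab: "a \<in> chart (Suc k) U" "b \<in> chart (Suc k) V" "\<pi> a = \<pi> b"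
      by (elim imageE) simp
    have abX: "a \<in> topspace X" "b \<in> topspace X" using ab chart_subset UV by blast+
    have "transition (Suc k) U V = trans a b (Suc k)"
      unfolding transition_def using ch ab by (intro cross) auto
    moreover have "cross k (chart (Suc k) U) (chart (Suc k) V) = trans a b k"
      using ch ab small_mono by (intro cross) auto
    ultimately have "cross k (chart (Suc k) U) (chart (Suc k) V) = transition (Suc k) U V mod ?q"
      using padic_coherent[OF p_pos(1) trans(1)[OF abX ab(3)], of k "Suc k"] by simp
    with 1 2 have "(transition k U V + shift V) mod ?q = (shift U + transition (Suc k) U V) mod ?q"
      by (simp add: mod_add_right_eq)
    then have "?q dvd transition k U V + shift V - (shift U + transition (Suc k) U V)"
      by (simp add: mod_eq_dvd_iff)
    also have "transition k U V + shift V - (shift U + transition (Suc k) U V) =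
        transition k U V - transition (Suc k) U V - shift U + shift V" by simp
    finally show ?thesis by (simp add: e_def)
  qed
  have "cobounds (chart_cover (Suc k)) e
     (\<lambda>a b c. bockstein k [a, b, c] - int p * bockstein (Suc k) [a, b, c])"
    unfolding cobounds_def
  proof (intro allI impI)
    fix a b c assume s: "[a, b, c] \<in> nerve_simplices 2 (chart_cover (Suc k))"
    then have s': "[a, b, c] \<in> nerve_simplices 2 (chart_cover k)"
      unfolding simplex2_iff using chart_cover_mono by blast
    obtain y where U: "a \<in> chart_cover (Suc k)" "b \<in> chart_cover (Suc k)" "c \<in> chart_cover (Suc k)"
      "y \<in> a" "y \<in> b" "y \<in> c"
      using s unfolding simplex2_iff by blast
    have "?q * (bockstein k [a, b, c] - int p * bockstein (Suc k) [a, b, c]) = ?q * (e b c - e a c + e a b)"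
      using bockstein_eq[OF s] bockstein_eq[OF s'] e[OF U(2,3,5,6)] e[OF U(1,3,4,6)] e[OF U(1,2,4,5)]
      by (simp add: algebra_simps)
    then show "bockstein k [a, b, c] - int p * bockstein (Suc k) [a, b, c] = e b c - e a c + e a b"
      using p_pos(1) p_pos(2)[of k] by simp
  qed
  then show ?thesis by blast
qed

end

section \<open>Covering dimension\<close>

lemma covering_dim_le_mono: "covering_dim_le X n \<Longrightarrow> n \<le> k \<Longrightarrow> covering_dim_le X k"
  unfolding covering_dim_le_def
proof (intro allI impI)
  fix \<U> assume le: "n \<le> k" and U: "finite \<U> \<and> open_cover X \<U>"
    and "\<forall>\<U>. finite \<U> \<and> open_cover X \<U> \<longrightarrow> (\<exists>\<V>. finite \<V> \<and> open_cover X \<V> \<and> refines \<V> \<U> \<and>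
           (\<forall>x\<in>topspace X. int (card {V \<in> \<V>. x \<in> V}) \<le> n + 1))"
  then obtain \<V> where "finite \<V>" "open_cover X \<V>" "refines \<V> \<U>"
    and "\<forall>x\<in>topspace X. int (card {V \<in> \<V>. x \<in> V}) \<le> n + 1" by blast
  moreover then have "\<forall>x\<in>topspace X. int (card {V \<in> \<V>. x \<in> V}) \<le> k + 1" using le by force
  ultimately show "\<exists>\<V>. finite \<V> \<and> open_cover X \<V> \<and> refines \<V> \<U> \<and>
           (\<forall>x\<in>topspace X. int (card {V \<in> \<V>. x \<in> V}) \<le> k + 1)" by blast
qed

lemma covering_dim_eqD:
  assumes "covering_dim X = ereal (real n)"
  shows "covering_dim_le X (int n)"
proof -
  have "covering_dim X < ereal (real n + 1)" using assms by simp
  then obtain k where k: "covering_dim_le X k" "ereal (real_of_int k) < ereal (real n + 1)"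
    unfolding covering_dim_def INF_less_iff by blast
  then have "k \<le> int n" by simp
  then show ?thesis using covering_dim_le_mono k(1) by blast
qed

lemma covering_dim_leD: "covering_dim_le X k \<Longrightarrow> k \<ge> -1 \<Longrightarrow> covering_dim X \<le> ereal (real_of_int k)"
  unfolding covering_dim_def by (intro INF_lower) simp

lemma finite_open_cover_refinement:
  assumes dim: "covering_dim_le X n" and U: "finite \<U>" "open_cover X \<U>"
  obtains \<V> where "finite \<V>" "open_cover X \<V>" "refines \<V> \<U>"
    "\<And>x. x \<in> topspace X \<Longrightarrow> int (card {V \<in> \<V>. x \<in> V}) \<le> n + 1"
proof -
  have "\<exists>\<V>. finite \<V> \<and> open_cover X \<V> \<and> refines \<V> \<U> \<and>
         (\<forall>x\<in>topspace X. int (card {V \<in> \<V>. x \<in> V}) \<le> n + 1)"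
    using dim U unfolding covering_dim_le_def by simp
  then show thesis using that by blast
qed

lemma card_containing_image_le:
  assumes "finite \<V>" "\<And>V. V \<in> \<V> \<Longrightarrow> f V \<subseteq> V"
  shows "card {W \<in> f ` \<V>. x \<in> W} \<le> card {V \<in> \<V>. x \<in> V}"
proof -
  have "{W \<in> f ` \<V>. x \<in> W} \<subseteq> f ` {V \<in> \<V>. x \<in> V}" using assms(2) by blast
  then have "card {W \<in> f ` \<V>. x \<in> W} \<le> card (f ` {V \<in> \<V>. x \<in> V})"
    using assms(1) by (intro card_mono) auto
  also have "\<dots> \<le> card {V \<in> \<V>. x \<in> V}" using assms(1) by (intro card_image_le) auto
  finally show ?thesis .
qed

text \<open>A cover of \<open>A\<close> extends to \<open>X\<close> by adding the complement of \<open>A\<close>; members of a refinement that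
  meet \<open>A\<close> cannot lie in that complement.\<close>

lemma covering_dim_le_closed_subspace:
  assumes dim: "covering_dim_le X n" and A: "closedin X A"
  shows "covering_dim_le (subtopology X A) n"
  unfolding covering_dim_le_def
proof (intro allI impI; elim conjE)
  fix \<U> assume U: "finite \<U>" "open_cover (subtopology X A) \<U>"
  have AX: "A \<subseteq> topspace X" using A closedin_subset by blast
  have "\<forall>U\<in>\<U>. \<exists>T. openin X T \<and> U = T \<inter> A"
    using U(2) unfolding open_cover_def openin_subtopology by blast
  then obtain T where T: "\<And>U. U \<in> \<U> \<Longrightarrow> openin X (T U)" "\<And>U. U \<in> \<U> \<Longrightarrow> U = T U \<inter> A" by metis
  let ?C = "insert (topspace X - A) (T ` \<U>)"
  have op: "openin X (topspace X - A)" using A by blast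
  have "\<Union>\<U> = A" using U(2) AX unfolding open_cover_def by auto
  then have "A \<subseteq> \<Union>(T ` \<U>)" using T(2) by blast
  moreover have "\<Union>(T ` \<U>) \<subseteq> topspace X" using T(1) openin_subset by blast
  ultimately have "open_cover X ?C"
    unfolding open_cover_def using T(1) op AX by auto
  then obtain \<V> where V: "finite \<V>" "open_cover X \<V>" "refines \<V> ?C"
    "\<And>x. x \<in> topspace X \<Longrightarrow> int (card {V \<in> \<V>. x \<in> V}) \<le> n + 1"
    using finite_open_cover_refinement[OF dim, of ?C] U(1) by auto
  let ?W = "(\<lambda>V. V \<inter> A) ` {V \<in> \<V>. V \<inter> A \<noteq> {}}"
  show "\<exists>\<V>. finite \<V> \<and> open_cover (subtopology X A) \<V> \<and> refines \<V> \<U> \<and>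
         (\<forall>x\<in>topspace (subtopology X A). int (card {V \<in> \<V>. x \<in> V}) \<le> n + 1)"
  proof (intro exI[of _ ?W] conjI ballI)
    show "finite ?W" using V(1) by simp
    have "\<Union>?W = A" using V(2) AX unfolding open_cover_def by blast
    then show "open_cover (subtopology X A) ?W"
      using V(2) AX unfolding open_cover_def by (auto intro: openin_subtopology_Int)
    show "refines ?W \<U>"
      unfolding refines_def
    proof
      fix W assume "W \<in> ?W"
      then obtain V where "V \<in> \<V>" "V \<inter> A \<noteq> {}" and W: "W = V \<inter> A" by blast
      then obtain U where "U \<in> \<U>" "V \<subseteq> T U" using V(3) unfolding refines_def by blast
      then show "\<exists>U\<in>\<U>. W \<subseteq> U" using T(2)[of U] W by blast
    qed
    fix x assume x: "x \<in> topspace (subtopology X A)"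
    have "card {W \<in> ?W. x \<in> W} \<le> card {V \<in> {V \<in> \<V>. V \<inter> A \<noteq> {}}. x \<in> V}"
      using V(1) by (intro card_containing_image_le) auto
    also have "\<dots> \<le> card {V \<in> \<V>. x \<in> V}" using V(1) by (intro card_mono) auto
    finally show "int (card {W \<in> ?W. x \<in> W}) \<le> n + 1" using V(4)[of x] x by simp
  qed
qed

section \<open>Covers by sets invariant under a small subgroup\<close>

context padic_bundle
begin

definition invariant :: "nat \<Rightarrow> 'a set \<Rightarrow> bool" where
  "invariant k V \<longleftrightarrow> (\<forall>x\<in>V. \<forall>t\<in>Ap. t k = 0 \<longrightarrow> \<phi> t x \<in> V)"

lemma vanishing_mono:
  assumes "t \<in> Ap" "t k = 0" "j \<le> k"
  shows "t j = 0"
  using padic_coherent[OF p_pos(1) assms(1,3)] assms(2) by simp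

lemma invariant_mono: "invariant j V \<Longrightarrow> j \<le> k \<Longrightarrow> invariant k V"
  unfolding invariant_def using vanishing_mono by blast

text \<open>The largest \<open>p\<^sup>kA\<^sub>p\<close>-invariant subset of \<open>V\<close>.\<close>

definition core :: "nat \<Rightarrow> 'a set \<Rightarrow> 'a set" where
  "core k V = {x \<in> topspace X. \<forall>t\<in>Ap. t k = 0 \<longrightarrow> \<phi> t x \<in> V}"

lemma one_closed: "\<one>\<^bsub>P\<^esub> \<in> Ap" using P.one_closed by simp

lemma core_subset: "core k V \<subseteq> V"
proof
  fix x assume x: "x \<in> core k V"
  then have "\<phi> \<one>\<^bsub>P\<^esub> x \<in> V" using one_closed by (simp add: core_def one_padic)
  then show "x \<in> V" using act_one[of x] x by (simp add: core_def)
qed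

lemma core_mono: "j \<le> k \<Longrightarrow> core j V \<subseteq> core k V"
  unfolding core_def using vanishing_mono by blast

lemma invariant_core: "invariant k (core k V)"
  unfolding invariant_def
proof (intro ballI impI)
  fix x t assume x: "x \<in> core k V" and t: "t \<in> Ap" "t k = 0"
  then have xX: "x \<in> topspace X" by (simp add: core_def)
  have "\<phi> s (\<phi> t x) \<in> V" if s: "s \<in> Ap" "s k = 0" for s
  proof -
    have "s \<otimes>\<^bsub>P\<^esub> t \<in> Ap" using P.m_closed[of s t] s t by simp
    moreover have "(s \<otimes>\<^bsub>P\<^esub> t) k = 0" using s t by (simp add: mult_padic)
    ultimately have "\<phi> (s \<otimes>\<^bsub>P\<^esub> t) x \<in> V" using x unfolding core_def by blast
    then show ?thesis using act_mult[OF s(1) t(1) xX] by simp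
  qed
  then show "\<phi> t x \<in> core k V" using act_closed[OF t(1) xX] by (simp add: core_def)
qed

text \<open>The complement is the image of a closed set under the projection along the compact
  group \<open>A\<^sub>p\<close>, which is a closed map.\<close>

lemma core_open:
  assumes V: "openin X V"
  shows "openin X (core k V)"
proof -
  let ?T = "padic_topology p"
  let ?C = "{w \<in> topspace (prod_topology ?T X). fst w \<in> {t \<in> Ap. t k \<in> {0}}}
     \<inter> {w \<in> topspace (prod_topology ?T X). (\<lambda>(t, x). \<phi> t x) w \<in> topspace X - V}"
  have "closedin (prod_topology ?T X) ?C"
    using V by (intro closedin_Int closedin_continuous_map_preimage[OF continuous_map_fst]
        closedin_continuous_map_preimage[OF act_continuous] padic_coordinate_closed) blast
  then have "closedin X (snd ` ?C)"
    using closed_map_snd[OF compact_space_padic[OF p_pos(1)]] unfolding closed_map_def by blast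
  moreover have "core k V = topspace X - snd ` ?C"
  proof (rule subset_antisym; rule subsetI)
    fix x assume "x \<in> core k V"
    then show "x \<in> topspace X - snd ` ?C" by (auto simp: core_def)
  next
    fix x assume x: "x \<in> topspace X - snd ` ?C"
    have "\<phi> t x \<in> V" if t: "t \<in> Ap" "t k = 0" for t
    proof (rule ccontr)
      assume "\<phi> t x \<notin> V"
      then have "(t, x) \<in> ?C" using t x act_closed by auto
      then have "snd (t, x) \<in> snd ` ?C" by (rule imageI)
      then show False using x unfolding snd_conv by blast
    qed
    then show "x \<in> core k V" using x by (simp add: core_def)
  qed
  ultimately show ?thesis by auto
qed

text \<open>The elements of \<open>A\<^sub>p\<close> that keep \<open>x\<close> in \<open>V\<close> form a neighbourhood of the identity.\<close>

lemma core_exhausts: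
  assumes V: "openin X V" and x: "x \<in> V"
  shows "\<exists>k. x \<in> core k V"
proof -
  have xX: "x \<in> topspace X" using openin_subset V x by blast
  have "continuous_map (padic_topology p) X (\<lambda>t. \<phi> t x)"
    using continuous_map_compose[OF _ act_continuous, of "padic_topology p" "\<lambda>t. (t, x)"] xX
    by (simp add: continuous_map_pairwise comp_def)
  from openin_continuous_map_preimage[OF this V]
  have "openin (padic_topology p) {t \<in> Ap. \<phi> t x \<in> V}" by simp
  moreover have "\<one>\<^bsub>P\<^esub> \<in> {t \<in> Ap. \<phi> t x \<in> V}" using act_one xX x one_closed by simp
  ultimately obtain k where "\<forall>t\<in>Ap. t k = 0 \<longrightarrow> t \<in> {t \<in> Ap. \<phi> t x \<in> V}"
    using padic_nhds_one[OF p_pos(1)] by blast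
  then show ?thesis using xX by (auto simp: core_def)
qed

text \<open>Replacing the members of a refinement by their cores does not raise the multiplicity, and by
  compactness the cores still cover for large \<open>k\<close>. So a cover of \<open>X\<close> may be taken from the finite stage
  \<open>X/p\<^sup>kA\<^sub>p\<close>.\<close>

lemma invariant_refinement:
  assumes dim: "covering_dim_le X n" and U: "finite \<U>" "open_cover X \<U>"
  obtains k \<V> where "k \<ge> j" "finite \<V>" "open_cover X \<V>" "refines \<V> \<U>" "\<And>V. V \<in> \<V> \<Longrightarrow> invariant k V"
    "\<And>x. x \<in> topspace X \<Longrightarrow> int (card {V \<in> \<V>. x \<in> V}) \<le> n + 1"
proof -
  obtain \<V> where V: "finite \<V>" "open_cover X \<V>" "refines \<V> \<U>"
    "\<And>x. x \<in> topspace X \<Longrightarrow> int (card {V \<in> \<V>. x \<in> V}) \<le> n + 1"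
    using finite_open_cover_refinement[OF dim U] by blast
  define D where "D k = \<Union>(core k ` \<V>)" for k
  have Dopen: "openin X (D k)" for k
    unfolding D_def using V(2) core_open unfolding open_cover_def by blast
  have Dmono: "D i \<subseteq> D k" if "i \<le> k" for i k
    unfolding D_def using core_mono[OF that] by blast
  have "topspace X \<subseteq> \<Union>(range D)"
  proof
    fix x assume "x \<in> topspace X"
    then obtain v where v: "v \<in> \<V>" "x \<in> v" using V(2) unfolding open_cover_def by blast
    then obtain k where "x \<in> core k v" using core_exhausts V(2) unfolding open_cover_def by blast
    then show "x \<in> \<Union>(range D)" using v unfolding D_def by blast
  qed
  then obtain \<F> where F: "finite \<F>" "\<F> \<subseteq> range D" "topspace X \<subseteq> \<Union>\<F>"
    using compact_X[unfolded compact_space_alt, rule_format, of "range D"] Dopen by blast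
  obtain I where I: "finite I" "\<F> = D ` I" using finite_subset_image[OF F(1,2)] by blast
  define k where "k = Max (insert j I)"
  have k: "j \<le> k" "\<And>i. i \<in> I \<Longrightarrow> i \<le> k" unfolding k_def using I(1) by auto
  have top: "topspace X = D k"
  proof
    show "topspace X \<subseteq> D k" using F(3) Dmono k(2) unfolding I(2) by blast
    show "D k \<subseteq> topspace X" using Dopen openin_subset by blast
  qed
  show thesis
  proof (rule that[OF k(1)])
    show "finite (core k ` \<V>)" using V(1) by simp
    show "open_cover X (core k ` \<V>)"
      using top V(2) core_open unfolding D_def open_cover_def by auto
    show "refines (core k ` \<V>) \<U>"
      unfolding refines_def
    proof
      fix W assume "W \<in> core k ` \<V>"
      then obtain v where v: "v \<in> \<V>" "W = core k v" by blast
      then obtain U where "U \<in> \<U>" "v \<subseteq> U" using V(3) unfolding refines_def by blast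
      then show "\<exists>U\<in>\<U>. W \<subseteq> U" using core_subset[of k v] v(2) by blast
    qed
    show "invariant k W" if "W \<in> core k ` \<V>" for W using that invariant_core by blast
    fix x assume "x \<in> topspace X"
    then have "int (card {V \<in> \<V>. x \<in> V}) \<le> n + 1" by (rule V(4))
    moreover have "card {W \<in> core k ` \<V>. x \<in> W} \<le> card {V \<in> \<V>. x \<in> V}"
      using V(1) core_subset by (intro card_containing_image_le) auto
    ultimately show "int (card {W \<in> core k ` \<V>. x \<in> W}) \<le> n + 1" by linarith
  qed
qed

end

lemma cover_member: "open_cover X \<U> \<Longrightarrow> x \<in> topspace X \<Longrightarrow> \<exists>U\<in>\<U>. x \<in> U"
  unfolding open_cover_def by auto

lemma cover_open: "open_cover X \<U> \<Longrightarrow> U \<in> \<U> \<Longrightarrow> openin X U"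
  unfolding open_cover_def by simp

lemma meet_cover:
  assumes "open_cover X \<U>" "open_cover X \<V>"
  shows "open_cover X ((\<lambda>(u, v). u \<inter> v) ` (\<U> \<times> \<V>))"
  unfolding open_cover_def
proof (intro conjI ballI subset_antisym subsetI)
  show "openin X W" if W: "W \<in> (\<lambda>(u, v). u \<inter> v) ` (\<U> \<times> \<V>)" for W
    using W cover_open[OF assms(1)] cover_open[OF assms(2)] by (auto intro: openin_Int)
  fix x
  show "x \<in> topspace X" if x: "x \<in> \<Union>((\<lambda>(u, v). u \<inter> v) ` (\<U> \<times> \<V>))"
  proof -
    obtain u where "u \<in> \<U>" "x \<in> u" using x by auto
    then show ?thesis using openin_subset[OF cover_open[OF assms(1)]] by blast
  qed
  assume "x \<in> topspace X"
  then obtain u v where uv: "u \<in> \<U>" "v \<in> \<V>" and x: "x \<in> u \<inter> v"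
    using cover_member[OF assms(1)] cover_member[OF assms(2)] by blast
  have "u \<inter> v \<in> (\<lambda>(u, v). u \<inter> v) ` (\<U> \<times> \<V>)" using uv by force
  then show "x \<in> \<Union>((\<lambda>(u, v). u \<inter> v) ` (\<U> \<times> \<V>))" using x by (rule UnionI)
qed

section \<open>Equivariant angles bound the dimension of the quotient\<close>

context padic_bundle
begin

text \<open>The function \<open>G\<close> represents a map to the circle \<open>\<real>/p\<^sup>k\<int>\<close>; the predicate says that \<open>s\<close> is
  one of the real representatives of the angle of \<open>x\<close>.\<close>

definition at_angle :: "nat \<Rightarrow> ('a \<Rightarrow> real) \<Rightarrow> 'a \<Rightarrow> real \<Rightarrow> bool" where
  "at_angle k G x s \<longleftrightarrow> (\<exists>i. s = G x + real_of_int (int p ^ k * i))"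

text \<open>Equivariance, where \<open>t\<close> rotates by the residue \<open>t k\<close>, and continuity as a map to
  \<open>\<real>/p\<^sup>k\<int>\<close>, tested on the images of open intervals. A representative \<open>G\<close> itself is in general
  discontinuous.\<close>

definition angle_map :: "nat \<Rightarrow> ('a \<Rightarrow> real) \<Rightarrow> bool" where
  "angle_map k G \<longleftrightarrow>
     (\<forall>x\<in>topspace X. \<forall>t\<in>Ap. at_angle k G (\<phi> t x) (G x + real_of_int (t k))) \<and>
     (\<forall>a b. openin X {x \<in> topspace X. \<exists>s. a < s \<and> s < b \<and> at_angle k G x s})"

lemma at_angle_act:
  assumes G: "angle_map k G" and x: "x \<in> topspace X" and t: "t \<in> Ap" and s: "at_angle k G x s"
    and u: "u = s + real_of_int (t k + int p ^ k * j)"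
  shows "at_angle k G (\<phi> t x) u"
proof -
  obtain i where "s = G x + real_of_int (int p ^ k * i)" using s unfolding at_angle_def by blast
  moreover obtain i' where "G x + real_of_int (t k) = G (\<phi> t x) + real_of_int (int p ^ k * i')"
    using G x t unfolding angle_map_def at_angle_def by blast
  ultimately have "u = G (\<phi> t x) + real_of_int (int p ^ k * (i' + i + j))"
    using u by (simp add: algebra_simps)
  then show ?thesis unfolding at_angle_def by blast
qed

lemma at_angle_act_cancel:
  assumes G: "angle_map k G" and x: "x \<in> topspace X" and t: "t \<in> Ap" and s: "at_angle k G (\<phi> t x) s"
  shows "at_angle k G x (s - real_of_int (t k))"
proof -
  obtain i where "s = G (\<phi> t x) + real_of_int (int p ^ k * i)" using s unfolding at_angle_def by blast
  moreover obtain i' where "G x + real_of_int (t k) = G (\<phi> t x) + real_of_int (int p ^ k * i')"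
    using G x t unfolding angle_map_def at_angle_def by blast
  ultimately have "s - real_of_int (t k) = G x + real_of_int (int p ^ k * (i - i'))"
    by (simp add: algebra_simps)
  then show ?thesis unfolding at_angle_def by blast
qed

lemma angle_difference:
  assumes G: "angle_map k G" and x: "x \<in> topspace X" "x' \<in> topspace X" "\<pi> x = \<pi> x'"
    and s: "at_angle k G x s" "at_angle k G x' s'"
  shows "s' - s \<in> \<int>"
proof -
  obtain t where t: "t \<in> Ap" "x' = \<phi> t x" using proj_eq_iff x by blast
  have "at_angle k G x (s' - real_of_int (t k))" using at_angle_act_cancel[OF G x(1) t(1)] s(2) t(2) by simp
  then obtain i where "s' - real_of_int (t k) = G x + real_of_int (int p ^ k * i)"
    unfolding at_angle_def by blast
  moreover obtain i' where "s = G x + real_of_int (int p ^ k * i')" using s(1) unfolding at_angle_def by blast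
  ultimately have "s' - s = real_of_int (t k + int p ^ k * (i - i'))" by (simp add: algebra_simps)
  then show ?thesis by simp
qed

text \<open>Angles of points of one orbit differ by integers, so angles at distance below \<open>1\<close> are equal;
  and points of an orbit with equal angles differ by an element of \<open>p\<^sup>kA\<^sub>p\<close>, which preserves \<open>V\<close>.\<close>

lemma same_angle_invariant:
  assumes G: "angle_map k G" and x: "x \<in> topspace X" "x' \<in> topspace X" "\<pi> x = \<pi> x'"
    and s: "at_angle k G x s" "at_angle k G x' s'" and close: "\<bar>s' - s\<bar> < 1"
    and V: "invariant k V" "x \<in> V"
  shows "s' = s" "x' \<in> V"
proof -
  obtain z where z: "s' - s = real_of_int z" using angle_difference[OF G x s] by (elim Ints_cases)
  then have "z = 0" using close by simp
  then show ss: "s' = s" using z by simp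
  obtain t where t: "t \<in> Ap" "x' = \<phi> t x" using proj_eq_iff x by blast
  have "at_angle k G x (s' - real_of_int (t k))" using at_angle_act_cancel[OF G x(1) t(1)] s(2) t(2) by simp
  then obtain i where "s' - real_of_int (t k) = G x + real_of_int (int p ^ k * i)"
    unfolding at_angle_def by blast
  moreover obtain i' where "s = G x + real_of_int (int p ^ k * i')" using s(1) unfolding at_angle_def by blast
  ultimately have "real_of_int (t k) = real_of_int (int p ^ k * (i' - i))"
    using ss by (simp add: algebra_simps)
  then have "t k = int p ^ k * (i' - i)" by linarith
  moreover have "t k mod int p ^ k = t k"
    using padic_coherent[OF p_pos(1) t(1), of k k] by simp
  ultimately have "t k = 0" by (metis mod_mult_self1_is_0)
  then show "x' \<in> V" using V t unfolding invariant_def by blast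
qed

text \<open>The fibre over a point of \<open>Y\<close> meets all residues, so one can translate the angle into
  \<open>[0, 1)\<close>.\<close>

lemma unit_angle_exists:
  assumes G: "angle_map k G" and y: "y \<in> topspace Y"
  obtains x s where "x \<in> topspace X" "\<pi> x = y" "at_angle k G x s" "0 \<le> s" "s < 1"
proof -
  obtain x where x: "x \<in> topspace X" "\<pi> x = y" using y unfolding proj_onto[symmetric] by (elim imageE) simp
  define t where "t = padic_of_int p (- \<lfloor>G x\<rfloor>)"
  have t: "t \<in> Ap" unfolding t_def by (rule padic_of_int_closed[OF p_pos(1)])
  define z where "z = - \<lfloor>G x\<rfloor>"
  have z: "t k + int p ^ k * (z div int p ^ k) = z"
    by (simp add: t_def padic_of_int_def z_def)
  have "G x - real_of_int \<lfloor>G x\<rfloor> = G x + real_of_int (t k + int p ^ k * (z div int p ^ k))"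
    unfolding z by (simp add: z_def)
  moreover have "at_angle k G x (G x)" unfolding at_angle_def by (rule exI[of _ 0]) simp
  ultimately have "at_angle k G (\<phi> t x) (G x - real_of_int \<lfloor>G x\<rfloor>)"
    using at_angle_act[OF G x(1) t] by blast
  moreover have "0 \<le> G x - real_of_int \<lfloor>G x\<rfloor>" "G x - real_of_int \<lfloor>G x\<rfloor> < 1" by linarith+
  ultimately show thesis
    using that[OF act_closed[OF t x(1)]] proj_act[OF t x(1)] x(2) by simp
qed

lemma translate_cover:
  assumes t: "t \<in> Ap" and V: "open_cover X \<V>"
  shows "open_cover X ((`) (\<phi> t) ` \<V>)"
  unfolding open_cover_def
proof (intro conjI ballI subset_antisym subsetI)
  have op: "openin X (\<phi> t ` v)" if "v \<in> \<V>" for v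
    by (rule act_image_open[OF t cover_open[OF V that]])
  show "openin X W" if W: "W \<in> (`) (\<phi> t) ` \<V>" for W
    using W op by (elim imageE) simp
  show "x \<in> topspace X" if x: "x \<in> \<Union>((`) (\<phi> t) ` \<V>)" for x
  proof -
    obtain v where v: "v \<in> \<V>" "x \<in> \<phi> t ` v" using x by blast
    show ?thesis using openin_subset[OF op[OF v(1)]] v(2) by blast
  qed
  fix x assume x: "x \<in> topspace X"
  obtain v where v: "v \<in> \<V>" "\<phi> (inv\<^bsub>P\<^esub> t) x \<in> v"
    using cover_member[OF V act_closed[OF inv_padic_closed[OF t] x]] by blast
  have "x \<in> \<phi> t ` v" using act_inv'[OF t x] v(2) by (metis image_eqI)
  then show "x \<in> \<Union>((`) (\<phi> t) ` \<V>)" using v(1) by blast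
qed

end

text \<open>Endpoints of disjoint consecutive subintervals of \<open>[1/4, 1/2]\<close>, one for each member of the cover.\<close>

definition level :: "nat \<Rightarrow> real" where
  "level j = 1/2 - 1 / (real j + 4)"

lemma level: "1/4 \<le> level j" "level j < level (Suc j)" "level j < 1/2" "i \<le> j \<Longrightarrow> level i \<le> level j"
proof -
  have anti: "1 / (real j + 4) \<le> 1 / (real i + 4)" if "i \<le> j" for i j
    using that by (intro divide_left_mono) auto
  show "1/4 \<le> level j" using anti[of 0 j] by (simp add: level_def)
  show "level j < level (Suc j)"
    unfolding level_def by (intro diff_strict_left_mono divide_strict_left_mono) auto
  show "level j < 1/2" by (simp add: level_def)
  show "i \<le> j \<Longrightarrow> level i \<le> level j" using anti[of i j] by (simp add: level_def)
qed

lemma level_unique: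
  assumes "level i < u" "u < level (Suc i)" "level j < u" "u < level (Suc j)"
  shows "i = j"
  using assms level(4)[of "Suc i" j] level(4)[of "Suc j" i] by (cases i j rule: linorder_cases) auto

context padic_bundle
begin

lemma preimage_cover:
  assumes U: "open_cover Y \<U>"
  shows "open_cover X ((\<lambda>U. {x \<in> topspace X. \<pi> x \<in> U}) ` \<U>)"
  unfolding open_cover_def
proof (intro conjI ballI subset_antisym subsetI)
  show "openin X V" if V: "V \<in> (\<lambda>U. {x \<in> topspace X. \<pi> x \<in> U}) ` \<U>" for V
    using V openin_continuous_map_preimage[OF proj_continuous cover_open[OF U]] by (elim imageE) simp
  fix x
  show "x \<in> topspace X" if x: "x \<in> \<Union>((\<lambda>U. {x \<in> topspace X. \<pi> x \<in> U}) ` \<U>)"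
    using x by blast
  assume x: "x \<in> topspace X"
  then have "\<pi> x \<in> topspace Y" unfolding proj_onto[symmetric] by (rule imageI)
  from cover_member[OF U this] x
  show "x \<in> \<Union>((\<lambda>U. {x \<in> topspace X. \<pi> x \<in> U}) ` \<U>)" by blast
qed

text \<open>The angle cuts \<open>Y\<close> open: over an arc of length \<open>1\<close> the fibre has a preferred point modulo
  \<open>p\<^sup>kA\<^sub>p\<close>, so a \<open>p\<^sup>kA\<^sub>p\<close>-invariant cover of \<open>X\<close> gives a cover of the part of \<open>Y\<close> over that arc with
  the same multiplicity. Going once around the circle replaces the preferred point \<open>x\<close> by its translate
  by \<open>t = 1 \<in> A\<^sub>p\<close>, so at the seam the covers \<open>\<V>\<close> and \<open>t\<V>\<close> must be matched. Choose a common refinement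
  \<open>\<W>\<close> of both, again of multiplicity \<open>n + 1\<close>, with projections \<open>r\<close> and \<open>r'\<close>. Near angle \<open>0\<close> the cover
  \<open>\<V>\<close> is used, near angle \<open>1/2\<close> the cover \<open>\<W>\<close>, and in between one passes from \<open>\<V>\<close> to \<open>\<W>\<close> by
  exchanging the members \<open>w\<close> for \<open>r w\<close> one at a time, \<open>w\<close> and \<open>r w\<close> being both present only at levels
  between \<open>lo w\<close> and \<open>hi w\<close>; similarly with \<open>r'\<close> between \<open>1/2\<close> and \<open>1\<close>. This is the prism
  triangulation of the mapping cylinder of \<open>r\<close>. The intervals are disjoint, so at each level at most one
  \<open>w\<close> is doubled, and the multiplicity is at most \<open>n + 2\<close>. The number \<open>k\<close> is dictated by the
  invariance of \<open>\<W>\<close>, which is why angles are needed for all \<open>k\<close>.\<close>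

lemma quotient_covering_dim_le:
  assumes dim: "covering_dim_le X (int n)" and angles: "\<And>k. k \<ge> 1 \<Longrightarrow> \<exists>G. angle_map k G"
  shows "covering_dim_le Y (int n + 1)"
  unfolding covering_dim_le_def
proof (intro allI impI; elim conjE)
  fix \<U> assume U: "finite \<U>" "open_cover Y \<U>"
  let ?U = "(\<lambda>U. {x \<in> topspace X. \<pi> x \<in> U}) ` \<U>"
  have "open_cover X ?U" by (rule preimage_cover[OF U(2)])
  then obtain k0 \<V> where k0: "k0 \<ge> 1" and V: "finite \<V>" "open_cover X \<V>" "refines \<V> ?U"
      "\<And>V. V \<in> \<V> \<Longrightarrow> invariant k0 V" "\<And>x. x \<in> topspace X \<Longrightarrow> int (card {V \<in> \<V>. x \<in> V}) \<le> int n + 1"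
    using invariant_refinement[OF dim, of ?U 1] finite_imageI[OF U(1)] by blast
  define t where "t = padic_of_int p 1"
  have t: "t \<in> Ap" unfolding t_def by (rule padic_of_int_closed[OF p_pos(1)])
  let ?C = "(\<lambda>(v, v'). v \<inter> v') ` (\<V> \<times> ((`) (\<phi> t) ` \<V>))"
  have finite_C: "finite ?C" using V(1) by simp
  have "open_cover X ?C" by (rule meet_cover[OF V(2) translate_cover[OF t V(2)]])
  then obtain k \<W> where k: "k \<ge> k0" and W: "finite \<W>" "open_cover X \<W>" "refines \<W> ?C"
      "\<And>V. V \<in> \<W> \<Longrightarrow> invariant k V" "\<And>x. x \<in> topspace X \<Longrightarrow> int (card {V \<in> \<W>. x \<in> V}) \<le> int n + 1"
    using invariant_refinement[OF dim, of ?C k0] finite_C by blast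
  have "\<forall>w\<in>\<W>. \<exists>v v'. v \<in> \<V> \<and> v' \<in> \<V> \<and> w \<subseteq> v \<inter> \<phi> t ` v'"
  proof
    fix w assume w: "w \<in> \<W>"
    obtain c where "c \<in> ?C" "w \<subseteq> c"
      using bspec[OF W(3)[unfolded refines_def] w] by (elim bexE)
    then obtain v v' where "v \<in> \<V>" "v' \<in> \<V>" "c = v \<inter> \<phi> t ` v'" by auto
    then show "\<exists>v v'. v \<in> \<V> \<and> v' \<in> \<V> \<and> w \<subseteq> v \<inter> \<phi> t ` v'" using \<open>w \<subseteq> c\<close> by blast
  qed
  then obtain r r' where r: "\<And>w. w \<in> \<W> \<Longrightarrow> r w \<in> \<V>" "\<And>w. w \<in> \<W> \<Longrightarrow> w \<subseteq> r w"
    and r': "\<And>w. w \<in> \<W> \<Longrightarrow> r' w \<in> \<V>" "\<And>w. w \<in> \<W> \<Longrightarrow> w \<subseteq> \<phi> t ` r' w" 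
    by (metis (no_types, lifting) Int_subset_iff)
  have Vinv: "invariant k v" if "v \<in> \<V>" for v using V(4)[OF that] invariant_mono k by blast
  obtain G where G: "angle_map k G" using angles[of k] k k0 by auto
  have tk: "t k = 1"
  proof -
    have "1 < int p ^ k" using p k k0 by (intro one_less_power) auto
    then show ?thesis by (simp add: t_def padic_of_int_def)
  qed
  obtain num :: "'a set \<Rightarrow> nat" where num: "inj_on num \<W>"
    using finite_imp_inj_to_nat_seg[OF W(1)] by blast
  define lo hi where "lo w = level (num w)" and "hi w = level (Suc (num w))" for w
  have lohi: "1/4 \<le> lo w" "lo w < hi w" "hi w < 1/2" for w
    unfolding lo_def hi_def by (rule level(1) level(2) level(3))+
  define B where "B a b = {x \<in> topspace X. \<exists>s. a < s \<and> s < b \<and> at_angle k G x s}" for a b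
  have B: "openin X (B a b)" for a b using G unfolding angle_map_def B_def by blast
  \<comment> \<open>\<open>S v\<close>: near the seam all of \<open>v\<close>, and beyond it the part of \<open>v\<close> not yet exchanged;
     \<open>Q w\<close>: the part of \<open>w\<close> at levels where \<open>w\<close> has been introduced.\<close>
  define S where "S v = (v \<inter> B (-1/4) (1/4)) \<union> (\<Union>w\<in>{w \<in> \<W>. r w = v}. w \<inter> B 0 (hi w))
      \<union> (\<Union>w\<in>{w \<in> \<W>. r' w = v}. w \<inter> B (1 - hi w) 1)" for v
  define Q where "Q w = w \<inter> B (lo w) (1 - lo w)" for w
  have S1: "x \<in> S v" if "x \<in> v" "x \<in> B (-1/4) (1/4)" for x v
    using that unfolding S_def by simp
  have S2: "x \<in> S (r w)" if "w \<in> \<W>" "x \<in> w" "x \<in> B 0 (hi w)" for x w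
    using that unfolding S_def by auto
  have S3: "x \<in> S (r' w)" if "w \<in> \<W>" "x \<in> w" "x \<in> B (1 - hi w) 1" for x w
    using that unfolding S_def by auto
  have Wopen: "openin X w" if "w \<in> \<W>" for w by (rule cover_open[OF W(2) that])
  have Vopen: "openin X v" if "v \<in> \<V>" for v by (rule cover_open[OF V(2) that])
  have Sopen: "openin X (S v)" if "v \<in> \<V>" for v
    unfolding S_def using Vopen[OF that] Wopen B by (intro openin_Un openin_Union) auto
  have Qopen: "openin X (Q w)" if "w \<in> \<W>" for w unfolding Q_def using Wopen[OF that] B by blast
  let ?D = "(\<lambda>v. \<pi> ` S v) ` \<V> \<union> (\<lambda>w. \<pi> ` Q w) ` \<W>"
  have Wsub: "w \<subseteq> topspace X" if "w \<in> \<W>" for w by (rule openin_subset[OF Wopen[OF that]])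
  have Vsub: "v \<subseteq> topspace X" if "v \<in> \<V>" for v by (rule openin_subset[OF Vopen[OF that]])
  have preimage_angle: "\<exists>x'\<in>r' w. \<phi> t x' = x \<and> at_angle k G x' (s - 1)"
    if w: "w \<in> \<W>" "x \<in> w" and s: "at_angle k G x s" for w x s
  proof -
    obtain x' where x': "x' \<in> r' w" "\<phi> t x' = x" using r'(2)[OF w(1)] w(2) by blast
    then have "x' \<in> topspace X" using Vsub[OF r'(1)[OF w(1)]] by blast
    from at_angle_act_cancel[OF G this t] x' s tk show ?thesis by auto
  qed
  have refU: "\<exists>U\<in>\<U>. \<pi> ` v \<subseteq> U" if v: "v \<in> \<V>" for v
  proof -
    obtain U where "U \<in> \<U>" "v \<subseteq> {x \<in> topspace X. \<pi> x \<in> U}"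
      using V(3) v unfolding refines_def by auto
    then show ?thesis by blast
  qed
  have Ssub: "\<pi> ` S v \<subseteq> \<pi> ` v" if v: "v \<in> \<V>" for v
  proof
    fix y assume "y \<in> \<pi> ` S v"
    then obtain x where x: "x \<in> S v" "y = \<pi> x" by blast
    then consider "x \<in> v" | w where "w \<in> \<W>" "r w = v" "x \<in> w" | w where "w \<in> \<W>" "r' w = v" "x \<in> w"
      unfolding S_def by blast
    then show "y \<in> \<pi> ` v"
    proof cases
      case 1 then show ?thesis using x by blast
    next
      case 2 then show ?thesis using r(2) x by blast
    next
      case 3
      then obtain x' where "x' \<in> v" "\<phi> t x' = x" using r'(2) by blast
      then show ?thesis using proj_act[OF t] Vsub[OF v] x(2) by (metis image_eqI subsetD)
    qed
  qed
  show "\<exists>\<O>. finite \<O> \<and> open_cover Y \<O> \<and> refines \<O> \<U> \<and>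
      (\<forall>y\<in>topspace Y. int (card {D \<in> \<O>. y \<in> D}) \<le> int n + 1 + 1)"
  proof (intro exI[of _ ?D] conjI ballI)
    show "finite ?D" using V(1) W(1) by simp
    show "open_cover Y ?D"
      unfolding open_cover_def
    proof (intro conjI ballI subset_antisym subsetI)
      show "openin Y D" if "D \<in> ?D" for D
        using that proj_open Sopen Qopen unfolding open_map_def by auto
      then show "y \<in> topspace Y" if y: "y \<in> \<Union>?D" for y
        using y openin_subset[of Y] by (meson UnionE subsetD)
      fix y assume "y \<in> topspace Y"
      then obtain x s where x: "x \<in> topspace X" "\<pi> x = y" and s: "at_angle k G x s" "0 \<le> s" "s < 1"
        using unit_angle_exists[OF G] by blast
      obtain w where w: "w \<in> \<W>" "x \<in> w" using cover_member[OF W(2) x(1)] by blast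
      obtain v where v: "v \<in> \<V>" "x \<in> v" using cover_member[OF V(2) x(1)] by blast
      have inB: "x \<in> B a b" if "a < s" "s < b" for a b using that x(1) s(1) unfolding B_def by blast
      consider "s = 0" | "lo w < s" "s < 1 - lo w" | "0 < s" "s < hi w" | "1 - hi w < s"
        using s(2) lohi[of w] by linarith
      then have "x \<in> S v \<or> x \<in> Q w \<or> x \<in> S (r w) \<or> x \<in> S (r' w)"
      proof cases
        case 1 then show ?thesis using S1[OF v(2) inB[of "-1/4" "1/4"]] v(1) by auto
      next
        case 2 then show ?thesis using inB[OF 2] w(2) unfolding Q_def by blast
      next
        case 3 then show ?thesis using S2[OF w inB[OF 3]] by blast
      next
        case 4 then show ?thesis using S3[OF w inB[OF 4 s(3)]] by blast
      qed
      then show "y \<in> \<Union>?D" using v(1) w(1) r(1)[OF w(1)] r'(1)[OF w(1)] x(2) by blast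
    qed
    show "refines ?D \<U>"
      unfolding refines_def
    proof
      fix D assume "D \<in> ?D"
      then consider v where "v \<in> \<V>" "D = \<pi> ` S v" | w where "w \<in> \<W>" "D = \<pi> ` Q w" by blast
      then show "\<exists>U\<in>\<U>. D \<subseteq> U"
      proof cases
        case 1 then show ?thesis using refU[OF 1(1)] Ssub[OF 1(1)] by blast
      next
        case 2
        have "Q w \<subseteq> r w" using r(2)[OF 2(1)] unfolding Q_def by blast
        then show ?thesis using refU[OF r(1)[OF 2(1)]] 2(2) by blast
      qed
    qed
    fix y assume "y \<in> topspace Y"
    then obtain x0 s0 where x0: "x0 \<in> topspace X" "\<pi> x0 = y" and s0: "at_angle k G x0 s0" "0 \<le> s0" "s0 < 1"
      using unit_angle_exists[OF G] by blast
    have eqs: "s' = s" "x' \<in> V'"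
      if "x \<in> V'" "invariant k V'" "V' \<subseteq> topspace X" "x' \<in> topspace X" "\<pi> x = y" "\<pi> x' = y"
        "at_angle k G x s" "at_angle k G x' s'" "\<bar>s' - s\<bar> < 1" for x V' x' s s'
      using same_angle_invariant[OF G _ that(4) _ that(7,8,9,2,1)] that by auto
    have SE: thesis
      if yS: "y \<in> \<pi> ` S v" and v: "v \<in> \<V>"
        and 1: "\<And>x s. \<lbrakk>x \<in> v; \<pi> x = y; at_angle k G x s; -1/4 < s; s < 1/4\<rbrakk> \<Longrightarrow> thesis"
        and 2: "\<And>x s w. \<lbrakk>w \<in> \<W>; x \<in> w; r w = v; \<pi> x = y; at_angle k G x s; 0 < s; s < hi w\<rbrakk> \<Longrightarrow> thesis"
        and 3: "\<And>x s w. \<lbrakk>w \<in> \<W>; x \<in> w; r' w = v; \<pi> x = y; at_angle k G x s; 1 - hi w < s; s < 1\<rbrakk> \<Longrightarrow> thesis"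
      for v thesis
    proof -
      obtain x where x: "x \<in> S v" "\<pi> x = y" using yS by blast
      from x(1) consider "x \<in> v" "x \<in> B (-1/4) (1/4)" | w where "w \<in> \<W>" "r w = v" "x \<in> w" "x \<in> B 0 (hi w)"
        | w where "w \<in> \<W>" "r' w = v" "x \<in> w" "x \<in> B (1 - hi w) 1"
        unfolding S_def by blast
      then show thesis
      proof cases
        case c1: 1 then show thesis using 1 x(2) unfolding B_def by blast
      next
        case c2: 2 then show thesis using 2 x(2) unfolding B_def by blast
      next
        case c3: 3 then show thesis using 3 x(2) unfolding B_def by blast
      qed
    qed
    have QE: "\<exists>x s. x \<in> w \<and> \<pi> x = y \<and> at_angle k G x s \<and> lo w < s \<and> s < 1 - lo w"
      if "y \<in> \<pi> ` Q w" for w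
      using that unfolding Q_def B_def by blast
    show "int (card {D \<in> ?D. y \<in> D}) \<le> int n + 1 + 1"
    proof (cases "1/4 \<le> s0 \<and> s0 \<le> 3/4")
      case False
      \<comment> \<open>Near the seam only members of \<open>\<V>\<close> are active; the angle is moved into \<open>(-1/4, 1/4)\<close>.\<close>
      obtain x1 s1 where x1: "x1 \<in> topspace X" "\<pi> x1 = y" and s1: "at_angle k G x1 s1" "-1/4 < s1" "s1 < 1/4"
      proof (cases "s0 < 1/4")
        case True then show thesis using that[of x0 s0] x0 s0 by auto
      next
        case F: False
        let ?x = "\<phi> (inv\<^bsub>P\<^esub> t) x0"
        have X: "?x \<in> topspace X" using act_closed[OF inv_padic_closed[OF t] x0(1)] .
        have "at_angle k G (\<phi> t ?x) s0" using act_inv'[OF t x0(1)] s0(1) by simp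
        from at_angle_act_cancel[OF G X t this] tk have "at_angle k G ?x (s0 - 1)" by simp
        moreover have "\<pi> ?x = y" using proj_act[OF inv_padic_closed[OF t] x0(1)] x0(2) by simp
        ultimately show thesis using that[of ?x "s0 - 1"] X F False s0 by auto
      qed
      have "{D \<in> ?D. y \<in> D} \<subseteq> (\<lambda>v. \<pi> ` S v) ` {v \<in> \<V>. x1 \<in> v}"
      proof
        fix D assume "D \<in> {D \<in> ?D. y \<in> D}"
        then consider v where "v \<in> \<V>" "D = \<pi> ` S v" "y \<in> \<pi> ` S v" | w where "w \<in> \<W>" "y \<in> \<pi> ` Q w" by blast
        then show "D \<in> (\<lambda>v. \<pi> ` S v) ` {v \<in> \<V>. x1 \<in> v}"
        proof cases
          case 1
          have "x1 \<in> v"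
          proof (rule SE[OF 1(3,1)])
            fix x s assume "x \<in> v" "\<pi> x = y" "at_angle k G x s" "-1/4 < s" "s < 1/4"
            then show ?thesis
              using eqs(2)[of x v x1 s s1] Vinv[OF 1(1)] Vsub[OF 1(1)] x1 s1 by auto
          next
            fix x s w assume w: "w \<in> \<W>" "x \<in> w" "r w = v" and "\<pi> x = y" "at_angle k G x s" "0 < s" "s < hi w"
            moreover have "x \<in> v" using r(2)[OF w(1)] w by blast
            ultimately show ?thesis
              using eqs(2)[of x v x1 s s1] Vinv[OF 1(1)] Vsub[OF 1(1)] x1 s1 lohi(3)[of w] by auto
          next
            fix x s w assume w: "w \<in> \<W>" "x \<in> w" "r' w = v" and x: "\<pi> x = y" "at_angle k G x s" "1 - hi w < s" "s < 1"
            obtain x' where x': "x' \<in> v" "\<phi> t x' = x" "at_angle k G x' (s - 1)"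
              using preimage_angle[OF w(1,2) x(2)] w(3) by blast
            have "\<pi> x' = y" using proj_act[OF t, of x'] x'(1,2) Vsub[OF 1(1)] x(1) by auto
            then show ?thesis
              using eqs(2)[of x' v x1 "s - 1" s1] Vinv[OF 1(1)] Vsub[OF 1(1)] x1 s1 x x' lohi(3)[of w] by auto
          qed
          then show ?thesis using 1 by blast
        next
          case 2
          obtain x s where x: "x \<in> w" "\<pi> x = y" "at_angle k G x s" "lo w < s" "s < 1 - lo w" using QE[OF 2(2)] by blast
          then have "s1 = s"
            using eqs(1)[of x w x1 s s1] W(4)[OF 2(1)] Wsub[OF 2(1)] x1 s1 lohi(1)[of w] by auto
          then show ?thesis using x s1 lohi(1)[of w] by linarith
        qed
      qed
      then have "card {D \<in> ?D. y \<in> D} \<le> card ((\<lambda>v. \<pi> ` S v) ` {v \<in> \<V>. x1 \<in> v})"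
        using V(1) by (intro card_mono) auto
      also have "\<dots> \<le> card {v \<in> \<V>. x1 \<in> v}" using V(1) by (intro card_image_le) auto
      finally show ?thesis using V(5)[OF x1(1)] by linarith
    next
      case True
      \<comment> \<open>Each \<open>w\<close> containing \<open>x0\<close> is counted once, and twice if \<open>lo w < \<mu> < hi w\<close>.\<close>
      define \<rho> where "\<rho> = (if s0 < 1/2 then r else r')"
      define \<mu> where "\<mu> = min s0 (1 - s0)"
      let ?H = "{w \<in> \<W>. x0 \<in> w \<and> \<mu> < hi w}" and ?L = "{w \<in> \<W>. x0 \<in> w \<and> lo w < \<mu>}"
      have "{D \<in> ?D. y \<in> D} \<subseteq> (\<lambda>w. \<pi> ` S (\<rho> w)) ` ?H \<union> (\<lambda>w. \<pi> ` Q w) ` ?L"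
      proof
        fix D assume "D \<in> {D \<in> ?D. y \<in> D}"
        then consider v where "v \<in> \<V>" "D = \<pi> ` S v" "y \<in> \<pi> ` S v" | w where "w \<in> \<W>" "D = \<pi> ` Q w" "y \<in> \<pi> ` Q w" by blast
        then show "D \<in> (\<lambda>w. \<pi> ` S (\<rho> w)) ` ?H \<union> (\<lambda>w. \<pi> ` Q w) ` ?L"
        proof cases
          case 1
          have "\<exists>w\<in>?H. \<rho> w = v"
          proof (rule SE[OF 1(3,1)])
            fix x s assume x: "x \<in> v" "\<pi> x = y" "at_angle k G x s" "-1/4 < s" "s < 1/4"
            then have "s0 = s"
              using eqs(1)[of x v x0 s s0] Vinv[OF 1(1)] Vsub[OF 1(1)] x0 s0 True by auto
            then show ?thesis using x True by linarith
          next
            fix x s w assume w: "w \<in> \<W>" "x \<in> w" "r w = v" and x: "\<pi> x = y" "at_angle k G x s" "0 < s" "s < hi w"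
            then have "s0 = s" "x0 \<in> w"
              using eqs[of x w x0 s s0] W(4)[OF w(1)] Wsub[OF w(1)] x0 s0 True lohi(3)[of w] by auto
            then show ?thesis using w x lohi(3)[of w] by (intro bexI[of _ w]) (auto simp: \<rho>_def \<mu>_def)
          next
            fix x s w assume w: "w \<in> \<W>" "x \<in> w" "r' w = v" and x: "\<pi> x = y" "at_angle k G x s" "1 - hi w < s" "s < 1"
            then have "s0 = s" "x0 \<in> w"
              using eqs[of x w x0 s s0] W(4)[OF w(1)] Wsub[OF w(1)] x0 s0 True lohi(3)[of w] by auto
            then show ?thesis using w x lohi(3)[of w] by (intro bexI[of _ w]) (auto simp: \<rho>_def \<mu>_def)
          qed
          then show ?thesis using 1(2) by blast
        next
          case 2
          obtain x s where x: "x \<in> w" "\<pi> x = y" "at_angle k G x s" "lo w < s" "s < 1 - lo w" using QE[OF 2(3)] by blast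
          then have "s0 = s" "x0 \<in> w"
            using eqs[of x w x0 s s0] W(4)[OF 2(1)] Wsub[OF 2(1)] x0 s0 True lohi(1)[of w] by auto
          then have "w \<in> ?L" using 2(1) x by (simp add: \<mu>_def)
          then show ?thesis using 2(2) by blast
        qed
      qed
      then have "card {D \<in> ?D. y \<in> D} \<le> card ((\<lambda>w. \<pi> ` S (\<rho> w)) ` ?H \<union> (\<lambda>w. \<pi> ` Q w) ` ?L)"
        using W(1) by (intro card_mono) auto
      also have "\<dots> \<le> card ((\<lambda>w. \<pi> ` S (\<rho> w)) ` ?H) + card ((\<lambda>w. \<pi> ` Q w) ` ?L)" by (rule card_Un_le)
      also have "\<dots> \<le> card ?H + card ?L"
        using W(1) by (intro add_mono card_image_le) auto
      also have "\<dots> = card (?H \<union> ?L) + card (?H \<inter> ?L)"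
        using W(1) by (intro card_Un_Int) auto
      also have "\<dots> \<le> card {w \<in> \<W>. x0 \<in> w} + 1"
      proof (intro add_mono)
        show "card (?H \<union> ?L) \<le> card {w \<in> \<W>. x0 \<in> w}" using W(1) by (intro card_mono) auto
        have "w = w'" if "w \<in> ?H \<inter> ?L" "w' \<in> ?H \<inter> ?L" for w w'
        proof -
          have "num w = num w'"
            using that level_unique[of "num w" \<mu> "num w'"] unfolding lo_def hi_def by blast
          then show ?thesis using that num by (auto simp: inj_on_def)
        qed
        then show "card (?H \<inter> ?L) \<le> 1"
          by (metis (no_types, lifting) card_le_Suc0_iff_eq One_nat_def card.infinite le0 le_Suc_eq)
      qed
      finally show ?thesis using W(5)[OF x0(1)] by linarith
    qed
  qed
qed

end

section \<open>Restriction to a closed subset of the orbit space\<close>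

lemma (in padic_bundle) restrict_bundle:
  assumes A: "closedin Y A"
  shows "padic_bundle p (subtopology X {x \<in> topspace X. \<pi> x \<in> A}) (subtopology Y A) \<phi> \<pi>"
proof -
  let ?S = "{x \<in> topspace X. \<pi> x \<in> A}"
  let ?X = "subtopology X ?S" and ?Y = "subtopology Y A"
  have top: "topspace ?X = ?S" "topspace ?Y = A"
    using closedin_subset[OF A] by auto
  have "closedin X ?S" by (rule closedin_continuous_map_preimage[OF proj_continuous A])
  then have compact: "compact_space ?X"
    by (intro compact_space_subtopology closedin_compact_space[OF compact_X])
  have inX: "x \<in> topspace X" if x: "x \<in> topspace ?X" for x
    using x by (simp add: top)
  have actS: "\<phi> t x \<in> ?S" if "t \<in> Ap" "x \<in> ?S" for t x
    using that act_closed[of t x] proj_act[of t x] by simp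
  have prod: "prod_topology (padic_topology p) ?X = subtopology (prod_topology (padic_topology p) X) (UNIV \<times> ?S)"
    using subtopology_Times[of "padic_topology p" X UNIV ?S] by simp
  show ?thesis
  proof
    show "p > 1" by (rule p)
    show "compact_space ?X" by (rule compact)
    show "\<phi> t x \<in> topspace ?X" if t: "t \<in> Ap" and x: "x \<in> topspace ?X" for t x
      unfolding top by (rule actS[OF t x[unfolded top]])
    show "\<phi> \<one>\<^bsub>P\<^esub> x = x" if x: "x \<in> topspace ?X" for x
      using act_one[OF inX[OF x]] .
    show "\<phi> (s \<otimes>\<^bsub>P\<^esub> t) x = \<phi> s (\<phi> t x)" if s: "s \<in> Ap" and t: "t \<in> Ap" and x: "x \<in> topspace ?X" for s t x
      using act_mult[OF s t inX[OF x]] .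
    show "t = \<one>\<^bsub>P\<^esub>" if t: "t \<in> Ap" and x: "x \<in> topspace ?X" and e: "\<phi> t x = x" for t x
      using act_free[OF t inX[OF x] e] .
    have "continuous_map (prod_topology (padic_topology p) ?X) X (\<lambda>(t, x). \<phi> t x)"
      unfolding prod by (rule continuous_map_from_subtopology[OF act_continuous])
    then show "continuous_map (prod_topology (padic_topology p) ?X) ?X (\<lambda>(t, x). \<phi> t x)"
      unfolding continuous_map_in_subtopology using actS by auto
    show "continuous_map ?X ?Y \<pi>"
      unfolding continuous_map_in_subtopology using continuous_map_from_subtopology[OF proj_continuous] top by auto
    show "open_map ?X ?Y \<pi>" by (rule open_map_restriction[OF proj_open refl])
    show "\<pi> ` topspace ?X = topspace ?Y"
      unfolding top using proj_onto closedin_subset[OF A] by auto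
    show "\<pi> x = \<pi> y \<longleftrightarrow> (\<exists>t\<in>Ap. y = \<phi> t x)" if x: "x \<in> topspace ?X" and y: "y \<in> topspace ?X" for x y
      using proj_eq_iff[OF inX[OF x] inX[OF y]] .
  qed
qed

section \<open>Partitions of unity\<close>

text \<open>Urysohn functions that are \<open>1\<close> at a point and vanish off a member of the cover; by compactness
  finitely many of them have positive sum everywhere, and they are divided by that sum. The index set
  consists of points.\<close>

lemma partition_of_unity:
  fixes Z :: "'b topology"
  assumes normal: "normal_space Z" and t1: "t1_space Z" and compact: "compact_space Z"
    and W: "open_cover Z \<W>"
  shows "\<exists>(F :: 'b set) (w :: 'b \<Rightarrow> 'b set) (\<rho> :: 'b \<Rightarrow> 'b \<Rightarrow> real). finite F \<and>
     (\<forall>i\<in>F. w i \<in> \<W> \<and> continuous_map Z euclideanreal (\<rho> i) \<and> (\<forall>y\<in>topspace Z. y \<notin> w i \<longrightarrow> \<rho> i y = 0)) \<and>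
     (\<forall>y\<in>topspace Z. (\<Sum>i\<in>F. \<rho> i y) = 1)"
proof -
  define bump where "bump z w f \<longleftrightarrow> w \<in> \<W> \<and> continuous_map Z euclideanreal f \<and> f z = (1::real) \<and> (\<forall>y\<in>topspace Z. 0 \<le> f y)
       \<and> (\<forall>y\<in>topspace Z. y \<notin> w \<longrightarrow> f y = 0)" for z w f
  have "\<exists>wf. bump z (fst wf) (snd wf)" if z: "z \<in> topspace Z" for z
  proof -
    obtain w where w: "w \<in> \<W>" "z \<in> w" using cover_member[OF W z] by blast
    have "closedin Z (topspace Z - w)" using openin_closedin_eq cover_open[OF W w(1)] by blast
    moreover have "closedin Z {z}" using t1 z by (simp add: t1_space_closedin_singleton)
    ultimately obtain f where f: "continuous_map Z (subtopology euclideanreal {0..1}) f"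
        "f ` (topspace Z - w) \<subseteq> {0::real}" "f ` {z} \<subseteq> {1}"
      using Urysohn_lemma[OF normal, of "topspace Z - w" "{z}" 0 1] w(2) by (auto simp: disjnt_def)
    have fc: "continuous_map Z euclideanreal f" and f0: "\<forall>y\<in>topspace Z. 0 \<le> f y"
      using f(1) unfolding continuous_map_in_subtopology by auto
    have "bump z w f" unfolding bump_def using w fc f0 f(2,3) by auto
    then show ?thesis by (intro exI[of _ "(w, f)"]) simp
  qed
  then obtain wf where bump: "\<And>z. z \<in> topspace Z \<Longrightarrow> bump z (fst (wf z)) (snd (wf z))"
    using bchoice[of "topspace Z" "\<lambda>z wf. bump z (fst wf) (snd wf)"] by blast
  define w where "w z = fst (wf z)" for z
  define f where "f z = snd (wf z)" for z
  have wf: "\<And>z. z \<in> topspace Z \<Longrightarrow> w z \<in> \<W>"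
    "\<And>z. z \<in> topspace Z \<Longrightarrow> continuous_map Z euclideanreal (f z)" "\<And>z. z \<in> topspace Z \<Longrightarrow> f z z = (1::real)"
    "\<And>z y. \<lbrakk>z \<in> topspace Z; y \<in> topspace Z\<rbrakk> \<Longrightarrow> 0 \<le> f z y"
    "\<And>z y. \<lbrakk>z \<in> topspace Z; y \<in> topspace Z; y \<notin> w z\<rbrakk> \<Longrightarrow> f z y = 0"
    using bump unfolding bump_def w_def f_def by simp_all
  define D where "D z = {y \<in> topspace Z. f z y \<in> {0<..}}" for z
  have Dopen: "openin Z (D z)" if "z \<in> topspace Z" for z
    unfolding D_def by (rule openin_continuous_map_preimage[OF wf(2)[OF that]]) (simp flip: open_openin)
  have "z \<in> D z" if "z \<in> topspace Z" for z using wf(3)[OF that] that by (simp add: D_def)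
  then have "topspace Z \<subseteq> \<Union>(D ` topspace Z)" by blast
  then obtain \<F> where Fam: "finite \<F>" "\<F> \<subseteq> D ` topspace Z" "topspace Z \<subseteq> \<Union>\<F>"
    using compact[unfolded compact_space_alt, rule_format, of "D ` topspace Z"] Dopen by blast
  obtain F where F: "F \<subseteq> topspace Z" "finite F" "\<F> = D ` F" using finite_subset_image[OF Fam(1,2)] by blast
  define T where "T y = (\<Sum>i\<in>F. f i y)" for y
  have Tpos: "T y \<noteq> 0" if y: "y \<in> topspace Z" for y
  proof -
    obtain i where i: "i \<in> F" "y \<in> D i" using Fam(3) F(3) y by blast
    have "0 < f i y" using i(2) by (simp add: D_def)
    then have "0 < T y"
      unfolding T_def using F(1) wf(4) y by (intro sum_pos2[OF F(2) i(1)]) auto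
    then show ?thesis by simp
  qed
  have Tc: "continuous_map Z euclideanreal T"
    unfolding T_def using F wf(2) by (intro continuous_map_sum) auto
  show ?thesis
  proof (intro exI[of _ F] exI[of _ w] exI[of _ "\<lambda>i y. f i y / T y"] conjI ballI impI)
    show "(\<Sum>i\<in>F. f i y / T y) = 1" if "y \<in> topspace Z" for y
      using Tpos[OF that] by (simp add: T_def flip: sum_divide_distrib)
    show "continuous_map Z euclideanreal (\<lambda>y. f i y / T y)" if "i \<in> F" for i
      using wf(2)[of i] Tc Tpos F(1) that by (intro continuous_map_real_divide) auto
  qed (use F wf in auto)
qed

section \<open>A trivial Bockstein class yields an equivariant angle\<close>

context metric_padic_bundle
begin

lemma chart_trans:
  assumes N: "small k N" and a: "a \<in> N" "b \<in> N" and x: "x \<in> topspace X" "\<pi> a = \<pi> x" "\<pi> b = \<pi> x"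
  shows "trans a x k = trans b x k"
proof -
  have X: "a \<in> topspace X" "b \<in> topspace X" using N a openin_subset unfolding small_def by blast+
  have "mdist m x x = 0" using x(1) mspace_eq by simp
  then have "mdist m x x < radius k" using good_radius_pos[OF good_radius[of k]] by linarith
  moreover have "mdist m a b < radius k" using N a unfolding small_def by blast
  ultimately show ?thesis using good_radius[of k] X x unfolding good_radius_def by blast
qed

text \<open>If the Bockstein cocycle becomes the coboundary of \<open>\<mu>\<close>, subtracting \<open>p\<^sup>k \<mu>\<close> from the transitions
  gives an integral cocycle \<open>\<theta>\<close>, that is, the class of the bundle lifts to an integral one. Over the
  reals \<open>\<theta>\<close> is the coboundary of continuous functions \<open>u\<close> by a partition of unity. Correcting the local
  trivialisations of the bundle by \<open>u\<close> makes them agree modulo \<open>p\<^sup>k\<close>, and they glue to a map to the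
  circle.\<close>

lemma trivial_bockstein_angle:
  assumes A: "closedin Y A" and normal: "normal_space (subtopology Y A)" "t1_space (subtopology Y A)"
    and W: "open_cover (subtopology Y A) \<W>" and r: "r \<in> projections id \<W> (chart_cover k)"
    and triv: "cobounds \<W> \<mu> (\<lambda>a b c. bockstein k [r a, r b, r c])"
  shows "\<exists>G. padic_bundle.angle_map p (subtopology X {x \<in> topspace X. \<pi> x \<in> A}) \<phi> k G"
proof -
  let ?S = "{x \<in> topspace X. \<pi> x \<in> A}"
  let ?X = "subtopology X ?S" and ?Y = "subtopology Y A" and ?q = "int p ^ k"
  interpret A: padic_bundle p ?X ?Y \<phi> \<pi> by (rule restrict_bundle[OF A])
  have topY: "topspace ?Y = A" and topX: "topspace ?X = ?S" using closedin_subset[OF A] by auto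
  have "topspace ?Y = \<pi> ` topspace ?X" using A.proj_onto by simp
  then have comp: "compact_space ?Y"
    using image_compactin[OF A.compact_X[unfolded compact_space_def] A.proj_continuous] unfolding compact_space_def by simp
  obtain F :: "'b set" and w :: "'b \<Rightarrow> 'b set" and \<rho> :: "'b \<Rightarrow> 'b \<Rightarrow> real" where Fin: "finite F"
    and F: "\<forall>i\<in>F. w i \<in> \<W> \<and> continuous_map ?Y euclideanreal (\<rho> i) \<and> (\<forall>y\<in>topspace ?Y. y \<notin> w i \<longrightarrow> \<rho> i y = 0)"
    and F_sum: "\<forall>y\<in>topspace ?Y. (\<Sum>i\<in>F. \<rho> i y) = 1"
    using partition_of_unity[OF normal comp W] by (elim exE conjE) (rule that)
  have rW: "r a \<in> chart_cover k" "a \<subseteq> r a" if a: "a \<in> \<W>" for a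
    using bspec[OF r[unfolded projections_id] a] by simp_all
  \<comment> \<open>An integral cocycle, since the coboundary of the transitions is \<open>p\<^sup>k\<close> times the
     Bockstein cocycle.\<close>
  define \<theta> where "\<theta> a b = transition k (r a) (r b) - ?q * \<mu> a b" for a b
  have \<theta>: "\<theta> a c = \<theta> a b + \<theta> b c" if W3: "a \<in> \<W>" "b \<in> \<W>" "c \<in> \<W>" "y \<in> a" "y \<in> b" "y \<in> c" for a b c y
  proof -
    have s: "[a, b, c] \<in> nerve_simplices 2 \<W>" unfolding simplex2_iff using W3(1-3) W3(4-6) by blast
    have "[r a, r b, r c] \<in> nerve_simplices 2 (chart_cover k)" using map_simplex[OF r s] by simp
    from bockstein_eq[OF this] triv s
    have "?q * (\<mu> b c - \<mu> a c + \<mu> a b) = transition k (r b) (r c) - transition k (r a) (r c) + transition k (r a) (r b)"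
      by (simp add: cobounds_def)
    then show ?thesis by (simp add: \<theta>_def algebra_simps)
  qed
  \<comment> \<open>A cochain contraction: its coboundary is \<open>\<theta>\<close> because the weights sum to \<open>1\<close>.\<close>
  define u where "u b y = (\<Sum>i\<in>F. \<rho> i y * real_of_int (\<theta> (w i) b))" for b y
  have u_cont: "continuous_map ?Y euclideanreal (u b)" for b
    unfolding u_def using Fin F by (intro continuous_map_sum continuous_map_real_mult) auto
  have u_diff: "u b y = u a y + real_of_int (\<theta> a b)"
    if ab: "a \<in> \<W>" "b \<in> \<W>" "y \<in> a" "y \<in> b" and y: "y \<in> A" for a b y
  proof -
    have yT: "y \<in> topspace ?Y" unfolding topY by (rule y)
    have "\<rho> i y * real_of_int (\<theta> (w i) b) = \<rho> i y * real_of_int (\<theta> (w i) a) + \<rho> i y * real_of_int (\<theta> a b)" if i: "i \<in> F" for i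
    proof (cases "y \<in> w i")
      case True
      then show ?thesis using \<theta>[of "w i" a b y] bspec[OF F i] ab by (simp add: algebra_simps)
    next
      case False
      then show ?thesis using bspec[OF F i] yT by simp
    qed
    then have "u b y = (\<Sum>i\<in>F. \<rho> i y * real_of_int (\<theta> (w i) a) + \<rho> i y * real_of_int (\<theta> a b))"
      unfolding u_def by (intro sum.cong) auto
    also have "\<dots> = u a y + (\<Sum>i\<in>F. \<rho> i y) * real_of_int (\<theta> a b)"
      by (simp add: u_def sum.distrib sum_distrib_right)
    finally show ?thesis by (simp add: bspec[OF F_sum yT])
  qed
  define base where "base b x = (SOME a. a \<in> chart k (r b) \<and> \<pi> a = \<pi> x)" for b x
  have base: "base b x \<in> chart k (r b)" "\<pi> (base b x) = \<pi> x" "base b x \<in> topspace X" if b: "b \<in> \<W>" "\<pi> x \<in> b" for b x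
  proof -
    have "\<pi> x \<in> \<pi> ` chart k (r b)" using chart[OF rW(1)[OF b(1)]] rW(2)[OF b(1)] b(2) by auto
    then have "\<exists>a. a \<in> chart k (r b) \<and> \<pi> a = \<pi> x" by (metis imageE)
    from someI_ex[OF this] show "base b x \<in> chart k (r b)" "\<pi> (base b x) = \<pi> x" unfolding base_def by blast+
    then show "base b x \<in> topspace X" using chart_subset[OF rW(1)[OF b(1)]] by blast
  qed
  define g where "g b x = real_of_int (trans (base b x) x k) + u b (\<pi> x)" for b x
  have g_diff: "\<exists>i. g b x = g a x + real_of_int (?q * i)"
    if ab: "a \<in> \<W>" "b \<in> \<W>" "\<pi> x \<in> a" "\<pi> x \<in> b" and x: "x \<in> ?S" for a b x
  proof -
    note A' = base[OF ab(1,3)] and B' = base[OF ab(2,4)]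
    have "trans (base a x) x k = (trans (base a x) (base b x) k + trans (base b x) x k) mod ?q"
      using A' B' x by (intro trans_comp) auto
    moreover have "transition k (r a) (r b) = trans (base a x) (base b x) k"
      unfolding transition_def using A' B' chart rW(1) ab(1,2) by (intro cross) auto
    ultimately have "trans (base a x) x k = (transition k (r a) (r b) + trans (base b x) x k) mod ?q" by simp
    then have "?q dvd (transition k (r a) (r b) + trans (base b x) x k) - trans (base a x) x k"
      using dvd_minus_mod by metis
    then obtain j where "(transition k (r a) (r b) + trans (base b x) x k) - trans (base a x) x k = ?q * j" by (elim dvdE)
    then have "trans (base b x) x k + \<theta> a b = trans (base a x) x k + ?q * (j - \<mu> a b)"
      by (simp add: \<theta>_def algebra_simps)
    then have "real_of_int (trans (base b x) x k) + real_of_int (\<theta> a b) =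
        real_of_int (trans (base a x) x k) + real_of_int (?q * (j - \<mu> a b))"
      by (simp only: of_int_add[symmetric])
    moreover have "u b (\<pi> x) = u a (\<pi> x) + real_of_int (\<theta> a b)" using u_diff[OF ab] x by simp
    ultimately have "g b x = g a x + real_of_int (?q * (j - \<mu> a b))"
      unfolding g_def by linarith
    then show ?thesis by blast
  qed
  define c where "c y = (SOME b. b \<in> \<W> \<and> y \<in> b)" for y
  have c: "c y \<in> \<W>" "y \<in> c y" if y: "y \<in> A" for y
  proof -
    have "\<exists>b. b \<in> \<W> \<and> y \<in> b" using cover_member[OF W, of y] y topY by auto
    from someI_ex[OF this] show "c y \<in> \<W>" "y \<in> c y" unfolding c_def by blast+
  qed
  define G where "G x = g (c (\<pi> x)) x" for x
  have angle: "A.at_angle k G x (g b x + real_of_int (?q * i))" if b: "b \<in> \<W>" "\<pi> x \<in> b" and x: "x \<in> ?S" for b x i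
  proof -
    obtain j where "g b x = G x + real_of_int (?q * j)"
      using g_diff[of "c (\<pi> x)" b x] c[of "\<pi> x"] b x unfolding G_def by blast
    then have "g b x + real_of_int (?q * i) = G x + real_of_int (?q * (j + i))" by (simp add: algebra_simps)
    then show ?thesis unfolding A.at_angle_def by blast
  qed
  have "A.angle_map k G"
    unfolding A.angle_map_def
  proof (intro conjI ballI allI)
    fix x t assume x: "x \<in> topspace ?X" and t: "t \<in> Ap"
    have xS: "x \<in> ?S" and xX: "x \<in> topspace X" using x topX by auto
    let ?b = "c (\<pi> x)" and ?x' = "\<phi> t x"
    have b: "?b \<in> \<W>" "\<pi> x \<in> ?b" using c xS by auto
    have e: "\<pi> ?x' = \<pi> x" by (rule proj_act[OF t xX])
    have X': "?x' \<in> topspace X" by (rule act_closed[OF t xX])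
    have same: "base ?b ?x' = base ?b x" unfolding base_def e ..
    have "trans (base ?b ?x') ?x' k = (trans (base ?b x) x k + t k) mod ?q"
      unfolding same
      using trans_comp[OF base(3)[OF b] xX X' base(2)[OF b] e[symmetric], of k]
      by (simp only: trans_unique[OF xX t])
    then have "?q dvd (trans (base ?b x) x k + t k) - trans (base ?b ?x') ?x' k"
      using dvd_minus_mod by metis
    then obtain j where j: "(trans (base ?b x) x k + t k) - trans (base ?b ?x') ?x' k = ?q * j" by (elim dvdE)
    have "G x + real_of_int (t k) = real_of_int (trans (base ?b x) x k + t k) + u ?b (\<pi> x)"
      by (simp add: G_def g_def)
    also have "trans (base ?b x) x k + t k = trans (base ?b ?x') ?x' k + ?q * j" using j by simp
    also have "real_of_int (trans (base ?b ?x') ?x' k + ?q * j) + u ?b (\<pi> x) = g ?b ?x' + real_of_int (?q * j)"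
      by (simp add: g_def e)
    finally have "G x + real_of_int (t k) = g ?b ?x' + real_of_int (?q * j)" .
    moreover have "A.at_angle k G ?x' (g ?b ?x' + real_of_int (?q * j))"
      using angle[of ?b ?x' j] b e X' xS by simp
    ultimately show "A.at_angle k G ?x' (G x + real_of_int (t k))" by simp
  next
    fix lo hi :: real
    let ?B = "{x \<in> topspace ?X. \<exists>s. lo < s \<and> s < hi \<and> A.at_angle k G x s}"
    show "openin ?X ?B"
    proof (subst openin_subopen, rule ballI)
      fix x0 assume "x0 \<in> ?B"
      then obtain s0 where x0: "x0 \<in> ?S" and s0: "lo < s0" "s0 < hi" "A.at_angle k G x0 s0" using topX by auto
      let ?b = "c (\<pi> x0)"
      have b: "?b \<in> \<W>" "\<pi> x0 \<in> ?b" using c x0 by auto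
      have ch: "small k (chart k (r ?b))" using chart[OF rW(1)[OF b(1)]] by blast
      obtain i where i: "s0 = g ?b x0 + real_of_int (?q * i)" using s0(3) unfolding A.at_angle_def G_def by blast
      define t where "t = trans (base ?b x0) x0"
      have t: "t \<in> Ap" "\<phi> t (base ?b x0) = x0" using trans[of "base ?b x0" x0] base[OF b] x0 by (auto simp: t_def)
      \<comment> \<open>On the translate of the chart by \<open>t\<close> the integral part of the angle is constant, so the
         angle varies continuously there.\<close>
      define h where "h y = real_of_int (t k) + u ?b y + real_of_int (?q * i)" for y
      let ?N = "{x \<in> topspace ?X. \<pi> x \<in> ?b} \<inter> (\<phi> t ` chart k (r ?b) \<inter> ?S) \<inter> {x \<in> topspace ?X. \<pi> x \<in> {y \<in> topspace ?Y. h y \<in> {lo<..<hi}}}"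
      have "continuous_map ?Y euclideanreal h"
        unfolding h_def using u_cont by (intro continuous_map_add) auto
      then have "openin ?Y {y \<in> topspace ?Y. h y \<in> {lo<..<hi}}"
        by (rule openin_continuous_map_preimage) (simp flip: open_openin)
      then have N3: "openin ?X {x \<in> topspace ?X. \<pi> x \<in> {y \<in> topspace ?Y. h y \<in> {lo<..<hi}}}"
        by (rule openin_continuous_map_preimage[OF A.proj_continuous])
      have "openin ?Y ?b" by (rule cover_open[OF W b(1)])
      then have N1: "openin ?X {x \<in> topspace ?X. \<pi> x \<in> ?b}"
        by (rule openin_continuous_map_preimage[OF A.proj_continuous])
      have "openin X (\<phi> t ` chart k (r ?b))" using act_image_open[OF t(1)] ch unfolding small_def by blast
      then have N2: "openin ?X (\<phi> t ` chart k (r ?b) \<inter> ?S)" by (rule openin_subtopology_Int)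
      have val: "g ?b x = real_of_int (t k) + u ?b (\<pi> x)"
        if x: "x \<in> ?S" "\<pi> x \<in> ?b" and a: "a \<in> chart k (r ?b)" "x = \<phi> t a" for x a
      proof -
        have aX: "a \<in> topspace X" using a(1) chart_subset[OF rW(1)[OF b(1)]] by blast
        have pa: "\<pi> a = \<pi> x" using proj_act[OF t(1) aX] a(2) by simp
        have "trans (base ?b x) x k = trans a x k"
          using chart_trans[OF ch base(1)[OF b(1) x(2)] a(1)] x pa base(2)[OF b(1) x(2)] by simp
        also have "\<dots> = t k" using trans_unique[OF aX t(1)] a(2) by simp
        finally show ?thesis by (simp add: g_def)
      qed
      have "x0 \<in> ?N"
      proof -
        have v0: "g ?b x0 = real_of_int (t k) + u ?b (\<pi> x0)"
          using val[OF x0 b(2) base(1)[OF b]] t(2) by simp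
        then have "h (\<pi> x0) = s0" using i by (simp add: h_def)
        moreover have "x0 \<in> \<phi> t ` chart k (r ?b)" using t(2) base(1)[OF b] by (metis image_eqI)
        ultimately show ?thesis using x0 b s0 topX topY by simp
      qed
      moreover have "?N \<subseteq> ?B"
      proof
        fix x assume x: "x \<in> ?N"
        then obtain a where a: "a \<in> chart k (r ?b)" "x = \<phi> t a" by blast
        have xS: "x \<in> ?S" "\<pi> x \<in> ?b" "lo < h (\<pi> x)" "h (\<pi> x) < hi" using x topX by auto
        have "h (\<pi> x) = g ?b x + real_of_int (?q * i)" using val[OF xS(1,2) a] by (simp add: h_def)
        then have "A.at_angle k G x (h (\<pi> x))" using angle[OF b(1) xS(2,1), of i] by simp
        then show "x \<in> ?B" using xS topX by blast
      qed
      moreover have "openin ?X ?N" by (intro openin_Int N1 N2 N3)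
      ultimately show "\<exists>T. openin ?X T \<and> x0 \<in> T \<and> T \<subseteq> ?B" by blast
    qed
  qed
  then show ?thesis by blast
qed

end

section \<open>Divisible towers and the Pruefer group\<close>

lemma prufer_directed_system:
  assumes p: "p > 0"
  shows "directed_system UNIV (\<le>) (\<lambda>k. integer_mod_group (p ^ k))
     (\<lambda>j k x. (int p ^ (k - j) * x) mod int p ^ k)"
proof (rule directed_system.intro)
  have scale: "(int p ^ (k - j) * (x mod int p ^ j)) mod int p ^ k = (int p ^ (k - j) * x) mod int p ^ k"
    if "j \<le> k" for j k :: nat and x :: int
  proof -
    have e: "int p ^ k = int p ^ (k - j) * int p ^ j" using that by (simp flip: power_add)
    show ?thesis by (simp only: e mult_mod_right mod_mod_trivial)
  qed
  show "(\<lambda>x. (int p ^ (k - j) * x) mod int p ^ k) \<in> hom (integer_mod_group (p ^ j)) (integer_mod_group (p ^ k))"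
    if jk: "j \<le> k" for j k
  proof (rule homI)
    show "(int p ^ (k - j) * x) mod int p ^ k \<in> carrier (integer_mod_group (p ^ k))" for x
      using p by (simp add: carrier_integer_mod_group)
    show "(int p ^ (k - j) * (x \<otimes>\<^bsub>integer_mod_group (p ^ j)\<^esub> y)) mod int p ^ k =
        ((int p ^ (k - j) * x) mod int p ^ k) \<otimes>\<^bsub>integer_mod_group (p ^ k)\<^esub> ((int p ^ (k - j) * y) mod int p ^ k)" for x y
      using scale[OF jk, of "x + y"] by (simp add: mod_add_eq distrib_left)
  qed
  show "(int p ^ (k - k) * x) mod int p ^ k = x" if "x \<in> carrier (integer_mod_group (p ^ k))" for k x
    using that p by (simp add: carrier_integer_mod_group)
  show "(int p ^ (l - k) * ((int p ^ (k - j) * x) mod int p ^ k)) mod int p ^ l = (int p ^ (l - j) * x) mod int p ^ l"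
    if jk: "j \<le> k" and kl: "k \<le> l" for j k l x
  proof -
    have "int p ^ (l - k) * int p ^ (k - j) = int p ^ (l - j)" using jk kl by (simp flip: power_add)
    then show ?thesis by (simp only: scale[OF kl] mult.assoc[symmetric])
  qed
  show "\<exists>k\<in>UNIV. i \<le> k \<and> j \<le> k" for i j :: nat
    by (intro bexI[of _ "max i j"]) simp_all
qed simp_all

text \<open>A tower \<open>b\<^sub>0 = 1\<close>, \<open>b\<^sub>k\<^sub>+\<^sub>1\<^sup>p = b\<^sub>k\<close> is a homomorphism from the Pruefer group, whose proper quotients are
  isomorphic to it; so its image is a copy of the Pruefer group as soon as it is nontrivial. The
  isomorphism is obtained by dropping the trivial initial part of the tower.\<close>

lemma prufer_subgroup_of_tower:
  fixes C :: "('c, 'd) monoid_scheme" and b :: "nat \<Rightarrow> 'c"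
  assumes C: "comm_group C" and p: "prime p" and b: "\<And>k. b k \<in> carrier C"
    and b0: "b 0 = \<one>\<^bsub>C\<^esub>" and step: "\<And>k. b (Suc k) [^]\<^bsub>C\<^esub> p = b k" and nontriv: "b j \<noteq> \<one>\<^bsub>C\<^esub>"
  shows "\<exists>H. subgroup H C \<and> C \<lparr>carrier := H\<rparr> \<cong> prufer_group p \<and> range b \<subseteq> H"
proof -
  interpret C: comm_group C by (rule C)
  have p0: "p > 0" using p prime_gt_0_nat by blast
  interpret D: directed_system UNIV "(\<le>)" "\<lambda>k. integer_mod_group (p ^ k)"
    "\<lambda>j k x. (int p ^ (k - j) * x) mod int p ^ k"
    by (rule prufer_directed_system[OF p0])
  have limit: "prufer_group p = D.L" by (simp add: prufer_group_def)
  have pow: "b (k + i) [^]\<^bsub>C\<^esub> (p ^ i) = b k" for k i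
  proof (induction i)
    case (Suc i)
    have "b (k + Suc i) [^]\<^bsub>C\<^esub> (p * p ^ i) = (b (k + Suc i) [^]\<^bsub>C\<^esub> p) [^]\<^bsub>C\<^esub> (p ^ i)"
      using b by (simp add: C.nat_pow_pow)
    then show ?case using Suc step[of "k + i"] by simp
  qed (use b in simp)
  have up: "b i = \<one>\<^bsub>C\<^esub>" if "b k = \<one>\<^bsub>C\<^esub>" "i \<le> k" for i k
    using pow[of i "k - i"] that by simp
  \<comment> \<open>Past the last trivial class, the element \<open>b (m + k)\<close> has order exactly \<open>p\<^sup>k\<close>.\<close>
  define m where "m = Max {k. b k = \<one>\<^bsub>C\<^esub>}"
  have fin: "finite {k. b k = \<one>\<^bsub>C\<^esub>}"
  proof (rule finite_subset)
    show "{k. b k = \<one>\<^bsub>C\<^esub>} \<subseteq> {..j}"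
    proof
      fix k assume "k \<in> {k. b k = \<one>\<^bsub>C\<^esub>}"
      then have "b k = \<one>\<^bsub>C\<^esub>" by simp
      then have "\<not> j \<le> k" using up[of k j] nontriv by blast
      then show "k \<in> {..j}" by simp
    qed
  qed simp
  have "{k. b k = \<one>\<^bsub>C\<^esub>} \<noteq> {}" using b0 by blast
  from Max_in[OF fin this] have bm: "b m = \<one>\<^bsub>C\<^esub>" unfolding m_def by simp
  have bSm: "b (Suc m) \<noteq> \<one>\<^bsub>C\<^esub>"
  proof
    assume "b (Suc m) = \<one>\<^bsub>C\<^esub>"
    then have "Suc m \<le> m" unfolding m_def using fin by (intro Max_ge) simp_all
    then show False by simp
  qed
  define b' where "b' k = b (m + k)" for k
  have b': "b' k \<in> carrier C" for k using b by (simp add: b'_def)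
  have pow': "b' (k + i) [^]\<^bsub>C\<^esub> (p ^ i) = b' k" for k i
    using pow[of "m + k" i] by (simp add: b'_def add.assoc)
  have triv': "b' k [^]\<^bsub>C\<^esub> (p ^ k) = \<one>\<^bsub>C\<^esub>" for k
    using pow'[of 0 k] bm by (simp add: b'_def)
  have ord: "C.ord (b' k) = p ^ k" for k
  proof (cases k)
    case 0
    then show ?thesis using bm by (simp add: b'_def)
  next
    case (Suc i)
    have "C.ord (b' k) dvd p ^ k" using triv'[of k] b'[of k] by (simp add: C.pow_eq_id)
    then obtain e where e: "e \<le> k" "C.ord (b' k) = p ^ e" using divides_primepow_nat[OF p] by blast
    have "\<not> C.ord (b' k) dvd p ^ i"
      using pow'[of 1 i] bSm b'[of k] Suc by (simp add: C.pow_eq_id[symmetric] b'_def)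
    then have "\<not> e \<le> i" using e(2) le_imp_power_dvd by metis
    then show ?thesis using e Suc by (simp add: le_Suc_eq)
  qed
  have mod: "b' k [^]\<^bsub>C\<^esub> (x mod int p ^ k) = b' k [^]\<^bsub>C\<^esub> x" for k and x :: int
  proof -
    have "int (C.ord (b' k)) dvd x - x mod int p ^ k"
      unfolding ord using dvd_minus_mod[of "int p ^ k" x] by simp
    then show ?thesis using C.int_pow_eq[OF b'[of k], of "x mod int p ^ k" x] by (rule iffD2[rotated])
  qed
  define f where "f k x = b' k [^]\<^bsub>C\<^esub> (x :: int)" for k x
  have hom: "f k \<in> hom (integer_mod_group (p ^ k)) C" for k
  proof (rule homI)
    show "f k x \<in> carrier C" for x using b' by (simp add: f_def)
    show "f k (x \<otimes>\<^bsub>integer_mod_group (p ^ k)\<^esub> y) = f k x \<otimes>\<^bsub>C\<^esub> f k y" for x y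
      using mod[of k "x + y"] C.int_pow_mult[OF b'[of k]] by (simp add: f_def)
  qed
  have compat: "f k ((int p ^ (k - i) * x) mod int p ^ k) = f i x" if "i \<le> k" for i k x
  proof -
    have "f k ((int p ^ (k - i) * x) mod int p ^ k) = b' k [^]\<^bsub>C\<^esub> (int (p ^ (k - i)) * x)"
      by (simp add: f_def mod)
    also have "\<dots> = (b' k [^]\<^bsub>C\<^esub> int (p ^ (k - i))) [^]\<^bsub>C\<^esub> x"
      using C.int_pow_pow[OF b'[of k]] by simp
    also have "b' k [^]\<^bsub>C\<^esub> int (p ^ (k - i)) = b' i"
      using pow'[of i "k - i"] that by (simp only: int_pow_int le_add_diff_inverse)
    finally show ?thesis by (simp add: f_def)
  qed
  have inj: "inj_on (f k) (carrier (integer_mod_group (p ^ k)))" for k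
  proof (rule inj_onI)
    fix x y assume xy: "x \<in> carrier (integer_mod_group (p ^ k))" "y \<in> carrier (integer_mod_group (p ^ k))" "f k x = f k y"
    then have "int p ^ k dvd y - x"
      using C.int_pow_eq[OF b'[of k], of x y] unfolding f_def ord by simp
    then have "y mod int p ^ k = x mod int p ^ k"
      by (simp only: mod_eq_dvd_iff)
    then show "x = y" using xy p0 by (simp add: carrier_integer_mod_group)
  qed
  obtain F where F: "F \<in> hom D.L C" "\<And>k x. x \<in> carrier (integer_mod_group (p ^ k)) \<Longrightarrow> F (D.cl k x) = f k x"
    "inj_on F (carrier D.L)"
  proof (rule D.cone_factors[of C f])
    show "Group.group C" by (rule C.is_group)
  qed (use hom compat inj in auto)
  let ?H = "F ` carrier D.L"
  have grp: "group D.L" using D.comm_group_limit comm_group.axioms(2) by blast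
  have "group_hom D.L C F" using grp F(1) C.is_group by (simp add: group_hom_def group_hom_axioms_def)
  then have sub: "subgroup ?H C" by (rule group_hom.img_is_subgroup)
  have "F \<in> iso D.L (C \<lparr>carrier := ?H\<rparr>)"
    using F(1,3) by (auto simp: iso_def hom_def bij_betw_def)
  then have "D.L \<cong> C \<lparr>carrier := ?H\<rparr>" unfolding is_iso_def by blast
  then have "C \<lparr>carrier := ?H\<rparr> \<cong> prufer_group p" unfolding limit by (rule group.iso_sym[OF grp])
  moreover have "b k \<in> ?H" for k
  proof -
    have "b k = b' k [^]\<^bsub>C\<^esub> (p ^ m)" using pow[of k m] by (simp add: b'_def add.commute)
    also have "\<dots> = f k (int (p ^ m) mod int p ^ k)" unfolding f_def mod by (simp only: int_pow_int)
    also have "\<dots> = F (D.cl k (int (p ^ m) mod int p ^ k))" using F(2) p0 by (simp add: carrier_integer_mod_group)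
    finally show ?thesis using D.cl_closed[of k "int (p ^ m) mod int p ^ k"] p0 by (simp add: carrier_integer_mod_group)
  qed
  ultimately show ?thesis using sub by blast
qed

section \<open>The tower of Bockstein classes\<close>

context metric_padic_bundle
begin

definition bockstein_class :: "nat \<Rightarrow> ('b set set \<times> ('b set list \<Rightarrow> int) set) set" where
  "bockstein_class k = cech_cocycle_class Y (chart_cover k) (bockstein k)"

lemma bockstein_class_closed: "bockstein_class k \<in> carrier (cech_cohomology 2 Y)"
  unfolding bockstein_class_def
  using cech_cocycle_class_hom[OF open_cover_charts[of k]] bockstein_cocycle[of k] by (auto simp: hom_def)

lemma cocycle_pow:
  "z \<in> nerve_cocycles 2 \<U> \<Longrightarrow> z [^]\<^bsub>cocycle_group \<U>\<^esub> (n::nat) = (\<lambda>s\<in>nerve_simplices 2 \<U>. int n * z s)"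
  by (induction n) (auto simp: one_nerve_cochains mult_nerve_cochains algebra_simps)

lemma bockstein_class_step: "bockstein_class (Suc k) [^]\<^bsub>cech_cohomology 2 Y\<^esub> p = bockstein_class k"
proof -
  let ?U = "chart_cover (Suc k)" and ?z = "bockstein (Suc k)"
  interpret C: comm_group "cech_cohomology 2 Y" by (rule comm_group_cech)
  interpret Z: comm_group "cocycle_group ?U" by (rule comm_group_cocycles)
  interpret h: group_hom "cocycle_group ?U" "cech_cohomology 2 Y" "cech_cocycle_class Y ?U"
    using cech_cocycle_class_hom[OF open_cover_charts] Z.is_group C.is_group
    by (simp add: group_hom_def group_hom_axioms_def)
  have z: "?z \<in> carrier (cocycle_group ?U)" using bockstein_cocycle by simp
  have zp: "?z [^]\<^bsub>cocycle_group ?U\<^esub> p \<in> nerve_cocycles 2 ?U" using Z.nat_pow_closed[OF z] by simp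
  obtain e where e: "cobounds ?U e (\<lambda>a b c. bockstein k [a, b, c] - int p * ?z [a, b, c])"
    using bockstein_step by blast
  have id: "(\<lambda>U. U) \<in> projections id ?U (chart_cover k)" "(\<lambda>U. U) \<in> projections id ?U ?U"
    using chart_cover_mono unfolding projections_id by blast+
  have "cobounds ?U e (\<lambda>a b c. bockstein k [a, b, c] - (?z [^]\<^bsub>cocycle_group ?U\<^esub> p) [a, b, c])"
    using e by (simp add: cobounds_def cocycle_pow[OF bockstein_cocycle])
  then have "cech_cocycle_class Y (chart_cover k) (bockstein k) = cech_cocycle_class Y ?U (?z [^]\<^bsub>cocycle_group ?U\<^esub> p)"
    by (rule cech_cocycle_class_eqI[OF open_cover_charts bockstein_cocycle open_cover_charts zp open_cover_charts id])
  then show ?thesis unfolding bockstein_class_def using h.hom_nat_pow[OF z] by simp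
qed

lemma bockstein_class_0: "bockstein_class 0 = \<one>\<^bsub>cech_cohomology 2 Y\<^esub>"
proof -
  let ?U = "chart_cover 0"
  interpret C: comm_group "cech_cohomology 2 Y" by (rule comm_group_cech)
  interpret Z: comm_group "cocycle_group ?U" by (rule comm_group_cocycles)
  have one: "\<one>\<^bsub>cocycle_group ?U\<^esub> \<in> nerve_cocycles 2 ?U" using Z.one_closed by simp
  have id: "(\<lambda>U. U) \<in> projections id ?U ?U" unfolding projections_id by blast
  have "cobounds ?U (transition 0) (\<lambda>a b c. bockstein 0 [a, b, c] - \<one>\<^bsub>cocycle_group ?U\<^esub> [a, b, c])"
    unfolding cobounds_def
  proof (intro allI impI)
    fix a b c assume s: "[a, b, c] \<in> nerve_simplices 2 ?U"
    show "bockstein 0 [a, b, c] - \<one>\<^bsub>cocycle_group ?U\<^esub> [a, b, c] = transition 0 b c - transition 0 a c + transition 0 a b"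
      using bockstein_eq[OF s] s by (simp add: one_nerve_cochains)
  qed
  then have "bockstein_class 0 = cech_cocycle_class Y ?U \<one>\<^bsub>cocycle_group ?U\<^esub>"
    unfolding bockstein_class_def
    by (rule cech_cocycle_class_eqI[OF open_cover_charts bockstein_cocycle open_cover_charts one open_cover_charts id id])
  also have "\<dots> = \<one>\<^bsub>cech_cohomology 2 Y\<^esub>"
    by (rule hom_one[OF cech_cocycle_class_hom[OF open_cover_charts] Z.is_group C.is_group])
  finally show ?thesis .
qed

text \<open>The preimage of \<open>A\<close> in \<open>X\<close> is closed, so it has dimension at most \<open>n\<close>, and it carries an angle
  for every \<open>k\<close>; the extra dimension is the circle direction.\<close>

lemma dimension_of_trivial_part:
  assumes dim: "covering_dim_le X (int n)" and A: "closedin Y A"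
    and Y: "normal_space (subtopology Y A)" "t1_space (subtopology Y A)"
    and triv: "\<And>k. \<exists>\<W> r \<mu>. open_cover (subtopology Y A) \<W> \<and> r \<in> projections id \<W> (chart_cover k) \<and>
           cobounds \<W> \<mu> (\<lambda>a b c. bockstein k [r a, r b, r c])"
  shows "covering_dim (subtopology Y A) \<le> ereal (real (n + 1))"
proof -
  let ?S = "{x \<in> topspace X. \<pi> x \<in> A}"
  interpret A: padic_bundle p "subtopology X ?S" "subtopology Y A" \<phi> \<pi> by (rule restrict_bundle[OF A])
  have "closedin X ?S" by (rule closedin_continuous_map_preimage[OF proj_continuous A])
  then have "covering_dim_le (subtopology X ?S) (int n)" by (rule covering_dim_le_closed_subspace[OF dim])
  moreover have "\<exists>G. A.angle_map k G" for k
    using triv[of k] trivial_bockstein_angle[OF A Y] by blast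
  ultimately have "covering_dim_le (subtopology Y A) (int n + 1)"
    by (rule A.quotient_covering_dim_le)
  from covering_dim_leD[OF this] show ?thesis by (simp add: add.commute)
qed

end

section \<open>Orbit spaces\<close>

text \<open>The orbit map is open because the saturation of an open set is a union of its translates; the
  rest transports the orbit space along the given homeomorphism.\<close>

lemma resolvable_bundle:
  assumes p: "p > 1" and X: "compact_space X" and res: "p_resolvable_by p Y X"
  shows "\<exists>\<phi> \<pi>. padic_bundle p X Y \<phi> \<pi>"
proof -
  let ?P = "padic_group p" and ?T = "padic_topology p"
  obtain \<phi> where act: "group_action ?P (topspace X) \<phi>"
    and cont: "continuous_map (prod_topology ?T X) X (\<lambda>(t, x). \<phi> t x)"
    and free: "free_action ?P (topspace X) \<phi>" and Y: "Y homeomorphic_space orbit_space ?P X \<phi>"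
    using res unfolding p_resolvable_by_def continuous_action_def by blast
  interpret act: group_action ?P "topspace X" \<phi> by (rule act)
  interpret P: comm_group ?P using comm_group_padic p by simp
  let ?O = "orbit_space ?P X \<phi>"
  have "?O homeomorphic_space Y" by (rule homeomorphic_space_sym[THEN iffD1, OF Y])
  then obtain h where h: "homeomorphic_map ?O Y h"
    unfolding homeomorphic_space by (elim exE)
  define q where "q x = orbit ?P \<phi> x" for x
  have topO: "topspace ?O = orbits ?P (topspace X) \<phi>"
  proof (rule subset_antisym)
    show "topspace ?O \<subseteq> orbits ?P (topspace X) \<phi>" using openin_orbit_space openin_topspace by blast
    have "{x \<in> topspace X. orbit ?P \<phi> x \<in> orbits ?P (topspace X) \<phi>} = topspace X" by (auto simp: orbits_def)
    then have "openin ?O (orbits ?P (topspace X) \<phi>)" unfolding openin_orbit_space by simp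
    then show "orbits ?P (topspace X) \<phi> \<subseteq> topspace ?O" by (rule openin_subset)
  qed
  have qO: "q ` topspace X = topspace ?O" unfolding topO orbits_def q_def by auto
  have qc: "continuous_map X ?O q"
    unfolding continuous_map_def
  proof (intro conjI allI impI)
    show "q \<in> topspace X \<rightarrow> topspace ?O" using qO by blast
    show "openin X {x \<in> topspace X. q x \<in> U}" if "openin ?O U" for U
      using that unfolding openin_orbit_space q_def by blast
  qed
  have clos: "\<phi> t x \<in> topspace X" if "t \<in> padic_carrier p" "x \<in> topspace X" for t x
    using act.element_image[of t x "\<phi> t x"] that by simp
  have one: "\<phi> \<one>\<^bsub>?P\<^esub> x = x" if "x \<in> topspace X" for x
    using act.id_eq_one that by (metis restrict_apply')
  have mult: "\<phi> (s \<otimes>\<^bsub>?P\<^esub> t) x = \<phi> s (\<phi> t x)" if "s \<in> padic_carrier p" "t \<in> padic_carrier p" "x \<in> topspace X" for s t x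
    using act.composition_rule[of x s t] that by simp
  have eq_iff: "q x = q y \<longleftrightarrow> (\<exists>t\<in>padic_carrier p. y = \<phi> t x)" if x: "x \<in> topspace X" and y: "y \<in> topspace X" for x y
  proof
    assume "q x = q y"
    moreover have "y \<in> q y" using one[OF y] P.one_closed unfolding q_def orbit_def by force
    ultimately show "\<exists>t\<in>padic_carrier p. y = \<phi> t x" unfolding q_def orbit_def by auto
  next
    assume "\<exists>t\<in>padic_carrier p. y = \<phi> t x"
    then obtain t where t: "t \<in> padic_carrier p" "y = \<phi> t x" by blast
    have ti: "inv\<^bsub>?P\<^esub> t \<in> padic_carrier p" using P.inv_closed t by simp
    have xy: "x = \<phi> (inv\<^bsub>?P\<^esub> t) y"
      using mult[OF ti t(1) x] one[OF x] t P.l_inv[of t] by simp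
    show "q x = q y"
    proof (rule subset_antisym; rule subsetI)
      fix v assume "v \<in> q x"
      then obtain s where s: "s \<in> padic_carrier p" "v = \<phi> s x" unfolding q_def orbit_def by auto
      then have "v = \<phi> (s \<otimes>\<^bsub>?P\<^esub> inv\<^bsub>?P\<^esub> t) y" using mult[OF s(1) ti y] xy by simp
      moreover have "s \<otimes>\<^bsub>?P\<^esub> inv\<^bsub>?P\<^esub> t \<in> carrier ?P" using P.m_closed[of s "inv\<^bsub>?P\<^esub> t"] s(1) ti by simp
      ultimately show "v \<in> q y" unfolding q_def orbit_def by blast
    next
      fix v assume "v \<in> q y"
      then obtain s where s: "s \<in> padic_carrier p" "v = \<phi> s y" unfolding q_def orbit_def by auto
      then have "v = \<phi> (s \<otimes>\<^bsub>?P\<^esub> t) x" using mult[OF s(1) t(1) x] t(2) by simp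
      moreover have "s \<otimes>\<^bsub>?P\<^esub> t \<in> carrier ?P" using s(1) t(1) P.m_closed[of s t] by simp
      ultimately show "v \<in> q x" unfolding q_def orbit_def by blast
    qed
  qed
  have qopen: "open_map X ?O q"
    unfolding open_map_def
  proof (intro allI impI)
    fix N assume N: "openin X N"
    have NX: "N \<subseteq> topspace X" using openin_subset[OF N] .
    have "openin X {x \<in> topspace X. \<phi> t x \<in> N}" if "t \<in> padic_carrier p" for t
    proof -
      have "continuous_map X X (\<phi> t)"
        using continuous_map_compose[OF _ cont, of X "\<lambda>x. (t, x)"] that
        by (simp add: continuous_map_pairwise comp_def)
      then show ?thesis using N by (rule openin_continuous_map_preimage)
    qed
    then have "openin X (\<Union>t\<in>padic_carrier p. {x \<in> topspace X. \<phi> t x \<in> N})" by (intro openin_Union) auto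
    moreover have "(\<Union>t\<in>padic_carrier p. {x \<in> topspace X. \<phi> t x \<in> N}) = {x \<in> topspace X. q x \<in> q ` N}"
    proof (rule subset_antisym; rule subsetI)
      fix x assume "x \<in> (\<Union>t\<in>padic_carrier p. {x \<in> topspace X. \<phi> t x \<in> N})"
      then obtain t where t: "t \<in> padic_carrier p" "x \<in> topspace X" "\<phi> t x \<in> N" by blast
      then have "q x = q (\<phi> t x)" using eq_iff[of x "\<phi> t x"] clos by blast
      then show "x \<in> {x \<in> topspace X. q x \<in> q ` N}" using t by blast
    next
      fix x assume "x \<in> {x \<in> topspace X. q x \<in> q ` N}"
      then obtain v where v: "x \<in> topspace X" "v \<in> N" "q x = q v" by blast
      then obtain t where "t \<in> padic_carrier p" "v = \<phi> t x" using eq_iff[of x v] NX by blast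
      then show "x \<in> (\<Union>t\<in>padic_carrier p. {x \<in> topspace X. \<phi> t x \<in> N})" using v by blast
    qed
    moreover have "q ` N \<subseteq> orbits ?P (topspace X) \<phi>" using NX unfolding orbits_def q_def by blast
    ultimately show "openin ?O (q ` N)" unfolding openin_orbit_space q_def by simp
  qed
  have hinj: "inj_on h (topspace ?O)" by (rule homeomorphic_imp_injective_map[OF h])
  have hsurj: "h ` topspace ?O = topspace Y" by (rule homeomorphic_imp_surjective_map[OF h])
  have hc: "continuous_map ?O Y h" by (rule homeomorphic_imp_continuous_map[OF h])
  have ho: "open_map ?O Y h" by (rule homeomorphic_imp_open_map[OF h])
  have "padic_bundle p X Y \<phi> (h \<circ> q)"
  proof
    show "continuous_map X Y (h \<circ> q)" by (rule continuous_map_compose[OF qc hc])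
    show "open_map X Y (h \<circ> q)" by (rule open_map_compose[OF qopen ho])
    show "(h \<circ> q) ` topspace X = topspace Y" by (simp only: image_comp[symmetric] qO hsurj)
    show "(h \<circ> q) x = (h \<circ> q) y \<longleftrightarrow> (\<exists>t\<in>padic_carrier p. y = \<phi> t x)" if "x \<in> topspace X" "y \<in> topspace X" for x y
    proof -
      have "q x \<in> topspace ?O" "q y \<in> topspace ?O" using qO that by blast+
      then show ?thesis using eq_iff[OF that] inj_on_eq_iff[OF hinj] by simp
    qed
    show "t = \<one>\<^bsub>?P\<^esub>" if "t \<in> padic_carrier p" "x \<in> topspace X" "\<phi> t x = x" for t x
      using free that unfolding free_action_def stabilizer_def by auto
  qed (use p X clos one mult cont in auto)
  then show ?thesis by blast
qed

section \<open>A Pruefer subgroup in the second cohomology of the orbit space\<close>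

theorem theorem1p6:
  fixes X :: "'a topology" and Y :: "'b topology" and p n :: nat
  assumes "prime p"
    and "compactum X" and "compactum Y"
    and "covering_dim X = ereal (real n)"
    and "p_resolvable_by p Y X"
    and "covering_dim Y \<ge> ereal (real (n + 2))"
  shows "\<exists>H. subgroup H (cech_cohomology 2 Y) \<and>
             (cech_cohomology 2 Y) \<lparr>carrier := H\<rparr> \<cong> prufer_group p \<and>
             (\<forall>A. closedin Y A \<and> covering_dim (subtopology Y A) \<ge> ereal (real (n + 2)) \<longrightarrow>
                cech_map 2 (subtopology Y A) id ` H \<noteq> {\<one>\<^bsub>cech_cohomology 2 (subtopology Y A)\<^esub>})"
proof -
  have X: "compact_space X" "metrizable_space X" and Y: "metrizable_space Y"
    using assms(2,3) by (auto simp: compactum_def)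
  obtain \<phi> \<pi> where "padic_bundle p X Y \<phi> \<pi>"
    using resolvable_bundle[OF prime_gt_1_nat[OF assms(1)] X(1) assms(5)] by blast
  then interpret B: padic_bundle p X Y \<phi> \<pi> .
  obtain M d where "Metric_space M d" "X = Metric_space.mtopology M d"
    using X(2) unfolding metrizable_space_def by blast
  then have "mtopology_of (metric (M, d)) = X"
    using Metric_space.mtopology_of by metis
  then interpret B: metric_padic_bundle p X Y \<phi> \<pi> "metric (M, d)" by unfold_locales
  have dim: "covering_dim_le X (int n)" by (rule covering_dim_eqD[OF assms(4)])
  have sep: "normal_space (subtopology Y A)" "t1_space (subtopology Y A)" for A
    using metrizable_space_subtopology[OF Y, of A] metrizable_imp_normal_space metrizable_imp_t1_space by blast+
  let ?b = B.bockstein_class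
  have large: "\<not> covering_dim (subtopology Y A) \<ge> ereal (real (n + 2))"
    if A: "closedin Y A" and triv: "\<And>k. \<exists>\<W> r \<mu>. open_cover (subtopology Y A) \<W> \<and> r \<in> projections id \<W> (B.chart_cover k) \<and>
           cobounds \<W> \<mu> (\<lambda>a b c. B.bockstein k [r a, r b, r c])" for A
  proof
    assume "ereal (real (n + 2)) \<le> covering_dim (subtopology Y A)"
    also have "\<dots> \<le> ereal (real (n + 1))" by (rule B.dimension_of_trivial_part[OF dim A sep triv])
    finally show False by simp
  qed
  have "\<exists>j. ?b j \<noteq> \<one>\<^bsub>cech_cohomology 2 Y\<^esub>"
  proof (rule ccontr)
    assume "\<not> (\<exists>j. ?b j \<noteq> \<one>\<^bsub>cech_cohomology 2 Y\<^esub>)"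
    then have "cech_cocycle_class Y (B.chart_cover k) (B.bockstein k) \<subseteq> \<one>\<^bsub>cech_cohomology 2 Y\<^esub>" for k
      unfolding B.bockstein_class_def by blast
    from cech_cocycle_class_trivialD[OF B.open_cover_charts B.bockstein_cocycle this]
    have "\<not> covering_dim (subtopology Y (topspace Y)) \<ge> ereal (real (n + 2))"
      by (intro large) simp_all
    then show False using assms(6) by simp
  qed
  then obtain j where j: "?b j \<noteq> \<one>\<^bsub>cech_cohomology 2 Y\<^esub>" by blast
  obtain H where H: "subgroup H (cech_cohomology 2 Y)" "(cech_cohomology 2 Y) \<lparr>carrier := H\<rparr> \<cong> prufer_group p" "range ?b \<subseteq> H"
    using prufer_subgroup_of_tower[OF comm_group_cech assms(1) B.bockstein_class_closed B.bockstein_class_0 B.bockstein_class_step j] by blast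
  have "cech_map 2 (subtopology Y A) id ` H \<noteq> {\<one>\<^bsub>cech_cohomology 2 (subtopology Y A)\<^esub>}"
    if A: "closedin Y A" and big: "covering_dim (subtopology Y A) \<ge> ereal (real (n + 2))" for A
  proof
    assume im: "cech_map 2 (subtopology Y A) id ` H = {\<one>\<^bsub>cech_cohomology 2 (subtopology Y A)\<^esub>}"
    have "cech_map 2 (subtopology Y A) id (?b k) = \<one>\<^bsub>cech_cohomology 2 (subtopology Y A)\<^esub>" for k
      using im H(3) by blast
    from cech_restriction_trivialD[OF closedin_subset[OF A] B.open_cover_charts B.bockstein_cocycle this[unfolded B.bockstein_class_def]]
    have "\<not> covering_dim (subtopology Y A) \<ge> ereal (real (n + 2))" by (intro large[OF A])
    then show False using big by simp
  qed
  then show ?thesis using H(1,2) by blast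
qed

end
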